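(* Let $(X_p,T_p,\mu_q)$, $q\in(0,1/a_0)$, be a polynomial adic system and let $g$ be a cylindric function of rank $N$ which is not cohomologous to a constant in $L^\infty(X_p,\mu_q)$. Then for $\mu_q$-a.e. $x\in X_p$ there is a sequence $n_j\to\infty$ such that $R^g_{n_j,k_{n_j}(x)}>0$ for all $j$ and the functions $\varphi^g_{n_j,k_{n_j}(x)}$ converge uniformly on $[0,1]$ to a continuous function.
   Context: Let $p(x)=a_0+a_1x+\dots+a_dx^d$, $d\ge1$, all $a_i$ positive integers, $r=p(1)$. The diagram $B_p$ has vertices $(n,k)$, $n\ge0$, $0\le k\le nd$; for every $n,k$ and $0\le j\le d$, $(n,k)$ and $(n+1,k+j)$ are joined by $a_j$ edges (edges of type $j$). Edges entering a vertex are linearly ordered canonically: first the $a_d$ edges of type $d$, then those of type $d-1$, ..., last the $a_0$ edges of type $0$ (parallel edges in a fixed order). $X_p$ is the set of infinite paths $x=(x_1,x_2,\dots)$ from $(0,0)$; $(n,k_n(x))$ is the vertex of $x$ at level $n$. Paths agreeing from some index on are compared by: $x\prec y$ iff at the largest index $i$ with $x_i\ne y_i$, $x_i$ precedes $y_i$; the same rule orders finite paths to a common vertex. $T_p x$ is the successor of $x$, defined off the maximal and minimal paths. $H_{n,k}=C_p(n,k)$, the coefficient of $x^k$ in $p(x)^n$, is the number of paths from $(0,0)$ to $(n,k)$; the tower $\tau_{n,k}$ consists of the cylinders $\tau_{n,k}(j)=[c_1\dots c_n]$, where $c$ is the $j$-th finite path to $(n,k)$. For $q\in(0,1/a_0)$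 let $t_q\in(0,1)$ be the unique solution of $a_0q^d+a_1q^{d-1}t+\dots+a_dt^d=q^{d-1}$; $\mu_q$ is the product measure on $X_p$ under which the $x_n$ are independent and every edge of type $j$ has probability $t_q^j/q^{j-1}$; it is $T_p$-invariant and ergodic; $(X_p,T_p,\mu_q)$ is the polynomial adic system. A cylindric function of rank $N$ is constant on every cylinder $[c_1\dots c_N]$; for $n\ge N$ write $g(\tau_{n,k}(i))$ for its value on $\tau_{n,k}(i)$. $F^g_{n,k}(j)=\sum_{i=1}^jg(\tau_{n,k}(i))$, $0\le j\le H_{n,k}$, linearly interpolated on $[0,H_{n,k}]$; $R^g_{n,k}=\max_{t\in[0,1]}|F^g_{n,k}(tH_{n,k})-tF^g_{n,k}(H_{n,k})|$; if $R^g_{n,k}>0$, $\varphi^g_{n,k}(t)=(F^g_{n,k}(tH_{n,k})-tF^g_{n,k}(H_{n,k}))/R^g_{n,k}$. $g$ is cohomologous to a constant in $L^\infty$ if $g=c+h\circ T_p-h$ a.e. for some $c\in\mathbb R$, $h\in L^\infty$. *)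

theory Defs
  imports "HOL-Probability.Probability" "HOL-Computational_Algebra.Polynomial"
begin

text \<open>An edge of the diagram B_p from level n to level n+1 is encoded by its label (j, m):
  j = type (0 \<le> j \<le> d), m = index among the a_j parallel edges (m < a_j).
  Given the source vertex, the label determines the edge.  An infinite path from (0,0)
  is a sequence x :: nat \<Rightarrow> nat \<times> nat; x i is the edge from level i to level i+1
  (the paper's x_(i+1)).\<close>

type_synonym label = "nat \<times> nat"
type_synonym path = "nat \<Rightarrow> label"

definition valid_label :: "nat poly \<Rightarrow> label \<Rightarrow> bool" where
  "valid_label p e \<longleftrightarrow> fst e \<le> degree p \<and> snd e < coeff p (fst e)"

definition valid_path :: "nat poly \<Rightarrow> path \<Rightarrow> bool" where
  "valid_path p x \<longleftrightarrow> (\<forall>i. valid_label p (x i))"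

text \<open>k_n(x): second coordinate of the vertex of x at level n.\<close>
definition kk :: "path \<Rightarrow> nat \<Rightarrow> nat" where
  "kk x n = (\<Sum>i<n. fst (x i))"

text \<open>Canonical order of edges entering a common vertex: higher type first;
  parallel edges ordered by index.\<close>
definition edge_less :: "label \<Rightarrow> label \<Rightarrow> bool" where
  "edge_less e e' \<longleftrightarrow> fst e > fst e' \<or> (fst e = fst e' \<and> snd e < snd e')"

definition path_less :: "path \<Rightarrow> path \<Rightarrow> bool" where
  "path_less x y \<longleftrightarrow> (\<exists>i. x i \<noteq> y i \<and> (\<forall>l>i. x l = y l) \<and> kk x (Suc i) = kk y (Suc i)
       \<and> edge_less (x i) (y i))"

text \<open>The adic transformation: successor of x (defined off maximal paths).\<close>
definition Tp :: "nat poly \<Rightarrow> path \<Rightarrow> path" where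
  "Tp p x = (THE y. valid_path p y \<and> path_less x y \<and>
       \<not> (\<exists>z. valid_path p z \<and> path_less x z \<and> path_less z y))"

definition tq :: "nat poly \<Rightarrow> real \<Rightarrow> real" where
  "tq p q = (THE t. 0 < t \<and> t < 1 \<and>
      (\<Sum>j\<le>degree p. real (coeff p j) * q ^ (degree p - j) * t ^ j) = q ^ (degree p - 1))"

text \<open>Distribution of a single edge: each edge of type j has probability t^j / q^(j-1)
  = q * (t/q)^j.\<close>
definition edge_measure :: "nat poly \<Rightarrow> real \<Rightarrow> label measure" where
  "edge_measure p q = density (count_space UNIV)
      (\<lambda>e. if valid_label p e then ennreal (q * (tq p q / q) ^ fst e) else 0)"

definition mu :: "nat poly \<Rightarrow> real \<Rightarrow> path measure" where
  "mu p q = (\<Pi>\<^sub>M i\<in>UNIV. edge_measure p q)"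

definition cylindric :: "(path \<Rightarrow> real) \<Rightarrow> nat \<Rightarrow> bool" where
  "cylindric g N \<longleftrightarrow> (\<forall>x y. (\<forall>i<N. x i = y i) \<longrightarrow> g x = g y)"

definition cohomologous_const :: "nat poly \<Rightarrow> real \<Rightarrow> (path \<Rightarrow> real) \<Rightarrow> bool" where
  "cohomologous_const p q g \<longleftrightarrow> (\<exists>c h. h \<in> borel_measurable (mu p q) \<and>
      (\<exists>B. AE x in mu p q. \<bar>h x\<bar> \<le> B) \<and>
      (AE x in mu p q. g x = c + h (Tp p x) - h x))"

definition fin_paths :: "nat poly \<Rightarrow> nat \<Rightarrow> nat \<Rightarrow> label list set" where
  "fin_paths p n k = {c. length c = n \<and> (\<forall>e\<in>set c. valid_label p e) \<and> sum_list (map fst c) = k}"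

definition fin_less :: "label list \<Rightarrow> label list \<Rightarrow> bool" where
  "fin_less c c' \<longleftrightarrow> (\<exists>i<length c. c ! i \<noteq> c' ! i \<and>
      (\<forall>l. i < l \<and> l < length c \<longrightarrow> c ! l = c' ! l) \<and> edge_less (c ! i) (c' ! i))"

definition H :: "nat poly \<Rightarrow> nat \<Rightarrow> nat \<Rightarrow> nat" where
  "H p n k = coeff (p ^ n) k"

text \<open>The j-th (1-based) finite path to (n,k).\<close>
definition tau :: "nat poly \<Rightarrow> nat \<Rightarrow> nat \<Rightarrow> nat \<Rightarrow> label list" where
  "tau p n k j = (THE c. c \<in> fin_paths p n k \<and>
      card {c' \<in> fin_paths p n k. fin_less c' c} = j - 1)"

text \<open>Value of g on the cylinder tau_{n,k}(i) (meaningful for n \<ge> rank of g).\<close>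
definition gval :: "nat poly \<Rightarrow> (path \<Rightarrow> real) \<Rightarrow> nat \<Rightarrow> nat \<Rightarrow> nat \<Rightarrow> real" where
  "gval p g n k i = g (\<lambda>l. if l < n then tau p n k i ! l else (0, 0))"

definition Fdisc :: "nat poly \<Rightarrow> (path \<Rightarrow> real) \<Rightarrow> nat \<Rightarrow> nat \<Rightarrow> nat \<Rightarrow> real" where
  "Fdisc p g n k j = (\<Sum>i\<in>{1..j}. gval p g n k i)"

definition Fint :: "nat poly \<Rightarrow> (path \<Rightarrow> real) \<Rightarrow> nat \<Rightarrow> nat \<Rightarrow> real \<Rightarrow> real" where
  "Fint p g n k s = (let m = nat \<lfloor>s\<rfloor> in
      if m \<ge> H p n k then Fdisc p g n k (H p n k)
      else Fdisc p g n k m + (s - real m) * (Fdisc p g n k (Suc m) - Fdisc p g n k m))"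

definition Rg :: "nat poly \<Rightarrow> (path \<Rightarrow> real) \<Rightarrow> nat \<Rightarrow> nat \<Rightarrow> real" where
  "Rg p g n k = (SUP t\<in>{0..1}. \<bar>Fint p g n k (t * real (H p n k)) - t * Fint p g n k (real (H p n k))\<bar>)"

definition phi :: "nat poly \<Rightarrow> (path \<Rightarrow> real) \<Rightarrow> nat \<Rightarrow> nat \<Rightarrow> real \<Rightarrow> real" where
  "phi p g n k t = (Fint p g n k (t * real (H p n k)) - t * Fint p g n k (real (H p n k))) / Rg p g n k"

end

theory Submission
  imports Defs "HOL-Complex_Analysis.Great_Picard"
begin

text \<open>
  Write F for the polygon of partial sums over a tower. Along the last edges of its paths, the
  tower over (n,k) is a concatenation of towers over (n-m,l), so the fluctuations of the normalised
  polygon are controlled by two things: the totals h(n',k') - lambda H(n',k') over subtowers, where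
  lambda is the mean of g over the whole tower, and the relative lengths of the subtowers.

  With w = t_q/q and f(x) = q p(wx), a probability generating function, the rescaled totals are
  coefficients of a fixed polynomial times a power of f. If the polynomial that collects the sums
  of g over the towers of level N is a multiple of p^N, then the partial sums of g - c over the
  towers of level N form a bounded transfer function and g is cohomologous to c. Otherwise, after
  subtracting the right c, the rescaled polynomial is (x-1)^s E(x) with s >= 1 and E(1) nonzero.
  Fourier inversion gives a local limit theorem for the coefficients of (x-1)^r E(x) f(x)^n with
  profile Psi r, the r-th derivative of a Gaussian up to sign. It shows that, while
  z = (k - n mean)/sqrt n stays in a fixed interval to the right of all zeros of Psi (s-1), the range
  R of the polygon is at least a constant times rho(n,k) = (sqrt n)^(-s-2) q^(-n) w^(-k), whereas the
  polygons over the towers m levels below have size at most rho(n,k) times the tail of a convergent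
  series. Hence the normalised polygons are equicontinuous and Arzela-Ascoli applies. By the
  local limit theorem and Kolmogorov's 0-1 law almost every path visits the interval infinitely often.
\<close>


section \<open>Polygons of partial sums\<close>

text \<open>The obstacle is that the upper and lower bounds must have the same order in n although
  leading terms cancel. Let U and P be the rescaled total of g - c and the rescaled height of a
  tower. Both U(n-1,k) and (U(n,k)/P(n,k)) P(n-1,k) have order (sqrt n)^(-s-1), but the polygon sees
  only their difference, of order (sqrt n)^(-s-2). So R is bounded below through the determinant
  U(n-1,k) P(n,k) - U(n,k) P(n-1,k). The three-term recurrence for \<open>Psi\<close> cancels
  everything in its limit except a multiple of Psi 0 * Psi (s-1), which explains the index s-1. The
  window [s + var, s + var + 1] is taken because there the recurrence alone makes Psi r
  nondecreasing in r for r up to s, so no zero has to be located. For the upper bounds, a difference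
  of totals along one edge carries an extra factor x^i - f, which vanishes at 1 and gains 1/sqrt n;
  m such steps cost a power of m, absorbed by the geometric weight of a subtower. At each large
  level the window is visited only with probability bounded below by a positive constant, hence the
  0-1 law.\<close>

text \<open>The polygon through the points (i, b_0 + ... + b_(i-1)), constant outside [0, length bs].\<close>

fun PL :: "real list \<Rightarrow> real \<Rightarrow> real" where
  "PL [] s = 0"
| "PL (b # bs) s = b * max 0 (min 1 s) + PL bs (s - 1)"

lemma PL_nonpos: "s \<le> 0 \<Longrightarrow> PL bs s = 0"
  by (induction bs arbitrary: s) auto

lemma PL_ge_length: "s \<ge> real (length bs) \<Longrightarrow> PL bs s = sum_list bs"
  by (induction bs arbitrary: s) auto

lemma PL_append: "PL (bs @ cs) s = PL bs s + PL cs (s - real (length bs))"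
  by (induction bs arbitrary: s) (auto simp: algebra_simps)

lemma PL_eq_take:
  "m < length bs \<Longrightarrow> real m \<le> s \<Longrightarrow> s < real m + 1 \<Longrightarrow>
    PL bs s = sum_list (take m bs) + (s - real m) * bs ! m"
proof (induction bs arbitrary: s m)
  case (Cons b bs)
  show ?case
  proof (cases m)
    case 0
    then show ?thesis using Cons.prems by (simp add: PL_nonpos)
  next
    case (Suc l)
    then have "PL bs (s - 1) = sum_list (take l bs) + (s - 1 - real l) * bs ! l"
      using Cons.prems by (intro Cons.IH) auto
    then show ?thesis using Suc Cons.prems by (simp add: algebra_simps)
  qed
qed simp

lemma PL_map_minus:
  assumes "0 \<le> s" "s \<le> real (length bs)"
  shows "PL (map (\<lambda>b. b - c) bs) s = PL bs s - c * s"
  using assms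
proof (induction bs arbitrary: s)
  case (Cons b bs)
  show ?case
  proof (cases "s \<le> 1")
    case True
    then show ?thesis using Cons.prems by (simp add: PL_nonpos algebra_simps)
  next
    case False
    then show ?thesis using Cons.prems Cons.IH[of "s - 1"] by (simp add: algebra_simps)
  qed
qed simp

lemma continuous_on_PL: "continuous_on A (PL bs)"
proof -
  have "continuous_on UNIV (PL bs)"
  proof (induction bs)
    case (Cons b bs)
    have "continuous_on UNIV (\<lambda>s. PL bs (s - 1))"
      by (rule continuous_on_compose2[OF Cons.IH]) (auto intro!: continuous_intros)
    then show ?case by (auto intro!: continuous_intros simp: PL.simps[abs_def])
  qed (simp add: PL.simps[abs_def])
  then show ?thesis by (rule continuous_on_subset) simp
qed

text \<open>A point lies in one block: the blocks to its left enter through their totals, its own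
  block through its polygon, which is at most \<open>Y\<close>, and the later ones still vanish.
  Totals and \<open>Y\<close> are kept apart because the bound is iterated over levels.\<close>

lemma abs_PL_concat_le:
  assumes "\<And>b s. b \<in> set bs \<Longrightarrow> \<bar>PL b s\<bar> \<le> Y" "Y \<ge> 0"
  shows "\<bar>PL (concat bs) s\<bar> \<le> (\<Sum>b\<leftarrow>bs. \<bar>sum_list b\<bar>) + Y"
  using assms(1)
proof (induction bs arbitrary: s)
  case Nil
  then show ?case using assms(2) by simp
next
  case (Cons b bs)
  have IH: "\<bar>PL (concat bs) s\<bar> \<le> (\<Sum>b\<leftarrow>bs. \<bar>sum_list b\<bar>) + Y" for s
    using Cons by simp
  have nn: "(\<Sum>b\<leftarrow>bs. \<bar>sum_list b\<bar>) \<ge> 0" by (intro sum_list_nonneg) auto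
  show ?case
  proof (cases "s \<le> real (length b)")
    case True
    then have "PL (concat (b # bs)) s = PL b s" by (simp add: PL_append PL_nonpos)
    moreover have "\<bar>PL b s\<bar> \<le> Y" using Cons.prems by simp
    ultimately show ?thesis using nn by simp
  next
    case False
    then have "PL (concat (b # bs)) s = sum_list b + PL (concat bs) (s - real (length b))"
      by (simp add: PL_append PL_ge_length)
    then show ?thesis using IH[of "s - real (length b)"] by simp
  qed
qed

text \<open>A window not longer than any block meets at most two adjacent blocks. Across a boundary
  the increment is the whole first block, minus its value at \<open>s\<close>, plus an initial piece
  of the second; hence the factor 3.\<close>

lemma PL_concat_window:
  assumes "\<And>b s. b \<in> set bs \<Longrightarrow> \<bar>PL b s\<bar> \<le> Y" "Y \<ge> 0"
    and "\<And>b. b \<in> set bs \<Longrightarrow> D \<le> real (length b)"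
    and "s \<le> t" "t \<le> s + D"
  shows "\<bar>PL (concat bs) t - PL (concat bs) s\<bar> \<le> 3 * Y"
  using assms(1,3,4,5)
proof (induction bs arbitrary: s t)
  case Nil
  then show ?case using assms(2) by simp
next
  case (Cons b bs)
  let ?l = "real (length b)"
  have b: "\<bar>PL b s\<bar> \<le> Y" for s using Cons.prems by simp
  \<comment> \<open>Up to \<open>D\<close> the polygon of the remaining blocks has not left the
    first of them.\<close>
  have head: "\<bar>PL (concat bs) u\<bar> \<le> Y" if "u \<le> D" for u
  proof (cases bs)
    case Nil then show ?thesis using assms(2) by simp
  next
    case (Cons c cs)
    then have "D \<le> real (length c)" "\<bar>PL c u\<bar> \<le> Y" using Cons.prems by auto
    then show ?thesis using that \<open>bs = c # cs\<close> by (simp add: PL_append PL_nonpos)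
  qed
  consider "s \<ge> ?l" | "t \<le> ?l" | "s < ?l" "?l < t" by linarith
  then show ?case
  proof cases
    case 1
    then have "\<bar>PL (concat bs) (t - ?l) - PL (concat bs) (s - ?l)\<bar> \<le> 3 * Y"
      using Cons.prems by (intro Cons.IH) auto
    then show ?thesis using 1 Cons.prems by (simp add: PL_append PL_ge_length)
  next
    case 2
    then have "PL (concat (b # bs)) t - PL (concat (b # bs)) s = PL b t - PL b s"
      using Cons.prems by (simp add: PL_append PL_nonpos)
    then show ?thesis using b[of t] b[of s] assms(2) by linarith
  next
    case 3
    then have "PL (concat (b # bs)) t - PL (concat (b # bs)) s = PL b t + PL (concat bs) (t - ?l) - PL b s"
      by (simp add: PL_append PL_nonpos)
    moreover have "\<bar>PL (concat bs) (t - ?l)\<bar> \<le> Y"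
      using 3 Cons.prems by (intro head) auto
    ultimately show ?thesis using b[of t] b[of s] by linarith
  qed
qed

section \<open>Local limit theorem for coefficients\<close>

lemma integral_cis_int:
  fixes m :: int
  shows "(CLINT \<theta>|lborel. indicator {-pi..pi} \<theta> *\<^sub>R cis (of_int m * \<theta>)) = (if m = 0 then 2 * pi else 0)"
proof (cases "m = 0")
  case True
  have "(CLINT \<theta>|lborel. indicator {-pi..pi} \<theta> *\<^sub>R (1::complex)) = of_real (2 * pi)"
    by (simp add: scaleR_conv_of_real)
  then show ?thesis using True by simp
next
  case False
  have "(CLINT \<theta>|lborel. indicator {-pi..pi} \<theta> *\<^sub>R cis (of_int m * \<theta>))
     = cis (of_int m * pi) / (\<i> * of_int m) - cis (of_int m * (-pi)) / (\<i> * of_int m)"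
  proof (rule integral_FTC_atLeastAtMost)
    fix x :: real
    have "((\<lambda>x. (\<lambda>y. exp (\<i> * (of_int m * y)) / (\<i> * of_int m)) (of_real x)) has_vector_derivative cis (of_int m * x)) (at x within {-pi..pi})"
      by (rule has_vector_derivative_real_field, unfold cis_conv_exp)
        (rule derivative_eq_intros refl | simp add: False field_simps)+
    then show "((\<lambda>x. cis (of_int m * x) / (\<i> * of_int m)) has_vector_derivative cis (of_int m * x)) (at x within {-pi..pi})"
      by (simp add: cis_conv_exp)
  next
    show "continuous_on {- pi..pi} (\<lambda>x. cis (real_of_int m * x))"
      by (intro continuous_intros)
  qed simp
  also have "cis (of_int m * (-pi)) = cis (of_int m * pi)"
    by (simp add: complex_eq_iff sin_zero_iff_int2)
  finally show ?thesis using False by simp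
qed

lemma integrable_indicator_continuous:
  fixes h :: "real \<Rightarrow> complex"
  assumes "continuous_on UNIV h"
  shows "integrable lborel (\<lambda>\<theta>. indicator {a..b} \<theta> *\<^sub>R h \<theta>)"
  using borel_integrable_compact[of "{a..b}" h] assms continuous_on_subset by blast

text \<open>Fourier inversion on the circle: by orthogonality only the frequency of
  \<open>coeff A k\<close> survives.\<close>

lemma coeff_eq_integral:
  fixes A :: "real poly"
  shows "of_real (coeff A k) = (1 / (2 * pi)) *
     (CLINT \<theta>|lborel. indicator {-pi..pi} \<theta> *\<^sub>R (poly (map_poly of_real A) (cis \<theta>) * cis (- (real k * \<theta>))))"
proof -
  have eq: "poly (map_poly of_real A) (cis \<theta>) * cis (- (real k * \<theta>))
     = (\<Sum>i\<le>degree A. of_real (coeff A i) * cis (of_int (int i - int k) * \<theta>))" for \<theta>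
    by (simp add: poly_altdef degree_map_poly coeff_map_poly sum_distrib_right mult.assoc
        Complex.DeMoivre cis_mult left_diff_distrib)
  have "(CLINT \<theta>|lborel. indicator {-pi..pi} \<theta> *\<^sub>R (poly (map_poly of_real A) (cis \<theta>) * cis (- (real k * \<theta>))))
    = (CLINT \<theta>|lborel. (\<Sum>i\<le>degree A. of_real (coeff A i) * (indicator {-pi..pi} \<theta> *\<^sub>R cis (of_int (int i - int k) * \<theta>))))"
    by (simp add: eq scaleR_sum_right)
  also have "\<dots> = (\<Sum>i\<le>degree A. of_real (coeff A i) * (CLINT \<theta>|lborel. indicator {-pi..pi} \<theta> *\<^sub>R cis (of_int (int i - int k) * \<theta>)))"
  proof (subst Bochner_Integration.integral_sum)
    show "integrable lborel (\<lambda>\<theta>. of_real (coeff A i) * (indicator {-pi..pi} \<theta> *\<^sub>R cis (of_int (int i - int k) * \<theta>)))" for i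
      by (intro integrable_mult_right integrable_indicator_continuous continuous_intros)
  qed (simp only: integral_mult_right_zero)
  also have "\<dots> = (\<Sum>i\<le>degree A. if i = k then complex_of_real (coeff A i) * complex_of_real (2 * pi) else 0)"
    unfolding integral_cis_int by (intro sum.cong) auto
  also have "\<dots> = of_real (coeff A k) * (2 * pi)"
    by (auto simp: sum.delta coeff_eq_0)
  finally show ?thesis by simp
qed

text \<open>Taylor's formula gives cos t \<le> 1 - t^2/2 + t^4/24. On the interval t^2 < 10.3, so
  the quartic term is below 0.43 t^2, which leaves more than t^2/20.\<close>

lemma one_minus_cos_ge:
  fixes t :: real
  assumes "\<bar>t\<bar> \<le> pi"
  shows "1 - cos t \<ge> t\<^sup>2 / 20"
proof -
  have pi: "pi < 3.2" using pi_approx by simp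
  have *: "1 - cos t \<ge> t\<^sup>2 / 20" if "0 < t" "t \<le> pi" for t :: real
  proof -
    obtain u where u: "cos t = (\<Sum>m<4. cos_coeff m * t ^ m) + cos (u + 1/2 * real 4 * pi) / fact 4 * t ^ 4"
      using Maclaurin_cos_expansion2[OF \<open>0 < t\<close>, of 4] by auto
    have s: "(\<Sum>m<4. cos_coeff m * t ^ m) = 1 - t\<^sup>2 / 2"
    proof -
      have "{..<4::nat} = {0, 1, 2, 3}" by auto
      then show ?thesis by (simp add: cos_coeff_def)
    qed
    have "cos (u + 1/2 * real 4 * pi) / fact 4 * t ^ 4 \<le> 1 / 24 * t ^ 4"
      by (intro mult_right_mono) (auto simp: fact_numeral)
    then have "cos t \<le> 1 - t\<^sup>2 / 2 + t ^ 4 / 24" using u s by simp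
    moreover have "t\<^sup>2 \<le> 3.2\<^sup>2" using that pi by (intro power_mono) auto
    then have "t\<^sup>2 * t\<^sup>2 \<le> t\<^sup>2 * 10.3" by (intro mult_left_mono) (auto simp: power2_eq_square)
    then have "t ^ 4 \<le> 10.3 * t\<^sup>2" by (simp add: power2_eq_square power4_eq_xxxx mult.assoc)
    ultimately show ?thesis using zero_le_power2[of t] by linarith
  qed
  show ?thesis
    using *[of t] *[of "-t"] assms by (cases "t = 0"; cases "t > 0"; auto)
qed

section \<open>Gaussian Fourier integrals and their three-term recurrence\<close>

lemma integrable_gaussian_moment:
  fixes c :: real
  assumes "c > 0"
  shows "integrable lborel (\<lambda>v. \<bar>v\<bar> ^ r * exp (- (c * v\<^sup>2)))"
proof -
  define b where "b = sqrt (2 * c)"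
  have b: "b > 0" "b\<^sup>2 = 2 * c" using assms by (auto simp: b_def)
  have "integrable lborel (\<lambda>x. std_normal_density (0 + b * x) * \<bar>0 + b * x\<bar> ^ r)"
    by (rule lborel_integrable_real_affine[OF integrable_std_normal_moment_abs]) (use b in auto)
  then have "integrable lborel (\<lambda>x. (sqrt (2 * pi) / b ^ r) * (std_normal_density (0 + b * x) * \<bar>0 + b * x\<bar> ^ r))"
    by (rule integrable_mult_right)
  moreover have "(sqrt (2 * pi) / b ^ r) * (std_normal_density (0 + b * x) * \<bar>0 + b * x\<bar> ^ r) = \<bar>x\<bar> ^ r * exp (- (c * x\<^sup>2))" for x
    using b by (simp add: normal_density_def power_mult_distrib abs_mult)
  ultimately show ?thesis by simp
qed

lemma integrable_gaussian_moment_cis: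
  fixes c z :: real
  assumes "c > 0"
  shows "integrable lborel (\<lambda>v. cis (- (z * v)) * (\<i> * of_real v) ^ r * of_real (exp (- (c * v\<^sup>2))))"
proof (rule Bochner_Integration.integrable_bound[OF integrable_gaussian_moment[OF assms, of r]])
  show "(\<lambda>v. cis (- (z * v)) * (\<i> * of_real v) ^ r * of_real (exp (- (c * v\<^sup>2)))) \<in> borel_measurable lborel"
  proof -
    have "continuous_on UNIV (\<lambda>v. cis (- (z * v)) * (\<i> * of_real v) ^ r * of_real (exp (- (c * v\<^sup>2))))"
      by (intro continuous_intros)
    then show ?thesis using borel_measurable_continuous_onI by simp
  qed
qed (simp add: norm_mult norm_power)

text \<open>The powers of \<open>\<i> v\<close> are the limits of the factors x - 1: on the circle
  at angle v / sqrt n, such a factor times sqrt n tends to \<open>\<i> v\<close>. The parameter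
  \<open>c\<close> will be the variance.\<close>

definition gauss_int :: "real \<Rightarrow> nat \<Rightarrow> real \<Rightarrow> complex" where
  "gauss_int c r z = (CLINT v|lborel. cis (- (z * v)) * (\<i> * of_real v) ^ r * of_real (exp (- (c * v\<^sup>2 / 2))))"

lemma gauss_int_0:
  assumes "c > 0"
  shows "gauss_int c 0 z = of_real (sqrt (2 * pi / c) * exp (- (z\<^sup>2 / (2 * c))))"
proof -
  define b where "b = sqrt c"
  have b: "b > 0" "b\<^sup>2 = c" using assms by (auto simp: b_def)
  have "of_real (exp (- ((- z / b)\<^sup>2) / 2)) = char std_normal_distribution (- z / b)"
    by (simp add: char_std_normal_distribution)
  also have "\<dots> = (CLINT x|lborel. std_normal_density x *\<^sub>R iexp ((- z / b) * x))"
    unfolding char_def by (subst integral_density) auto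
  also have "\<dots> = \<bar>b\<bar> *\<^sub>R (CLINT x|lborel. std_normal_density (0 + b * x) *\<^sub>R iexp ((- z / b) * (0 + b * x)))"
    by (rule lborel_integral_real_affine) (use b in auto)
  also have "(\<lambda>x. std_normal_density (0 + b * x) *\<^sub>R iexp ((- z / b) * (0 + b * x)))
     = (\<lambda>x. of_real (1 / sqrt (2 * pi)) * (cis (- (z * x)) * (\<i> * of_real x) ^ 0 * of_real (exp (- (c * x\<^sup>2 / 2)))))"
    using b by (auto simp: fun_eq_iff normal_density_def scaleR_conv_of_real cis_conv_exp power_mult_distrib)
  also have "\<bar>b\<bar> *\<^sub>R (CLINT x|lborel. of_real (1 / sqrt (2 * pi)) * (cis (- (z * x)) * (\<i> * of_real x) ^ 0 * of_real (exp (- (c * x\<^sup>2 / 2)))))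
      = of_real (b / sqrt (2 * pi)) * gauss_int c 0 z"
    unfolding gauss_int_def using b by (simp add: scaleR_conv_of_real)
  finally have "gauss_int c 0 z * of_real (b / sqrt (2 * pi)) = of_real (exp (- (z\<^sup>2 / (2 * c))))"
    using b by (simp add: power_divide mult.commute)
  moreover have "sqrt (2 * pi / c) * (b / sqrt (2 * pi)) = 1"
    using b assms by (simp add: real_sqrt_divide b_def)
  ultimately have "gauss_int c 0 z * of_real (b / sqrt (2 * pi))
     = of_real (sqrt (2 * pi / c) * exp (- (z\<^sup>2 / (2 * c)))) * of_real (b / sqrt (2 * pi))"
    by (metis (no_types, opaque_lifting) mult.commute mult.left_commute mult_1 of_real_mult)
  moreover have "b / sqrt (2 * pi) \<noteq> 0" using b by simp
  ultimately show ?thesis by (metis mult_right_cancel of_real_eq_0_iff)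
qed

text \<open>The derivative of the integrand integrates to 0 over the line; differentiating the
  power, the phase and the Gaussian gives the three terms. This is the Hermite recurrence. For r = 0
  the term with \<open>r - 1\<close> has coefficient 0, so the truncated subtraction does no
  harm.\<close>

lemma gauss_int_Suc:
  assumes "c > 0"
  shows "of_real c * gauss_int c (Suc r) z = of_real z * gauss_int c r z - of_nat r * gauss_int c (r - 1) z"
proof -
  define h where "h r v = cis (- (z * v)) * (\<i> * of_real v) ^ r * of_real (exp (- (c * v\<^sup>2 / 2)))" for r v
  have int: "integrable lborel (h r)" for r
    using integrable_gaussian_moment_cis[of "c/2" z r] assms by (simp add: h_def[abs_def])
  \<comment> \<open>\<open>h'\<close> is the derivative of \<open>h r\<close>; the Gaussian
    contributes \<open>- c v\<close> times \<open>h r\<close>, which equals \<open>\<i> c\<close>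
    times \<open>h (Suc r)\<close>.\<close>
  define h' where "h' v = \<i> * (of_real c * h (Suc r) v + of_nat r * h (r - 1) v - of_real z * h r v)" for v
  have int': "integrable lborel h'"
    unfolding h'_def by (intro integrable_mult_right Bochner_Integration.integrable_add Bochner_Integration.integrable_diff int)
  have der: "(h r has_vector_derivative h' v) (at v)" for v
  proof -
    \<comment> \<open>The integrand is the restriction to the reals of the entire function
      \<open>e\<close>, whose complex derivative is the required one along the line.\<close>
    define e where "e y = exp (- (\<i> * of_real z * y)) * (\<i> * y) ^ r * exp (- (of_real c * y\<^sup>2 / 2))" for y :: complex
    have "h r = (\<lambda>v. e (of_real v))"
      by (simp add: h_def e_def fun_eq_iff cis_conv_exp exp_of_real[symmetric] mult.assoc)
    moreover have "((\<lambda>v. e (of_real v)) has_vector_derivative h' v) (at v)"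
    proof (rule has_vector_derivative_real_field)
      show "(e has_field_derivative h' v) (at (of_real v))"
      proof (rule DERIV_cong)
        define y where "y = complex_of_real v"
        define a where "a = exp (- (\<i> * of_real z * y))"
        define b where "b = exp (- (of_real c * y\<^sup>2 / 2))"
        show "(e has_field_derivative
          (a * (- (\<i> * of_real z)) * (\<i> * y) ^ r + a * (of_nat r * (\<i> * y) ^ (r - 1) * \<i>)) * b
            + a * (\<i> * y) ^ r * (b * (- (of_real c * y)))) (at (of_real v))"
        proof -
          have d1: "((\<lambda>y. exp (- (\<i> * of_real z * y))) has_field_derivative a * (- (\<i> * of_real z))) (at y)"
            unfolding a_def by (auto intro!: derivative_eq_intros)
          have d2: "((\<lambda>y. (\<i> * y) ^ r) has_field_derivative of_nat r * (\<i> * (\<i> * y) ^ (r - Suc 0))) (at y)"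
            by (rule DERIV_power) (auto intro!: derivative_eq_intros)
          have d3: "((\<lambda>y. exp (- (of_real c * y\<^sup>2 / 2))) has_field_derivative b * (- (of_real c * y))) (at y)"
            unfolding b_def by (auto intro!: derivative_eq_intros)
          show ?thesis
            unfolding e_def y_def[symmetric]
            by (rule DERIV_cong[OF DERIV_mult[OF DERIV_mult[OF d1 d2] d3]])
              (simp only: a_def[symmetric] b_def[symmetric],
                simp add: mult.assoc mult.left_commute mult.commute)
        qed
        have h: "h j v = a * (\<i> * y) ^ j * b" for j
          by (simp add: h_def a_def b_def y_def cis_conv_exp exp_of_real[symmetric] mult.assoc)
        show "(a * (- (\<i> * of_real z)) * (\<i> * y) ^ r + a * (of_nat r * (\<i> * y) ^ (r - 1) * \<i>)) * b
            + a * (\<i> * y) ^ r * (b * (- (of_real c * y))) = h' v"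
          unfolding h'_def h by (simp add: algebra_simps)
      qed
    qed
    ultimately show ?thesis by simp
  qed
  have cont: "isCont h' v" for v
  proof -
    have "continuous_on UNIV (h j)" for j
      unfolding h_def by (intro continuous_intros) auto
    then have "continuous_on UNIV h'"
      unfolding h'_def by (intro continuous_on_mult continuous_on_add continuous_on_diff continuous_on_const) auto
    then show ?thesis by (simp add: continuous_on_eq_continuous_at)
  qed
  have lim: "((\<lambda>v. h r v) \<longlongrightarrow> 0) at_top" "((\<lambda>v. h r v) \<longlongrightarrow> 0) at_bot"
  proof -
    have *: "((\<lambda>v::real. \<bar>v\<bar> ^ r * exp (- (c * v\<^sup>2 / 2))) \<longlongrightarrow> 0) at_top"
    proof -
      have "((\<lambda>x::real. x ^ r / exp x) \<longlongrightarrow> 0) at_top" by (rule tendsto_power_div_exp_0)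
      moreover have "eventually (\<lambda>v::real. norm (\<bar>v\<bar> ^ r * exp (- (c * v\<^sup>2 / 2))) \<le> v ^ r / exp v) at_top"
        using eventually_ge_at_top[of "max 1 (2 / c)"]
      proof eventually_elim
        case (elim v)
        then have "v \<ge> 2 / c" "v \<ge> 1" by auto
        then have "c * v \<ge> 2" using assms by (simp add: field_simps)
        then have "v * (c * v) \<ge> v * 2" using \<open>v \<ge> 1\<close> by (intro mult_left_mono) auto
        then have "v \<le> c * v\<^sup>2 / 2" by (simp add: power2_eq_square algebra_simps)
        then have "exp (- (c * v\<^sup>2 / 2)) \<le> exp (- v)" by simp
        then show ?case using \<open>v \<ge> 1\<close> by (simp add: exp_minus field_simps abs_mult)
      qed
      ultimately show ?thesis by (rule Lim_null_comparison[rotated])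
    qed
    have n: "norm (h r v) = \<bar>v\<bar> ^ r * exp (- (c * v\<^sup>2 / 2))" for v
      by (simp add: h_def norm_mult norm_power)
    show "((\<lambda>v. h r v) \<longlongrightarrow> 0) at_top"
      by (rule tendsto_norm_zero_cancel) (simp add: n *)
    have "((\<lambda>v. norm (h r (- v))) \<longlongrightarrow> 0) at_top" by (simp add: n *)
    then show "((\<lambda>v. h r v) \<longlongrightarrow> 0) at_bot"
      unfolding at_bot_mirror filterlim_filtermap by (rule tendsto_norm_zero_cancel)
  qed
  have "(LBINT x=-\<infinity>..\<infinity>. h' x) = 0 - 0"
  proof (rule interval_integral_FTC_integrable)
    show "set_integrable lborel (einterval (-\<infinity>) \<infinity>) h'"
      using int' by (simp add: set_integrable_def)
    show "((h r \<circ> real_of_ereal) \<longlongrightarrow> 0) (at_right (-\<infinity>))"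
      using lim(2) by (simp add: o_def flip: ereal_tendsto_simps)
    show "((h r \<circ> real_of_ereal) \<longlongrightarrow> 0) (at_left \<infinity>)"
      using lim(1) by (simp add: o_def flip: ereal_tendsto_simps)
  qed (use der cont in auto)
  then have "0 = (CLINT v|lborel. h' v)"
    by (simp add: interval_integral_to_infinity_eq interval_lebesgue_integral_def set_lebesgue_integral_def)
  also have "\<dots> = \<i> * (of_real c * gauss_int c (Suc r) z + of_nat r * gauss_int c (r - 1) z - of_real z * gauss_int c r z)"
  proof -
    have "gauss_int c j z = (CLINT v|lborel. h j v)" for j
      by (simp add: gauss_int_def h_def)
    then show ?thesis unfolding h'_def using int by simp
  qed
  finally have "of_real c * gauss_int c (Suc r) z + of_nat r * gauss_int c (r - 1) z - of_real z * gauss_int c r z = 0"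
    by (metis complex_i_not_zero mult_eq_0_iff)
  then show ?thesis by (simp add: algebra_simps)
qed

text \<open>\<open>f\<close> is the generating polynomial of a law on finitely many naturals. Mass
  at the adjacent points 0 and 1 makes the law non-degenerate and aperiodic, whence positive
  variance and decay of the characteristic function on all of [-pi, pi].\<close>

locale lattice_dist =
  fixes f :: "real poly"
  assumes nonneg: "\<And>i. coeff f i \<ge> 0"
    and pos0: "coeff f 0 > 0" and pos1: "coeff f 1 > 0"
    and poly_1: "poly f 1 = 1"
begin

definition mean :: real where "mean = (\<Sum>i\<le>degree f. coeff f i * real i)"

definition var :: real where "var = (\<Sum>i\<le>degree f. coeff f i * (real i - mean)\<^sup>2)"

text \<open>The factor 1/(2 pi) comes from Fourier inversion and makes \<open>Psi 0\<close> the
  centred normal density of variance \<open>var\<close>. The integral is real, so \<open>Re\<close>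
  only changes the type.\<close>

definition Psi :: "nat \<Rightarrow> real \<Rightarrow> real" where
  "Psi r z = Re (gauss_int var r z) / (2 * pi)"

text \<open>The characteristic function of the law centred at its mean: no linear term at 0, so
  rescaling by sqrt n has a limit.\<close>

definition chi :: "real \<Rightarrow> complex" where
  "chi \<theta> = (\<Sum>i\<le>degree f. of_real (coeff f i) * cis ((real i - mean) * \<theta>))"

lemma degree_ge_1: "degree f \<ge> 1"
  using pos1 le_degree[of f 1] by simp

lemma sum_coeff: "(\<Sum>i\<le>degree f. coeff f i) = 1"
  using poly_1 by (simp add: poly_altdef)

lemma mean_pos: "mean > 0"
proof -
  have "coeff f 1 * real 1 \<le> mean"
    unfolding mean_def using nonneg degree_ge_1 by (intro member_le_sum) auto
  then show ?thesis using pos1 by simp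
qed

lemma mean_eq_pderiv: "poly (pderiv f) 1 = mean"
proof -
  have "poly (pderiv f) 1 = (\<Sum>i\<le>degree f - 1. real (Suc i) * coeff f (Suc i))"
    by (simp add: poly_altdef coeff_pderiv degree_pderiv)
  also have "\<dots> = (\<Sum>i\<in>{Suc 0..Suc (degree f - 1)}. real i * coeff f i)"
    by (subst sum.shift_bounds_cl_Suc_ivl) (simp add: atMost_atLeast0)
  also have "{Suc 0..Suc (degree f - 1)} = {..degree f} - {0}"
    using degree_ge_1 by auto
  also have "(\<Sum>i\<in>{..degree f} - {0}. real i * coeff f i) = (\<Sum>i\<le>degree f. real i * coeff f i)"
    by (rule sum.mono_neutral_left) auto
  finally show ?thesis by (simp add: mean_def mult.commute)
qed

lemma var_pos: "var > 0"
proof -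
  have "coeff f 0 * (real 0 - mean)\<^sup>2 \<le> var"
    unfolding var_def using nonneg by (intro member_le_sum) auto
  then show ?thesis using pos0 mean_pos
    by (smt (verit, best) mult_pos_pos of_nat_0 zero_less_power2)
qed

lemma chi_eq: "chi \<theta> = poly (map_poly of_real f) (cis \<theta>) * cis (- (mean * \<theta>))"
  by (simp add: chi_def poly_altdef degree_map_poly coeff_map_poly sum_distrib_right mult.assoc
        Complex.DeMoivre cis_mult left_diff_distrib)

text \<open>Only the masses a and b at 0 and 1 are played off against each other; the others enter
  by the triangle inequality. With s = a + b, the squared modulus of a + b e^(i \<theta>) is s^2 - 2
  s y, at most (s - y)^2, so the whole sum loses at least y.\<close>

lemma norm_chi_le:
  assumes "\<bar>\<theta>\<bar> \<le> pi"
  shows "norm (chi \<theta>) \<le> exp (- (coeff f 0 * coeff f 1 / 20 * \<theta>\<^sup>2))"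
proof -
  define a b where "a = coeff f 0" and "b = coeff f 1"
  define s y where "s = a + b" and "y = a * b * (1 - cos \<theta>) / s"
  have ab: "a > 0" "b > 0" using pos0 pos1 by (auto simp: a_def b_def)
  have s: "s > 0" using ab by (simp add: s_def)
  have split: "{..degree f} = insert 0 (insert 1 {2..degree f})" using degree_ge_1 by auto
  have rest: "(\<Sum>i=2..degree f. coeff f i) = 1 - s"
    using sum_coeff unfolding split s_def a_def b_def by simp
  then have "s \<le> 1" using nonneg by (metis diff_ge_0_iff_ge sum_nonneg)
  have "norm (of_real a + of_real b * cis \<theta>) ^ 2 = (a + b * cos \<theta>)\<^sup>2 + (b * sin \<theta>)\<^sup>2"
    by (simp add: cmod_power2)
  also have "\<dots> = a\<^sup>2 + 2 * a * b * cos \<theta> + b\<^sup>2 * ((sin \<theta>)\<^sup>2 + (cos \<theta>)\<^sup>2)"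
    by (simp only: power2_eq_square ring_distribs) (simp only: ac_simps mult_2 ring_distribs)
  also have "\<dots> = s\<^sup>2 - 2 * (s * y)"
  proof -
    have "s * y = a * b * (1 - cos \<theta>)" using s by (simp add: y_def)
    then show ?thesis by (simp add: s_def power2_eq_square algebra_simps)
  qed
  also have "\<dots> \<le> (s - y)\<^sup>2" by (simp add: power2_eq_square algebra_simps)
  finally have sq: "norm (of_real a + of_real b * cis \<theta>) ^ 2 \<le> (s - y)\<^sup>2" .
  \<comment> \<open>The square root of (s - y)^2 is s - y only if \<open>y \<le> s\<close>.\<close>
  have "a * b * (1 - cos \<theta>) \<le> a * b * 2" using ab by (intro mult_left_mono) (auto simp: add.commute[of _ "cos \<theta>"] intro: order_trans[OF _ cos_ge_minus_one] )
  also have "\<dots> \<le> s * s" unfolding s_def by (simp add: algebra_simps)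
  finally have "y \<le> s" using s by (simp add: y_def divide_le_eq)
  then have n1: "norm (of_real a + of_real b * cis \<theta>) \<le> s - y"
    by (intro power2_le_imp_le[OF sq]) simp
  have "y \<ge> a * b * (1 - cos \<theta>)"
    unfolding y_def using s \<open>s \<le> 1\<close> ab by (simp add: le_divide_eq mult_left_le)
  moreover have "a * b * (1 - cos \<theta>) \<ge> a * b * (\<theta>\<^sup>2 / 20)"
    using ab one_minus_cos_ge[OF assms] by (intro mult_left_mono) auto
  ultimately have y: "y \<ge> a * b / 20 * \<theta>\<^sup>2" by simp
  have "norm (chi \<theta>) = norm (poly (map_poly of_real f) (cis \<theta>))"
    by (simp add: chi_eq norm_mult)
  also have "poly (map_poly of_real f) (cis \<theta>) = (\<Sum>i\<le>degree f. of_real (coeff f i) * cis \<theta> ^ i)"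
    by (simp add: poly_altdef degree_map_poly coeff_map_poly)
  also have "\<dots> = (of_real a + of_real b * cis \<theta>) + (\<Sum>i=2..degree f. of_real (coeff f i) * cis \<theta> ^ i)"
    unfolding split by (simp add: a_def b_def)
  also have "norm \<dots> \<le> (s - y) + (\<Sum>i=2..degree f. coeff f i)"
    by (intro norm_triangle_mono n1 sum_norm_le) (simp add: norm_mult norm_power nonneg)
  also have "\<dots> = 1 - y" using rest by simp
  also have "\<dots> \<le> 1 + (- (a * b / 20 * \<theta>\<^sup>2))" using y by simp
  also have "\<dots> \<le> exp (- (a * b / 20 * \<theta>\<^sup>2))" by (rule exp_ge_add_one_self)
  finally show ?thesis by (simp add: a_def b_def)
qed

text \<open>Termwise Taylor expansion: the linear terms add up to 0 by centring, the quadratic ones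
  to the variance.\<close>

lemma chi_approx: "norm (chi \<theta> - of_real (1 - var * \<theta>\<^sup>2 / 2)) \<le> (\<Sum>i\<le>degree f. coeff f i * \<bar>real i - mean\<bar> ^ 3) * \<bar>\<theta>\<bar> ^ 3"
proof -
  define x where "x i = (real i - mean) * \<theta>" for i
  have m0: "(\<Sum>i\<le>degree f. coeff f i * x i) = 0"
    using sum_coeff by (simp add: x_def algebra_simps sum_subtractf mean_def flip: sum_distrib_left sum_distrib_right)
  have v0: "(\<Sum>i\<le>degree f. coeff f i * (x i)\<^sup>2) = var * \<theta>\<^sup>2"
    by (simp add: x_def var_def power_mult_distrib sum_distrib_right mult.assoc)
  have "(\<Sum>i\<le>degree f. of_real (coeff f i) * (1 + \<i> * of_real (x i) - of_real ((x i)\<^sup>2) / 2))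
      = of_real (\<Sum>i\<le>degree f. coeff f i) + \<i> * of_real (\<Sum>i\<le>degree f. coeff f i * x i) - of_real (\<Sum>i\<le>degree f. coeff f i * (x i)\<^sup>2) / 2"
    by (simp add: ring_distribs sum.distrib sum_subtractf sum_distrib_left sum_divide_distrib mult.left_commute)
  then have "of_real (1 - var * \<theta>\<^sup>2 / 2) = (\<Sum>i\<le>degree f. of_real (coeff f i) * (1 + \<i> * of_real (x i) - of_real ((x i)\<^sup>2) / 2))"
    unfolding v0 m0 sum_coeff by simp
  then have "chi \<theta> - of_real (1 - var * \<theta>\<^sup>2 / 2)
    = (\<Sum>i\<le>degree f. of_real (coeff f i) * (cis (x i) - (1 + \<i> * of_real (x i) - of_real ((x i)\<^sup>2) / 2)))"
    by (simp add: chi_def x_def right_diff_distrib sum_subtractf)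
  also have "norm \<dots> \<le> (\<Sum>i\<le>degree f. coeff f i * \<bar>x i\<bar> ^ 3)"
  proof (rule sum_norm_le)
    fix i
    have "norm (iexp (x i) - (\<Sum>k\<le>2. (\<i> * x i)^k / fact k)) \<le> \<bar>x i\<bar>^(Suc 2) / fact (Suc 2)"
      by (rule iexp_approx1)
    also have "\<dots> \<le> \<bar>x i\<bar> ^ 3 / 1" unfolding numeral_3_eq_3[symmetric] numeral_2_eq_2
      by (intro divide_left_mono) (auto simp: fact_numeral numeral_3_eq_3)
    also have "(\<Sum>k\<le>2. (\<i> * x i)^k / fact k) = 1 + \<i> * of_real (x i) - of_real ((x i)\<^sup>2) / 2"
      by (simp add: numeral_2_eq_2 power_mult_distrib)
    finally show "norm (of_real (coeff f i) * (cis (x i) - (1 + \<i> * of_real (x i) - of_real ((x i)\<^sup>2) / 2))) \<le> coeff f i * \<bar>x i\<bar> ^ 3"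
      by (simp add: norm_mult nonneg cis_conv_exp mult_left_mono)
  qed
  also have "\<dots> = (\<Sum>i\<le>degree f. coeff f i * \<bar>real i - mean\<bar> ^ 3) * \<bar>\<theta>\<bar> ^ 3"
    by (simp add: x_def abs_mult power_mult_distrib sum_distrib_right mult.assoc)
  finally show ?thesis .
qed

lemma tendsto_div_sqrt: "(\<lambda>n. v / sqrt (real n)) \<longlonglongrightarrow> 0"
  by (intro real_tendsto_divide_at_top[OF tendsto_const] filterlim_compose[OF sqrt_at_top filterlim_real_sequentially])

text \<open>The comparison with (1 - var v^2 / (2n))^n uses |a^n - b^n| \<le> n |a - b| for numbers
  in the unit disc. The cubic error at v / sqrt n, multiplied by n, is still O(1 / sqrt n).\<close>

lemma chi_power_tendsto: "(\<lambda>n. chi (v / sqrt (real n)) ^ n) \<longlonglongrightarrow> of_real (exp (- (var * v\<^sup>2 / 2)))"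
proof -
  define K where "K = (\<Sum>i\<le>degree f. coeff f i * \<bar>real i - mean\<bar> ^ 3)"
  define a where "a n = 1 + (- (var * v\<^sup>2 / 2)) / real n" for n
  have a_lim: "(\<lambda>n. complex_of_real (a n ^ n)) \<longlonglongrightarrow> of_real (exp (- (var * v\<^sup>2 / 2)))"
    unfolding a_def by (intro tendsto_of_real tendsto_exp_limit_sequentially)
  have "(\<lambda>n. chi (v / sqrt (real n)) ^ n - of_real (a n ^ n)) \<longlonglongrightarrow> 0"
  proof (rule Lim_null_comparison)
    show "(\<lambda>n. K * \<bar>v\<bar> ^ 3 / sqrt (real n)) \<longlonglongrightarrow> 0"
      by (rule tendsto_div_sqrt)
    have "eventually (\<lambda>n. \<bar>v / sqrt (real n)\<bar> < pi) sequentially"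
      using tendsto_rabs[OF tendsto_div_sqrt, of v] by (rule order_tendstoD) simp
    \<comment> \<open>From this index on \<open>a n\<close> lies in [0, 1]; together with the bound
      pi on the angle, both bases lie in the unit disc.\<close>
    moreover have "eventually (\<lambda>n. n \<ge> max 1 (nat \<lceil>var * v\<^sup>2\<rceil>)) sequentially"
      by (rule eventually_ge_at_top)
    ultimately show "\<forall>\<^sub>F n in sequentially. norm (chi (v / sqrt (real n)) ^ n - of_real (a n ^ n)) \<le> K * \<bar>v\<bar> ^ 3 / sqrt (real n)"
    proof eventually_elim
      case (elim n)
      define \<theta> where "\<theta> = v / sqrt (real n)"
      have n: "n \<ge> 1" "real n \<ge> var * v\<^sup>2" using elim(2) by linarith+
      have th2: "\<theta>\<^sup>2 = v\<^sup>2 / real n" using n by (simp add: \<theta>_def power_divide)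
      have "norm (chi \<theta>) \<le> 1"
      proof -
        have "norm (chi \<theta>) \<le> exp (- (coeff f 0 * coeff f 1 / 20 * \<theta>\<^sup>2))"
          using elim(1) by (intro norm_chi_le) (simp add: \<theta>_def)
        also have "\<dots> \<le> 1" using pos0 pos1 by simp
        finally show ?thesis .
      qed
      moreover have "\<bar>a n\<bar> \<le> 1"
      proof -
        have "0 \<le> var * v\<^sup>2 / real n" "var * v\<^sup>2 / real n \<le> 1" using n var_pos by auto
        then show ?thesis by (simp add: a_def abs_le_iff)
      qed
      ultimately have "norm (chi \<theta> ^ n - of_real (a n) ^ n) \<le> n * norm (chi \<theta> - of_real (a n))"
        by (intro norm_power_diff) auto
      also have "\<dots> \<le> real n * (K * \<bar>\<theta>\<bar> ^ 3)"
        using chi_approx[of \<theta>]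
        by (intro mult_left_mono) (simp_all add: a_def K_def th2 mult.commute)
      also have "\<dots> = K * \<bar>v\<bar> ^ 3 / sqrt (real n)"
      proof -
        have "real n = sqrt (real n) * sqrt (real n)" by simp
        then show ?thesis using n
          by (simp add: \<theta>_def power_divide power3_eq_cube field_simps)
      qed
      finally show ?case by (simp add: \<theta>_def)
    qed
  qed
  from tendsto_add[OF this a_lim] show ?thesis by simp
qed

lemma chi_tendsto_1: "(\<lambda>n. chi (v / sqrt (real n))) \<longlonglongrightarrow> 1"
proof -
  have "isCont chi 0" unfolding chi_def cis_conv_exp by (intro continuous_intros)
  moreover have "chi 0 = 1" using sum_coeff by (simp add: chi_def flip: of_real_sum)
  ultimately show ?thesis
    using isCont_tendsto_compose[OF _ tendsto_div_sqrt, of chi] by fastforce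
qed

lemma chi_power_diff_tendsto:
  "(\<lambda>n. chi (v / sqrt (real n)) ^ (n - M)) \<longlonglongrightarrow> of_real (exp (- (var * v\<^sup>2 / 2)))"
proof -
  have "(\<lambda>n. chi (v / sqrt (real n)) ^ n / chi (v / sqrt (real n)) ^ M) \<longlonglongrightarrow> of_real (exp (- (var * v\<^sup>2 / 2))) / 1 ^ M"
    by (intro tendsto_divide chi_power_tendsto tendsto_power chi_tendsto_1) simp
  moreover have "eventually (\<lambda>n. chi (v / sqrt (real n)) \<noteq> 0) sequentially"
    using chi_tendsto_1 by (rule tendsto_imp_eventually_ne) simp
  then have "eventually (\<lambda>n. chi (v / sqrt (real n)) ^ n / chi (v / sqrt (real n)) ^ M = chi (v / sqrt (real n)) ^ (n - M)) sequentially"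
    using eventually_ge_at_top[of M] by eventually_elim (simp add: power_diff)
  ultimately show ?thesis by (simp add: tendsto_cong)
qed

lemma sqrt_cis_minus_1_tendsto:
  "(\<lambda>n. of_real (sqrt (real n)) * (cis (v / sqrt (real n)) - 1)) \<longlonglongrightarrow> \<i> * of_real v"
proof -
  have "(\<lambda>n. of_real (sqrt (real n)) * (cis (v / sqrt (real n)) - 1) - \<i> * of_real v) \<longlonglongrightarrow> 0"
  proof (rule Lim_null_comparison)
    show "(\<lambda>n. v\<^sup>2 / sqrt (real n)) \<longlonglongrightarrow> 0" by (rule tendsto_div_sqrt)
    show "\<forall>\<^sub>F n in sequentially. norm (of_real (sqrt (real n)) * (cis (v / sqrt (real n)) - 1) - \<i> * of_real v) \<le> v\<^sup>2 / sqrt (real n)"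
      using eventually_gt_at_top[of 0]
    proof eventually_elim
      case (elim n)
      define s where "s = sqrt (real n)"
      have s: "s > 0" using elim by (simp add: s_def)
      define x where "x = v / s"
      have "norm (iexp x - (\<Sum>k\<le>1. (\<i> * x)^k / fact k)) \<le> \<bar>x\<bar>^(Suc 1) / fact (Suc 1)"
        by (rule iexp_approx1)
      then have "2 * norm (cis x - 1 - \<i> * x) \<le> x\<^sup>2"
        by (simp add: cis_conv_exp power2_eq_square algebra_simps)
      then have "norm (cis x - 1 - \<i> * x) \<le> x\<^sup>2"
        using norm_ge_zero[of "cis x - 1 - \<i> * x"] by linarith
      then have "s * norm (cis x - 1 - \<i> * x) \<le> s * x\<^sup>2" using s by simp
      moreover have "of_real s * (cis x - 1) - \<i> * of_real v = of_real s * (cis x - 1 - \<i> * x)"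
        using s by (simp add: x_def algebra_simps)
      ultimately show ?case
        using s unfolding s_def[symmetric] x_def[symmetric]
        by (simp add: norm_mult) (simp add: x_def power2_eq_square field_simps)
    qed
  qed
  then show ?thesis by (simp add: LIM_zero_iff)
qed



text \<open>Uniformity in \<open>k\<close> is automatic: after the substitution \<theta> = v / sqrt
  n, \<open>k\<close> enters the integrand only through a unimodular phase. The error is therefore
  at most the L1 distance between phase-free integrands, which do not depend on \<open>k\<close>,
  and dominated convergence makes it small. \<open>M\<close> allows a generating polynomial that
  starts at a fixed level.\<close>

lemma local_limit:
  fixes E :: "real poly"
  assumes "\<epsilon> > 0"
  shows "\<forall>\<^sub>F n in sequentially. \<forall>k.
    \<bar>sqrt (real n) ^ Suc r * coeff ([:-1, 1:] ^ r * E * f ^ (n - M)) k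
      - poly E 1 * Psi r ((real k - real n * mean) / sqrt (real n))\<bar> < \<epsilon>"
proof -
  define cE where "cE = map_poly complex_of_real E"
  \<comment> \<open>Half the decay rate of \<open>norm_chi_le\<close>, since only n - M factors are
    available and n - M \<ge> n / 2 for n > 2M.\<close>
  define c0 where "c0 = coeff f 0 * coeff f 1 / 40"
  have c0: "c0 > 0" using pos0 pos1 by (simp add: c0_def)
  define KE where "KE = (\<Sum>i\<le>degree E. \<bar>coeff E i\<bar>)"
  \<comment> \<open>The rescaled integrand without the phase in \<open>k\<close>. The factor with
    \<open>mean * real M\<close> corrects the centring at n mean instead of (n - M) mean; setting it
    to 0 for n \<le> 2M makes \<open>w\<close> dominate for every n.\<close>
  define s where "s n v = (if n > 2 * M then indicator {-pi..pi} (v / sqrt (real n)) *\<^sub>R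
     ((of_real (sqrt (real n)) * (cis (v / sqrt (real n)) - 1)) ^ r * poly cE (cis (v / sqrt (real n)))
       * cis (- (mean * real M * (v / sqrt (real n)))) * chi (v / sqrt (real n)) ^ (n - M)) else 0)" for n v
  define l where "l v = (\<i> * of_real v) ^ r * of_real (poly E 1) * of_real (exp (- (var * v\<^sup>2 / 2)))" for v :: real
  define w where "w v = \<bar>v\<bar> ^ r * KE * exp (- (c0 * v\<^sup>2))" for v :: real
  have KE: "norm (poly cE (cis \<theta>)) \<le> KE" for \<theta>
    unfolding poly_altdef cE_def KE_def
    by (rule order_trans[OF norm_sum])
      (simp add: norm_mult norm_power coeff_map_poly degree_map_poly)
  have KE0: "KE \<ge> 0" unfolding KE_def by (simp add: sum_nonneg)
  have cE1: "poly cE 1 = of_real (poly E 1)"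
    by (simp add: cE_def poly_altdef coeff_map_poly degree_map_poly)
  have s_lim: "(\<lambda>n. s n v) \<longlonglongrightarrow> l v" for v
  proof -
    have cont: "isCont (poly cE) 1" "isCont cis 0"
      by (simp_all add: poly_isCont) (simp add: cis_conv_exp[abs_def])
    have cis1: "(\<lambda>n. cis (a * (v / sqrt (real n)))) \<longlonglongrightarrow> 1" for a
    proof -
      have "(\<lambda>n. a * (v / sqrt (real n))) \<longlonglongrightarrow> 0"
        using tendsto_mult_right_zero[OF tendsto_div_sqrt, of a v] by simp
      from isCont_tendsto_compose[OF cont(2) this] show ?thesis by simp
    qed
    have "(\<lambda>n. (of_real (sqrt (real n)) * (cis (v / sqrt (real n)) - 1)) ^ r * poly cE (cis (v / sqrt (real n)))
       * cis (- (mean * real M * (v / sqrt (real n)))) * chi (v / sqrt (real n)) ^ (n - M))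
       \<longlonglongrightarrow> (\<i> * of_real v) ^ r * poly cE 1 * 1 * of_real (exp (- (var * v\<^sup>2 / 2)))"
      using cis1[of "- (mean * real M)"] isCont_tendsto_compose[OF cont(1) cis1[of 1]]
      by (intro tendsto_mult tendsto_power sqrt_cis_minus_1_tendsto chi_power_diff_tendsto) auto
    moreover have "eventually (\<lambda>n. \<bar>v / sqrt (real n)\<bar> < pi) sequentially"
      using tendsto_rabs[OF tendsto_div_sqrt, of v] by (rule order_tendstoD) simp
    then have "eventually (\<lambda>n. (of_real (sqrt (real n)) * (cis (v / sqrt (real n)) - 1)) ^ r * poly cE (cis (v / sqrt (real n)))
       * cis (- (mean * real M * (v / sqrt (real n)))) * chi (v / sqrt (real n)) ^ (n - M) = s n v) sequentially"
      using eventually_gt_at_top[of "2 * M"]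
    proof eventually_elim
      case (elim n)
      have "v / sqrt (real n) \<in> {-pi..pi}" using elim(1) unfolding abs_less_iff by auto
      then show ?case using elim(2) by (simp add: s_def)
    qed
    ultimately have "(\<lambda>n. s n v) \<longlonglongrightarrow> (\<i> * of_real v) ^ r * poly cE 1 * 1 * of_real (exp (- (var * v\<^sup>2 / 2)))"
      by (rule Lim_transform_eventually)
    then show ?thesis by (simp add: l_def cE1)
  qed
  have s_bound: "norm (s n v) \<le> w v" for n v
  proof (cases "n > 2 * M \<and> \<bar>v / sqrt (real n)\<bar> \<le> pi")
    case True
    define \<theta> where "\<theta> = v / sqrt (real n)"
    have n: "n > 2 * M" "n > 0" and th: "\<bar>\<theta>\<bar> \<le> pi" using True by (auto simp: \<theta>_def)
    have sq: "sqrt (real n) > 0" using n by simp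
    have "norm (iexp \<theta> - (\<Sum>k\<le>0. (\<i> * \<theta>)^k / fact k)) \<le> \<bar>\<theta>\<bar>^(Suc 0) / fact (Suc 0)"
      by (rule iexp_approx1)
    then have "norm (cis \<theta> - 1) \<le> \<bar>\<theta>\<bar>" by (simp add: cis_conv_exp)
    then have "sqrt (real n) * norm (cis \<theta> - 1) \<le> sqrt (real n) * \<bar>\<theta>\<bar>" by (intro mult_left_mono) auto
    also have "\<dots> = \<bar>v\<bar>" using sq by (simp add: \<theta>_def)
    finally have b1: "norm (of_real (sqrt (real n)) * (cis \<theta> - 1)) \<le> \<bar>v\<bar>"
      by (simp add: norm_mult)
    have b2: "norm (chi \<theta> ^ (n - M)) \<le> exp (- (c0 * v\<^sup>2))"
    proof -
      have "norm (chi \<theta> ^ (n - M)) \<le> exp (- (2 * c0 * \<theta>\<^sup>2)) ^ (n - M)"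
        unfolding norm_power using norm_chi_le[OF th] by (intro power_mono) (simp_all add: c0_def)
      also have "\<dots> = exp (real (n - M) * (- (2 * c0 * \<theta>\<^sup>2)))"
        by (simp add: exp_of_nat_mult[symmetric])
      also have "\<dots> \<le> exp (- (c0 * v\<^sup>2))"
      proof -
        have "v\<^sup>2 = real n * \<theta>\<^sup>2" using n by (simp add: \<theta>_def power_divide)
        moreover have "real n \<le> real (n - M) * 2" using n by linarith
        then have "real n * (c0 * \<theta>\<^sup>2) \<le> real (n - M) * 2 * (c0 * \<theta>\<^sup>2)"
          using c0 by (intro mult_right_mono) auto
        ultimately show ?thesis by (simp add: mult_ac)
      qed
      finally show ?thesis .
    qed
    have "norm (s n v) = norm (of_real (sqrt (real n)) * (cis \<theta> - 1)) ^ r * norm (poly cE (cis \<theta>)) * 1 * norm (chi \<theta> ^ (n - M))"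
    proof -
      have "v / sqrt (real n) \<in> {-pi..pi}" using th unfolding abs_le_iff \<theta>_def by auto
      then show ?thesis using n by (simp add: s_def norm_mult norm_power \<theta>_def)
    qed
    also have "\<dots> \<le> \<bar>v\<bar> ^ r * KE * 1 * exp (- (c0 * v\<^sup>2))"
      using b1 b2 KE KE0 by (intro mult_mono power_mono) auto
    finally show ?thesis by (simp add: w_def)
  next
    case False
    then have "n \<le> 2 * M \<or> v / sqrt (real n) \<notin> {-pi..pi}" unfolding abs_le_iff by auto
    then have "s n v = 0" by (auto simp: s_def)
    then show ?thesis using KE0 by (simp add: w_def)
  qed
  have w_int: "integrable lborel w"
    using integrable_mult_right[OF integrable_gaussian_moment[OF c0, of r], of KE]
    by (simp add: w_def[abs_def] mult_ac)
  have l_meas: "l \<in> borel_measurable borel"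
    unfolding l_def by (intro borel_measurable_continuous_onI continuous_intros) auto
  have s_meas: "s n \<in> borel_measurable borel" for n
  proof (cases "n > 2 * M")
    case True
    have "continuous_on UNIV chi" unfolding chi_def by (intro continuous_intros)
    then have c2: "continuous_on UNIV (\<lambda>v. chi (v / sqrt (real n)))"
      by (rule continuous_on_compose2) (use True in \<open>auto intro!: continuous_intros\<close>)
    have c1: "continuous_on UNIV (\<lambda>v. cis (a * (v / sqrt (real n))))" for a
      using True by (intro continuous_intros) auto
    have c3: "continuous_on UNIV (\<lambda>v. poly cE (cis (v / sqrt (real n))))"
    proof (rule continuous_on_compose2[of UNIV "poly cE"])
      show "continuous_on UNIV (poly cE)" by (simp add: continuous_at_imp_continuous_on poly_isCont)
    qed (use c1[of 1] in auto)
    have "(\<lambda>v. (of_real (sqrt (real n)) * (cis (v / sqrt (real n)) - 1)) ^ r * poly cE (cis (v / sqrt (real n)))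
       * cis (- (mean * real M * (v / sqrt (real n)))) * chi (v / sqrt (real n)) ^ (n - M)) \<in> borel_measurable borel"
      using c1[of 1] c1[of "- (mean * real M)"]
      by (intro borel_measurable_continuous_onI continuous_on_mult continuous_on_power
          continuous_on_diff continuous_on_const c2 c3) auto
    moreover have "(\<lambda>v. indicator {-pi..pi} (v / sqrt (real n)) :: real) \<in> borel_measurable borel"
      by measurable
    ultimately show ?thesis using True
      unfolding s_def by simp
  qed (simp add: s_def[abs_def])
  have s_int: "integrable lborel (s n)" for n
    using s_bound s_meas by (intro Bochner_Integration.integrable_bound[OF w_int]) (auto intro: order_trans[OF _ abs_ge_self])
  have l_bound: "norm (l v) \<le> w v" for v
    using s_bound s_lim by (intro tendsto_upperbound[OF tendsto_norm[OF s_lim]]) auto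
  have l_int: "integrable lborel l"
    using l_bound l_meas by (intro Bochner_Integration.integrable_bound[OF w_int]) (auto intro: order_trans[OF _ abs_ge_self])
  \<comment> \<open>Convergence of the L1 norm rather than of the integrals, so that any unimodular
    factor may be inserted afterwards.\<close>
  have "(\<lambda>n. LINT v|lborel. norm (s n v - l v)) \<longlonglongrightarrow> (LINT v|(lborel :: real measure). (0 :: real))"
  proof (rule integral_dominated_convergence[of "\<lambda>v. 0" lborel "\<lambda>n v. norm (s n v - l v)" "\<lambda>v. 2 * w v"])
    show "integrable lborel (\<lambda>v. 2 * w v)" using w_int by simp
    show "AE v in lborel. (\<lambda>n. norm (s n v - l v)) \<longlonglongrightarrow> 0"
      using tendsto_norm_zero[OF LIM_zero[OF s_lim]] by simp
    show "AE v in lborel. norm (norm (s n v - l v)) \<le> 2 * w v" for n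
    proof (rule AE_I2)
      fix v
      show "norm (norm (s n v - l v)) \<le> 2 * w v"
        using norm_triangle_ineq4[of "s n v" "l v"] s_bound[of n v] l_bound[of v] by simp
    qed
  qed (use s_meas l_meas in auto)
  then have "(\<lambda>n. LINT v|lborel. norm (s n v - l v)) \<longlonglongrightarrow> 0" by simp
  then have "eventually (\<lambda>n. (LINT v|lborel. norm (s n v - l v)) < \<epsilon>) sequentially"
    using assms by (rule order_tendstoD)
  then show ?thesis
    using eventually_gt_at_top[of "2 * M"]
  proof eventually_elim
    case (elim n)
    define sn where "sn = sqrt (real n)"
    have sn: "sn > 0" "sn * sn = real n" using elim(2) by (auto simp: sn_def)
    show ?case
    proof
      fix k :: nat
      define z where "z = (real k - real n * mean) / sn"
      define A where "A = [:-1, 1:] ^ r * E * f ^ (n - M)"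
      define h where "h \<theta> = indicator {-pi..pi} \<theta> *\<^sub>R (poly (map_poly of_real A) (cis \<theta>) * cis (- (real k * \<theta>)))" for \<theta>
      have of_real_lift: "poly (map_poly complex_of_real (B * C)) x = poly (map_poly of_real B) x * poly (map_poly of_real C) x"
        for B C x
      proof -
        have "map_poly complex_of_real (B * C) = map_poly of_real B * map_poly of_real C"
          by (rule poly_eqI) (simp add: coeff_map_poly coeff_mult)
        then show ?thesis by simp
      qed
      have pow_lift: "poly (map_poly complex_of_real (B ^ m)) x = poly (map_poly of_real B) x ^ m" for B m x
        by (induction m) (simp_all add: of_real_lift)
      have polyA: "poly (map_poly of_real A) y = (y - 1) ^ r * poly cE y * poly (map_poly of_real f) y ^ (n - M)" for y
        by (simp add: A_def of_real_lift pow_lift cE_def map_poly_pCons)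
      have hs: "of_real sn ^ r * h (0 + 1 / sn * v) = cis (- (z * v)) * s n v" for v
      proof -
        define \<theta> where "\<theta> = v / sn"
        \<comment> \<open>The centring phases of M levels and of the remaining n - M levels cancel
          the n mean contained in z, leaving the frequency \<open>k\<close>.\<close>
        have e: "(- (z * v)) + (- (mean * real M * \<theta>)) + (- (mean * \<theta>)) * real (n - M) = - (real k * \<theta>)"
        proof -
          have "z * v = (real k - real n * mean) * \<theta>" by (simp add: z_def \<theta>_def)
          moreover have "real (n - M) = real n - real M" using elim(2) by simp
          ultimately show ?thesis by (simp add: algebra_simps)
        qed
        have "cis (- (z * v)) * (cis (- (mean * real M * \<theta>)) * chi \<theta> ^ (n - M))
           = poly (map_poly of_real f) (cis \<theta>) ^ (n - M) * cis (- (z * v) + (- (mean * real M * \<theta>)) + (- (mean * \<theta>)) * real (n - M))"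
          by (simp only: chi_eq power_mult_distrib Complex.DeMoivre cis_mult[symmetric]) (simp only: mult_ac)
        then have "cis (- (z * v)) * (cis (- (mean * real M * \<theta>)) * chi \<theta> ^ (n - M))
           = poly (map_poly of_real f) (cis \<theta>) ^ (n - M) * cis (- (real k * \<theta>))"
          unfolding e .
        then show ?thesis
          using elim(2) by (simp add: h_def s_def polyA sn_def[symmetric] \<theta>_def[symmetric] power_mult_distrib mult_ac)
      qed
      have "complex_of_real (coeff A k) = (1 / (2 * pi)) * (CLINT \<theta>|lborel. h \<theta>)"
        unfolding h_def by (rule coeff_eq_integral)
      also have "(CLINT \<theta>|lborel. h \<theta>) = \<bar>1 / sn\<bar> *\<^sub>R (CLINT v|lborel. h (0 + 1 / sn * v))"
        by (rule lborel_integral_real_affine) (use sn in auto)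
      finally have "complex_of_real (sn ^ Suc r * coeff A k) = (1 / (2 * pi)) * (of_real sn ^ r * (CLINT v|lborel. h (0 + 1 / sn * v)))"
        using sn by (simp add: scaleR_conv_of_real)
      also have "of_real sn ^ r * (CLINT v|lborel. h (0 + 1 / sn * v)) = (CLINT v|lborel. cis (- (z * v)) * s n v)"
        unfolding hs[symmetric] by simp
      finally have 1: "complex_of_real (sn ^ Suc r * coeff A k) = (1 / (2 * pi)) * (CLINT v|lborel. cis (- (z * v)) * s n v)" .
      have cis_meas: "(\<lambda>v. cis (- (z * v))) \<in> borel_measurable borel"
        by (intro borel_measurable_continuous_onI continuous_intros)
      have i1: "integrable lborel (\<lambda>v. cis (- (z * v)) * s n v)"
        using s_meas cis_meas by (intro Bochner_Integration.integrable_bound[OF s_int[of n]]) (auto simp: norm_mult)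
      have i2: "integrable lborel (\<lambda>v. cis (- (z * v)) * l v)"
        using l_meas cis_meas by (intro Bochner_Integration.integrable_bound[OF l_int]) (auto simp: norm_mult)
      have i3: "integrable lborel (\<lambda>v. cis (- (z * v)) * s n v - cis (- (z * v)) * l v)"
        by (intro Bochner_Integration.integrable_diff i1 i2)
      have 2: "of_real (poly E 1) * gauss_int var r z = (CLINT v|lborel. cis (- (z * v)) * l v)"
        unfolding gauss_int_def l_def by (subst integral_mult_right_zero[symmetric]) (simp add: mult_ac)
      have "\<bar>sn ^ Suc r * coeff A k - poly E 1 * Psi r z\<bar>
         = \<bar>Re (complex_of_real (sn ^ Suc r * coeff A k) - (1 / (2 * pi)) * (of_real (poly E 1) * gauss_int var r z))\<bar>"
        by (simp add: Psi_def)
      also have "\<dots> \<le> norm (complex_of_real (sn ^ Suc r * coeff A k) - (1 / (2 * pi)) * (of_real (poly E 1) * gauss_int var r z))"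
        by (rule abs_Re_le_cmod)
      also have "complex_of_real (sn ^ Suc r * coeff A k) - (1 / (2 * pi)) * (of_real (poly E 1) * gauss_int var r z)
         = (1 / (2 * pi)) * (CLINT v|lborel. cis (- (z * v)) * s n v - cis (- (z * v)) * l v)"
        unfolding 1 2 using i1 i2 by (simp add: right_diff_distrib)
      also have "norm \<dots> = (1 / (2 * pi)) * norm (CLINT v|lborel. cis (- (z * v)) * s n v - cis (- (z * v)) * l v)"
        by (simp add: norm_mult norm_divide)
      also have "\<dots> \<le> 1 * norm (CLINT v|lborel. cis (- (z * v)) * s n v - cis (- (z * v)) * l v)"
        using pi_gt3 by (intro mult_right_mono) auto
      also have "\<dots> \<le> (LINT v|lborel. norm (s n v - l v))"
        using integral_norm_bound[of lborel "\<lambda>v. cis (- (z * v)) * s n v - cis (- (z * v)) * l v"]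
        by (simp add: norm_mult right_diff_distrib[symmetric])
      also have "\<dots> < \<epsilon>" by (rule elim(1))
      finally show "\<bar>sqrt (real n) ^ Suc r * coeff ([:-1, 1:] ^ r * E * f ^ (n - M)) k
         - poly E 1 * Psi r ((real k - real n * mean) / sqrt (real n))\<bar> < \<epsilon>"
        by (simp add: A_def z_def sn_def)
    qed
  qed
qed


section \<open>Coefficient estimates\<close>

lemma Psi_Suc: "var * Psi (Suc r) z = z * Psi r z - real r * Psi (r - 1) z"
proof -
  have "Re (of_real var * gauss_int var (Suc r) z) = Re (of_real z * gauss_int var r z - of_nat r * gauss_int var (r - 1) z)"
    using gauss_int_Suc[OF var_pos, of r z] by simp
  then have "var * Re (gauss_int var (Suc r) z) = z * Re (gauss_int var r z) - real r * Re (gauss_int var (r - 1) z)"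
    by simp
  then show ?thesis by (simp add: Psi_def field_simps)
qed

lemma Psi_0: "Psi 0 z = sqrt (2 * pi / var) / (2 * pi) * exp (- (z\<^sup>2 / (2 * var)))"
  unfolding Psi_def gauss_int_0[OF var_pos] by simp

lemma Psi_0_pos: "Psi 0 z > 0"
  unfolding Psi_0 using var_pos by simp

lemma Psi_0_antimono:
  assumes "0 \<le> y" "y \<le> z" shows "Psi 0 z \<le> Psi 0 y"
proof -
  have "y\<^sup>2 / (2 * var) \<le> z\<^sup>2 / (2 * var)"
    using assms var_pos by (intro divide_right_mono power_mono) auto
  then show ?thesis unfolding Psi_0 using var_pos by (intro mult_left_mono) auto
qed

lemma Psi_bounded: "\<exists>B. \<forall>z. \<bar>Psi r z\<bar> \<le> B"
proof (intro exI allI)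
  fix z
  have "\<bar>Psi r z\<bar> \<le> \<bar>Re (gauss_int var r z)\<bar> / 1"
    unfolding Psi_def abs_divide using pi_gt3 by (intro divide_left_mono) auto
  also have "\<dots> \<le> norm (gauss_int var r z)" by (simp add: abs_Re_le_cmod)
  also have "\<dots> \<le> (LINT v|lborel. norm (cis (- (z * v)) * (\<i> * of_real v) ^ r * of_real (exp (- (var * v\<^sup>2 / 2)))))"
    unfolding gauss_int_def by (rule integral_norm_bound)
  also have "\<dots> = (LINT v|lborel. \<bar>v\<bar> ^ r * exp (- (var * v\<^sup>2 / 2)))"
    by (simp add: norm_mult norm_power)
  finally show "\<bar>Psi r z\<bar> \<le> (LINT v|lborel. \<bar>v\<bar> ^ r * exp (- (var * v\<^sup>2 / 2)))" .
qed

text \<open>If Psi (r-1) \<le> Psi r and Psi r > 0, the recurrence gives var Psi (r+1) \<ge> (z - r)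
  Psi r \<ge> var Psi r. Positivity and monotonicity in r thus have to be carried through the
  induction together.\<close>

lemma Psi_ge_Psi_0:
  assumes "z \<ge> real s + var" "r \<le> s"
  shows "Psi 0 z \<le> Psi r z"
proof -
  have "Psi 0 z \<le> Psi r z \<and> (r > 0 \<longrightarrow> Psi (r - 1) z \<le> Psi r z)" using assms(2)
  proof (induction r)
    case (Suc r)
    then have IH: "Psi 0 z \<le> Psi r z" "r > 0 \<longrightarrow> Psi (r - 1) z \<le> Psi r z" by auto
    have pos: "Psi r z > 0" using IH Psi_0_pos[of z] by linarith
    have "real r * Psi (r - 1) z \<le> real r * Psi r z"
      using IH by (cases "r = 0") (auto intro: mult_left_mono)
    then have "(z - real r) * Psi r z \<le> var * Psi (Suc r) z"
      unfolding Psi_Suc by (simp add: algebra_simps)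
    moreover have "var * Psi r z \<le> (z - real r) * Psi r z"
      using assms(1) Suc.prems pos by (intro mult_right_mono) auto
    ultimately have "var * Psi r z \<le> var * Psi (Suc r) z" by linarith
    then show ?case using var_pos IH by simp
  qed simp
  then show ?thesis by simp
qed

text \<open>\<open>Q\<close> collects data at level \<open>N\<close>, and each further level
  multiplies by \<open>f\<close>. Q = 1 with N = 0 gives rescaled tower heights;
  \<open>tilted c\<close> gives, from level \<open>N\<close> on, rescaled totals of g - c.\<close>

definition cf :: "real poly \<Rightarrow> nat \<Rightarrow> nat \<Rightarrow> nat \<Rightarrow> real" where
  "cf Q N n k = coeff (Q * f ^ (n - N)) k"

definition zs :: "nat \<Rightarrow> nat \<Rightarrow> real" where
  "zs n k = (real k - real n * mean) / sqrt (real n)"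

lemma cf_limit:
  assumes "\<epsilon> > 0"
  shows "\<forall>\<^sub>F n in sequentially. \<forall>k.
    \<bar>sqrt (real n) ^ Suc r * cf ([:-1, 1:] ^ r * E) N n k - poly E 1 * Psi r (zs n k)\<bar> < \<epsilon>"
  using local_limit[OF assms, of r E N] by (simp add: cf_def zs_def)

lemma abs_coeff_le: "\<bar>coeff (A :: real poly) k\<bar> \<le> (\<Sum>i\<le>degree A. \<bar>coeff A i\<bar>)"
proof (cases "k \<le> degree A")
  case True
  then show ?thesis by (intro member_le_sum) auto
qed (simp add: coeff_eq_0 sum_nonneg)

text \<open>Large n are covered by the limit theorem and the boundedness of \<open>Psi r\<close>;
  the finitely many others contribute finitely many coefficients each.\<close>

lemma cf_bound: "\<exists>C\<ge>0. \<forall>n k. sqrt (real n) ^ Suc r * \<bar>cf ([:-1, 1:] ^ r * E) N n k\<bar> \<le> C"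
proof -
  obtain B where B: "\<And>z. \<bar>Psi r z\<bar> \<le> B" using Psi_bounded by blast
  have "\<forall>\<^sub>F n in sequentially. \<forall>k. \<bar>sqrt (real n) ^ Suc r * cf ([:-1, 1:] ^ r * E) N n k - poly E 1 * Psi r (zs n k)\<bar> < 1"
    by (rule cf_limit) simp
  then obtain n0 where n0: "\<And>n k. n \<ge> n0 \<Longrightarrow> \<bar>sqrt (real n) ^ Suc r * cf ([:-1, 1:] ^ r * E) N n k - poly E 1 * Psi r (zs n k)\<bar> < 1"
    unfolding eventually_sequentially by blast
  define S where "S n = (\<Sum>i\<le>degree ([:-1, 1:] ^ r * E * f ^ (n - N)). \<bar>coeff ([:-1, 1:] ^ r * E * f ^ (n - N)) i\<bar>)" for n
  define C where "C = 1 + \<bar>poly E 1\<bar> * B + (\<Sum>n<n0. sqrt (real n) ^ Suc r * S n)"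
  have S0: "S n \<ge> 0" for n unfolding S_def by (simp add: sum_nonneg)
  have sum0: "(\<Sum>n<n0. sqrt (real n) ^ Suc r * S n) \<ge> 0"
    using S0 by (intro sum_nonneg mult_nonneg_nonneg) auto
  have B0: "0 \<le> \<bar>poly E 1\<bar> * B" using B[of 0] by simp
  show ?thesis
  proof (intro exI[of _ C] conjI allI)
    show "0 \<le> C" using sum0 B0 by (simp add: C_def)
    fix n k
    show "sqrt (real n) ^ Suc r * \<bar>cf ([:-1, 1:] ^ r * E) N n k\<bar> \<le> C"
    proof (cases "n \<ge> n0")
      case True
      have "\<bar>poly E 1 * Psi r (zs n k)\<bar> \<le> \<bar>poly E 1\<bar> * B"
        unfolding abs_mult using B by (intro mult_left_mono) auto
      moreover have "sqrt (real n) ^ Suc r * \<bar>cf ([:-1, 1:] ^ r * E) N n k\<bar> = \<bar>sqrt (real n) ^ Suc r * cf ([:-1, 1:] ^ r * E) N n k\<bar>"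
        by (simp add: abs_mult)
      ultimately show ?thesis using n0[OF True, of k] sum0 unfolding C_def by linarith
    next
      case False
      have "sqrt (real n) ^ Suc r * \<bar>cf ([:-1, 1:] ^ r * E) N n k\<bar> \<le> sqrt (real n) ^ Suc r * S n"
        unfolding cf_def S_def by (intro mult_left_mono abs_coeff_le) auto
      also have "\<dots> \<le> (\<Sum>n<n0. sqrt (real n) ^ Suc r * S n)"
        using False S0 by (intro member_le_sum) auto
      finally show ?thesis using B0 unfolding C_def by linarith
    qed
  qed
qed

text \<open>The polynomial vanishes at 1, and the value of the cofactor there is its derivative. The
  extra factor x - 1 raises the order of vanishing by one, that is, it gains 1/sqrt n.\<close>

lemma monom_minus_f: "\<exists>e. monom 1 i - f = [:-1, 1:] * e \<and> poly e 1 = real i - mean"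
proof -
  have "poly (monom 1 i - f) 1 = 0" using poly_1 by (simp add: poly_monom)
  then have "[:-1, 1:] dvd monom 1 i - f" unfolding poly_eq_0_iff_dvd .
  then obtain e where e: "monom 1 i - f = [:-1, 1:] * e" by (rule dvdE)
  have "poly (pderiv (monom 1 i - f)) 1 = poly e 1"
    unfolding e by (subst pderiv_mult) (simp add: pderiv_pCons)
  moreover have "poly (pderiv (monom 1 i - f)) 1 = real i - mean"
    by (simp add: pderiv_diff pderiv_monom poly_monom mean_eq_pderiv)
  ultimately show ?thesis using e by auto
qed

text \<open>A shift by \<open>i\<close> is multiplication by x^i and a new level is multiplication
  by \<open>f\<close>, so differencing along an edge is multiplication by
  \<open>monom 1 i - f\<close>. Moving the base level to \<open>Suc N\<close> keeps the power of
  \<open>f\<close> the same.\<close>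

lemma cf_step:
  assumes "n \<ge> N" "i \<le> k"
  shows "cf Q N n (k - i) - cf Q N (Suc n) k = cf ((monom 1 i - f) * Q) (Suc N) (Suc n) k"
proof -
  have "cf ((monom 1 i - f) * Q) (Suc N) (Suc n) k
     = coeff (monom 1 i * (Q * f ^ (n - N))) k - coeff (Q * (f * f ^ (n - N))) k"
    unfolding cf_def by (simp add: left_diff_distrib mult.assoc mult.left_commute)
  also have "f * f ^ (n - N) = f ^ (Suc n - N)" using assms by (simp add: Suc_diff_le)
  finally show ?thesis using assms by (simp add: cf_def coeff_monom_mult)
qed

lemma cf_one_step:
  "\<exists>C\<ge>0. \<forall>n k i. n \<ge> N \<longrightarrow> i \<le> k \<longrightarrow> i \<le> degree f \<longrightarrow>
     sqrt (real (Suc n)) ^ Suc (Suc r) * \<bar>cf ([:-1, 1:] ^ r * E) N n (k - i) - cf ([:-1, 1:] ^ r * E) N (Suc n) k\<bar> \<le> C"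
proof -
  have "\<exists>C\<ge>0. \<forall>n k. sqrt (real n) ^ Suc (Suc r) * \<bar>cf ((monom 1 i - f) * ([:-1, 1:] ^ r * E)) (Suc N) n k\<bar> \<le> C" for i
  proof -
    obtain e where e: "monom 1 i - f = [:-1, 1:] * e" using monom_minus_f by blast
    have "(monom 1 i - f) * ([:-1, 1:] ^ r * E) = [:-1, 1:] ^ Suc r * (e * E)"
      unfolding e by (simp only: power_Suc mult_ac)
    then show ?thesis using cf_bound[of "Suc r" "e * E" "Suc N"] by (simp only:)
  qed
  then obtain C where C: "\<And>i. C i \<ge> 0"
    "\<And>i n k. sqrt (real n) ^ Suc (Suc r) * \<bar>cf ((monom 1 i - f) * ([:-1, 1:] ^ r * E)) (Suc N) n k\<bar> \<le> C i" by metis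
  show ?thesis
  proof (intro exI[of _ "\<Sum>i\<le>degree f. C i"] conjI allI impI)
    show "0 \<le> (\<Sum>i\<le>degree f. C i)" using C(1) by (simp add: sum_nonneg)
    fix n k i assume "n \<ge> N" "i \<le> k" "i \<le> degree f"
    then have "sqrt (real (Suc n)) ^ Suc (Suc r) * \<bar>cf ([:-1, 1:] ^ r * E) N n (k - i) - cf ([:-1, 1:] ^ r * E) N (Suc n) k\<bar> \<le> C i"
      using C(2)[of "Suc n" i k] by (simp only: cf_step)
    also have "\<dots> \<le> (\<Sum>i\<le>degree f. C i)" using \<open>i \<le> degree f\<close> C(1) by (intro member_le_sum) auto
    finally show "sqrt (real (Suc n)) ^ Suc (Suc r) * \<bar>cf ([:-1, 1:] ^ r * E) N n (k - i) - cf ([:-1, 1:] ^ r * E) N (Suc n) k\<bar> \<le> (\<Sum>i\<le>degree f. C i)" .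
  qed
qed

text \<open>The displacement \<open>j\<close> over \<open>m\<close> levels is split into
  \<open>m\<close> edges, and the one-step bounds add up. Since 2m \<le> n and 2N \<le> n, every
  level met is at least n/2 and at least \<open>N\<close>; sqrt n is then at most twice the root of
  that level.\<close>

lemma cf_multi_step:
  "\<exists>C\<ge>0. \<forall>n m k j. 2 * N \<le> n \<longrightarrow> 2 * m \<le> n \<longrightarrow> j \<le> k \<longrightarrow> j \<le> degree f * m \<longrightarrow>
     sqrt (real n) ^ Suc (Suc r) * \<bar>cf ([:-1, 1:] ^ r * E) N (n - m) (k - j) - cf ([:-1, 1:] ^ r * E) N n k\<bar> \<le> C * real m"
proof -
  let ?U = "cf ([:-1, 1:] ^ r * E) N"
  obtain C where C: "C \<ge> 0" "\<And>n k i. n \<ge> N \<Longrightarrow> i \<le> k \<Longrightarrow> i \<le> degree f \<Longrightarrow>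
     sqrt (real (Suc n)) ^ Suc (Suc r) * \<bar>?U n (k - i) - ?U (Suc n) k\<bar> \<le> C"
    using cf_one_step[of N r E] by blast
  have "sqrt (real n) ^ Suc (Suc r) * \<bar>?U (n - m) (k - j) - ?U n k\<bar> \<le> (2 ^ Suc (Suc r) * C) * real m"
    if "2 * N \<le> n" "2 * m \<le> n" "j \<le> k" "j \<le> degree f * m" for n m k j
    using that
  proof (induction m arbitrary: j)
    case (Suc m)
    \<comment> \<open>The first m edges take as much of the displacement as they can; at most
      \<open>degree f\<close> is left for the last one.\<close>
    define j' where "j' = min j (degree f * m)"
    define i where "i = j - j'"
    have j': "j' \<le> degree f * m" "j' \<le> j" "i \<le> degree f" "k - j = k - j' - i" "i \<le> k - j'"
      using Suc.prems by (auto simp: j'_def i_def)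
    have IH: "sqrt (real n) ^ Suc (Suc r) * \<bar>?U (n - m) (k - j') - ?U n k\<bar> \<le> (2 ^ Suc (Suc r) * C) * real m"
      using Suc.prems j' by (intro Suc.IH) auto
    define n' where "n' = n - Suc m"
    have n': "n' \<ge> N" "Suc n' = n - m" "real n \<le> 4 * real (Suc n')" using Suc.prems by (auto simp: n'_def)
    have st: "sqrt (real (Suc n')) ^ Suc (Suc r) * \<bar>?U n' (k - j' - i) - ?U (Suc n') (k - j')\<bar> \<le> C"
      using n' j' by (intro C(2)) auto
    have "sqrt (real n) \<le> sqrt (4 * real (Suc n'))" using n'(3) by (rule real_sqrt_le_mono)
    also have "\<dots> = 2 * sqrt (real (Suc n'))" by (simp add: real_sqrt_mult del: of_nat_Suc)
    finally have "sqrt (real n) ^ Suc (Suc r) \<le> (2 * sqrt (real (Suc n'))) ^ Suc (Suc r)"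
      by (intro power_mono) auto
    then have "sqrt (real n) ^ Suc (Suc r) * \<bar>?U n' (k - j' - i) - ?U (Suc n') (k - j')\<bar>
      \<le> (2 * sqrt (real (Suc n'))) ^ Suc (Suc r) * \<bar>?U n' (k - j' - i) - ?U (Suc n') (k - j')\<bar>"
      by (intro mult_right_mono) auto
    also have "\<dots> = 2 ^ Suc (Suc r) * (sqrt (real (Suc n')) ^ Suc (Suc r) * \<bar>?U n' (k - j' - i) - ?U (Suc n') (k - j')\<bar>)"
      by (simp only: power_mult_distrib mult.assoc)
    also have "\<dots> \<le> 2 ^ Suc (Suc r) * C" using st by (intro mult_left_mono) auto
    finally have st2: "sqrt (real n) ^ Suc (Suc r) * \<bar>?U (n - Suc m) (k - j) - ?U (n - m) (k - j')\<bar> \<le> 2 ^ Suc (Suc r) * C"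
      using n' j' by (simp add: n'_def)
    have "\<bar>?U (n - Suc m) (k - j) - ?U n k\<bar> \<le> \<bar>?U (n - Suc m) (k - j) - ?U (n - m) (k - j')\<bar> + \<bar>?U (n - m) (k - j') - ?U n k\<bar>"
      by linarith
    then have "sqrt (real n) ^ Suc (Suc r) * \<bar>?U (n - Suc m) (k - j) - ?U n k\<bar>
      \<le> sqrt (real n) ^ Suc (Suc r) * (\<bar>?U (n - Suc m) (k - j) - ?U (n - m) (k - j')\<bar> + \<bar>?U (n - m) (k - j') - ?U n k\<bar>)"
      by (intro mult_left_mono) auto
    also have "\<dots> = sqrt (real n) ^ Suc (Suc r) * \<bar>?U (n - Suc m) (k - j) - ?U (n - m) (k - j')\<bar>
       + sqrt (real n) ^ Suc (Suc r) * \<bar>?U (n - m) (k - j') - ?U n k\<bar>"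
      by (rule distrib_left)
    also have "\<dots> \<le> 2 ^ Suc (Suc r) * C + (2 ^ Suc (Suc r) * C) * real m" using IH st2 by linarith
    also have "\<dots> = (2 ^ Suc (Suc r) * C) * real (Suc m)" by (simp only: of_nat_Suc ring_distribs mult_1_right)
    finally show ?case .
  qed simp
  then show ?thesis using C(1) by (intro exI[of _ "2 ^ Suc (Suc r) * C"]) auto
qed

section \<open>Estimates on the favourable window\<close>

lemma abs_prod_diff_le:
  fixes a b A B :: real
  assumes "\<bar>a - A\<bar> \<le> \<delta>" "\<bar>b - B\<bar> \<le> \<delta>" "\<bar>A\<bar> \<le> K" "\<bar>B\<bar> \<le> K" "\<delta> \<le> 1"
  shows "\<bar>a * b - A * B\<bar> \<le> \<delta> * (2 * K + 1)"
proof -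
  have \<delta>: "\<delta> \<ge> 0" using assms(1) by linarith
  have "a * b - A * B = (a - A) * (b - B) + A * (b - B) + (a - A) * B" by (simp add: algebra_simps)
  then have "\<bar>a * b - A * B\<bar> \<le> \<bar>a - A\<bar> * \<bar>b - B\<bar> + \<bar>A\<bar> * \<bar>b - B\<bar> + \<bar>a - A\<bar> * \<bar>B\<bar>"
    by (metis (no_types, lifting) abs_mult abs_triangle_ineq add_right_mono order_trans)
  also have "\<dots> \<le> \<delta> * 1 + K * \<delta> + \<delta> * K"
    using assms \<delta> by (intro add_mono mult_mono) auto
  finally show ?thesis by (simp add: algebra_simps)
qed

text \<open>On this window all Psi r with r \<le> s are bounded below by Psi 0.\<close>

definition good :: "nat \<Rightarrow> nat \<Rightarrow> nat \<Rightarrow> bool" where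
  "good s n k \<longleftrightarrow> real s + var \<le> zs n k \<and> zs n k \<le> real s + var + 1"

lemma good_Psi_0:
  assumes "good s n k" shows "Psi 0 (real s + var + 1) \<le> Psi 0 (zs n k)"
  using assms var_pos unfolding good_def by (intro Psi_0_antimono) auto

text \<open>For i \<le> k the coefficient is the rescaled height of the tower over
  \<open>(n - m, k - i)\<close>. The shifts are fixed, so its profile is still \<open>Psi 0\<close>
  at \<open>zs n k\<close>.\<close>

lemma good_cf_ge:
  assumes "i \<le> degree f * m"
  shows "\<forall>\<^sub>F n in sequentially. \<forall>k. good s n k \<longrightarrow> Psi 0 (real s + var + 1) / 2 \<le> sqrt (real n) * cf (monom 1 i) m n k"
proof -
  define \<kappa> where "\<kappa> = Psi 0 (real s + var + 1)"
  have \<kappa>: "\<kappa> > 0" unfolding \<kappa>_def by (rule Psi_0_pos)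
  have "\<forall>\<^sub>F n in sequentially. \<forall>k. \<bar>sqrt (real n) ^ Suc 0 * cf ([:-1, 1:] ^ 0 * monom 1 i) m n k - poly (monom 1 i) 1 * Psi 0 (zs n k)\<bar> < \<kappa> / 2"
    by (rule cf_limit) (use \<kappa> in simp)
  then show ?thesis
  proof eventually_elim
    case (elim n)
    show ?case
    proof (intro allI impI)
      fix k assume "good s n k"
      then have "\<kappa> \<le> Psi 0 (zs n k)" unfolding \<kappa>_def by (rule good_Psi_0)
      moreover have "\<bar>sqrt (real n) * cf (monom 1 i) m n k - Psi 0 (zs n k)\<bar> < \<kappa> / 2"
        using elim[rule_format, of k] by (simp add: poly_monom)
      ultimately show "Psi 0 (real s + var + 1) / 2 \<le> sqrt (real n) * cf (monom 1 i) m n k"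
        unfolding \<kappa>_def[symmetric] abs_less_iff by linarith
    qed
  qed
qed

text \<open>By the three-term recurrence the limit of the rescaled expression is a multiple of Psi 0 * Psi (s - 1).\<close>

lemma cf_wronskian_ge:
  assumes "s \<ge> 1" "poly E 1 \<noteq> 0"
  shows "\<exists>c>0. \<forall>\<^sub>F n in sequentially. \<forall>k. good s n k \<longrightarrow>
    c \<le> sqrt (real n) ^ (s + 3) * \<bar>cf ([:-1, 1:] ^ s * E) N (n - 1) k * cf 1 0 n k - cf ([:-1, 1:] ^ s * E) N n k * cf 1 0 (n - 1) k\<bar>"
proof -
  let ?Q = "[:-1, 1:] ^ s * E"
  define \<kappa> where "\<kappa> = Psi 0 (real s + var + 1)"
  have \<kappa>: "\<kappa> > 0" unfolding \<kappa>_def by (rule Psi_0_pos)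
  define e where "e = poly E 1"
  \<comment> \<open>A lower bound for the modulus of the limit of the rescaled determinant on the
    window.\<close>
  define L where "L = mean * \<bar>e\<bar> * (real s / var) * \<kappa>\<^sup>2"
  have L: "L > 0" using \<kappa> mean_pos var_pos assms by (simp add: L_def e_def)
  obtain B where B: "\<And>r z. \<bar>Psi r z\<bar> \<le> B r" using Psi_bounded by metis
  define K where "K = 1 + mean * \<bar>e\<bar> * B (Suc s) + B 0 + \<bar>e\<bar> * B s + mean * B 1"
  have B0: "B r \<ge> 0" for r using B[of r 0] by linarith
  have K: "mean * \<bar>e\<bar> * B (Suc s) \<le> K" "B 0 \<le> K" "\<bar>e\<bar> * B s \<le> K" "mean * B 1 \<le> K" "K \<ge> 1"
    using B0 mean_pos by (auto simp: K_def intro!: add_nonneg_nonneg)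
  \<comment> \<open>If each of the four factors is within \<delta> of its limit, each of the two
    products is within L/4 of its own; L/2 remains.\<close>
  define \<delta> where "\<delta> = min 1 (L / (4 * (2 * K + 1)))"
  have \<delta>: "\<delta> > 0" "\<delta> \<le> 1" using L K by (auto simp: \<delta>_def)
  have "\<delta> * (2 * K + 1) \<le> L / (4 * (2 * K + 1)) * (2 * K + 1)"
    using K by (intro mult_right_mono) (auto simp: \<delta>_def)
  also have "\<dots> = L / 4" using K by (simp add: divide_simps)
  finally have \<delta>L: "\<delta> * (2 * K + 1) \<le> L / 4" .
  \<comment> \<open>Levels n - 1 and n are compared in the same column, the case i = 0, so the
    cofactor has the value \<open>- mean\<close> at 1.\<close>
  obtain d where d: "monom 1 0 - f = [:-1, 1:] * d" "poly d 1 = - mean" using monom_minus_f[of 0] by auto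
  have e1: "\<forall>\<^sub>F n in sequentially. \<forall>k. \<bar>sqrt (real n) ^ Suc (Suc s) * cf ([:-1, 1:] ^ Suc s * (d * E)) (Suc N) n k - poly (d * E) 1 * Psi (Suc s) (zs n k)\<bar> < \<delta>"
    by (rule cf_limit[OF \<delta>(1)])
  have e2: "\<forall>\<^sub>F n in sequentially. \<forall>k. \<bar>sqrt (real n) ^ Suc 0 * cf ([:-1, 1:] ^ 0 * 1) 0 n k - poly 1 1 * Psi 0 (zs n k)\<bar> < \<delta>"
    by (rule cf_limit[OF \<delta>(1)])
  have e3: "\<forall>\<^sub>F n in sequentially. \<forall>k. \<bar>sqrt (real n) ^ Suc s * cf ?Q N n k - poly E 1 * Psi s (zs n k)\<bar> < \<delta>"
    by (rule cf_limit[OF \<delta>(1)])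
  have e4: "\<forall>\<^sub>F n in sequentially. \<forall>k. \<bar>sqrt (real n) ^ Suc 1 * cf ([:-1, 1:] ^ 1 * d) 1 n k - poly d 1 * Psi 1 (zs n k)\<bar> < \<delta>"
    by (rule cf_limit[OF \<delta>(1)])
  show ?thesis
  proof (intro exI[of _ "L / 2"] conjI)
    show "L / 2 > 0" using L by simp
    show "\<forall>\<^sub>F n in sequentially. \<forall>k. good s n k \<longrightarrow>
      L / 2 \<le> sqrt (real n) ^ (s + 3) * \<bar>cf ?Q N (n - 1) k * cf 1 0 n k - cf ?Q N n k * cf 1 0 (n - 1) k\<bar>"
      using e1 e2 e3 e4 eventually_ge_at_top[of "Suc N"]
    proof eventually_elim
      case (elim n)
      show ?case
      proof (intro allI impI)
        fix k assume g: "good s n k"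
        define z where "z = zs n k"
        define S where "S = sqrt (real n)"
        define U U' P P' where "U = cf ?Q N n k" and "U' = cf ?Q N (n - 1) k" and "P = cf 1 0 n k" and "P' = cf 1 0 (n - 1) k"
        have stU: "U' - U = cf ([:-1, 1:] ^ Suc s * (d * E)) (Suc N) n k"
        proof -
          have "U' - U = cf ((monom 1 0 - f) * ?Q) (Suc N) (Suc (n - 1)) k"
            unfolding U_def U'_def using cf_step[of N "n - 1" 0 k ?Q] elim(5) by simp
          also have "(monom 1 0 - f) * ?Q = [:-1, 1:] ^ Suc s * (d * E)"
            unfolding d(1) by (simp only: power_Suc mult_ac)
          finally show ?thesis using elim(5) by simp
        qed
        have stP: "P' - P = cf ([:-1, 1:] ^ 1 * d) 1 n k"
        proof -
          have "P' - P = cf ((monom 1 0 - f) * 1) (Suc 0) (Suc (n - 1)) k"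
            unfolding P_def P'_def using cf_step[of 0 "n - 1" 0 k 1] elim(5) by simp
          also have "(monom 1 0 - f) * 1 = [:-1, 1:] ^ 1 * d"
            unfolding d(1) by (simp only: power_one_right mult_1_right)
          finally show ?thesis using elim(5) by simp
        qed
        define a b c h where "a = S ^ Suc (Suc s) * (U' - U)" and "b = S * P" and "c = S ^ Suc s * U" and "h = S ^ Suc 1 * (P' - P)"
        define A B' C D where "A = - mean * e * Psi (Suc s) z" and "B' = Psi 0 z" and "C = e * Psi s z" and "D = - mean * Psi 1 z"
        have la: "\<bar>a - A\<bar> \<le> \<delta>" using elim(1)[rule_format, of k] d(2) by (simp add: a_def stU A_def e_def z_def S_def del: power_Suc)
        have lb: "\<bar>b - B'\<bar> \<le> \<delta>" using elim(2)[rule_format, of k] by (simp add: b_def P_def B'_def z_def S_def)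
        have lc: "\<bar>c - C\<bar> \<le> \<delta>" using elim(3)[rule_format, of k] by (simp add: c_def U_def C_def e_def z_def S_def del: power_Suc)
        have ld: "\<bar>h - D\<bar> \<le> \<delta>" using elim(4)[rule_format, of k] d(2) by (simp add: h_def stP D_def z_def S_def del: power_Suc)
        have "\<bar>A\<bar> = mean * \<bar>e\<bar> * \<bar>Psi (Suc s) z\<bar>" using mean_pos by (simp add: A_def abs_mult)
        also have "\<dots> \<le> mean * \<bar>e\<bar> * B (Suc s)" using mean_pos B by (intro mult_left_mono) auto
        finally have bA: "\<bar>A\<bar> \<le> K" using K by linarith
        have bB: "\<bar>B'\<bar> \<le> K" using B[of 0 z] K unfolding B'_def by linarith
        have "\<bar>C\<bar> \<le> \<bar>e\<bar> * B s" unfolding C_def abs_mult using B by (intro mult_left_mono) auto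
        then have bC: "\<bar>C\<bar> \<le> K" using K by linarith
        have "\<bar>D\<bar> = mean * \<bar>Psi 1 z\<bar>" using mean_pos by (simp add: D_def abs_mult)
        also have "\<dots> \<le> mean * B 1" using mean_pos B by (intro mult_left_mono) auto
        finally have bD: "\<bar>D\<bar> \<le> K" using K by linarith
        have ab: "\<bar>a * b - A * B'\<bar> \<le> L / 4"
          using abs_prod_diff_le[OF la lb bA bB \<delta>(2)] \<delta>L by linarith
        have cd: "\<bar>c * h - C * D\<bar> \<le> L / 4"
          using abs_prod_diff_le[OF lc ld bC bD \<delta>(2)] \<delta>L by linarith
        have PsiS: "Psi (Suc s) z = (z * Psi s z - real s * Psi (s - 1) z) / var"
          using Psi_Suc[of s z] var_pos by (simp add: field_simps)
        have Psi1: "Psi 1 z = z * Psi 0 z / var"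
          using Psi_Suc[of 0 z] var_pos by (simp add: field_simps)
        \<comment> \<open>The terms z Psi s Psi 0 of the two products cancel; only the term of the
          recurrence with Psi (s - 1) remains.\<close>
        have main: "A * B' - C * D = mean * e * (real s / var) * (Psi 0 z * Psi (s - 1) z)"
          unfolding A_def B'_def C_def D_def PsiS Psi1 using var_pos by (simp add: field_simps)
        have k1: "\<kappa> \<le> Psi 0 z" unfolding \<kappa>_def z_def by (rule good_Psi_0[OF g])
        have "Psi 0 z \<le> Psi (s - 1) z" using g unfolding good_def z_def by (intro Psi_ge_Psi_0[of s]) auto
        then have "\<kappa> * \<kappa> \<le> Psi 0 z * Psi (s - 1) z" using k1 \<kappa> by (intro mult_mono) auto
        then have "mean * \<bar>e\<bar> * (real s / var) * (\<kappa> * \<kappa>) \<le> mean * \<bar>e\<bar> * (real s / var) * (Psi 0 z * Psi (s - 1) z)"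
          using mean_pos var_pos by (intro mult_left_mono) auto
        also have "\<dots> = \<bar>A * B' - C * D\<bar>"
          unfolding main using mean_pos var_pos Psi_0_pos[of z] \<open>Psi 0 z \<le> Psi (s - 1) z\<close>
          by (simp add: abs_mult)
        finally have L_le: "L \<le> \<bar>A * B' - C * D\<bar>" by (simp add: L_def power2_eq_square)
        have "L / 2 \<le> \<bar>a * b - c * h\<bar>" using ab cd L_le by linarith
        \<comment> \<open>Subtracting the entries of level n does not change the determinant, but it
          gives both products the exact order S^(-s-3).\<close>
        also have "a * b - c * h = S ^ (s + 3) * ((U' - U) * P - U * (P' - P))"
          by (simp add: a_def b_def c_def h_def power_add algebra_simps eval_nat_numeral)
        also have "(U' - U) * P - U * (P' - P) = U' * P - U * P'" by (simp add: algebra_simps)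
        finally show "L / 2 \<le> sqrt (real n) ^ (s + 3) * \<bar>cf ?Q N (n - 1) k * cf 1 0 n k - cf ?Q N n k * cf 1 0 (n - 1) k\<bar>"
          by (simp add: abs_mult U_def U'_def P_def P'_def S_def)
      qed
    qed
  qed
qed

text \<open>Complements \<open>cf_bound\<close>, whose factor sqrt n vanishes at n = 0.\<close>

lemma cf_abs_bound: "\<exists>C\<ge>0. \<forall>n k. \<bar>cf ([:-1, 1:] ^ r * E) N n k\<bar> \<le> C"
proof -
  let ?Q = "[:-1, 1:] ^ r * E"
  obtain C where C: "C \<ge> 0" "\<And>n k. sqrt (real n) ^ Suc r * \<bar>cf ?Q N n k\<bar> \<le> C"
    using cf_bound by blast
  define C' where "C' = (\<Sum>i\<le>degree ?Q. \<bar>coeff ?Q i\<bar>)"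
  have "\<bar>cf ?Q N n k\<bar> \<le> C + C'" for n k
  proof (cases "n = 0")
    case True
    have "\<bar>cf ?Q N n k\<bar> = \<bar>coeff ?Q k\<bar>" unfolding cf_def using True by simp
    also have "\<dots> \<le> C'" unfolding C'_def by (rule abs_coeff_le)
    finally show ?thesis using C(1) by linarith
  next
    case False
    then have "1 \<le> sqrt (real n) ^ Suc r" by (intro one_le_power) auto
    then have "1 * \<bar>cf ?Q N n k\<bar> \<le> sqrt (real n) ^ Suc r * \<bar>cf ?Q N n k\<bar>" by (intro mult_right_mono) auto
    moreover have "C' \<ge> 0" unfolding C'_def by (simp add: sum_nonneg)
    ultimately show ?thesis using C(2)[of n k] by linarith
  qed
  moreover have "C + C' \<ge> 0" using C(1) unfolding C'_def by (intro add_nonneg_nonneg sum_nonneg) auto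
  ultimately show ?thesis by blast
qed

text \<open>Let lam be the quotient U/P at \<open>(n, k)\<close>. Then U - lam P vanishes there, so
  the expression is a difference of increments of U and of lam P. For 2m \<le> n the multi-step
  bounds apply, with lam = O((sqrt n)^(-s)) on the window. For larger m boundedness is enough, since
  then sqrt n \<le> 2m; this case dictates the power of m.\<close>

lemma cf_bridge_bound:
  "\<exists>C\<ge>0. \<forall>\<^sub>F n in sequentially. \<forall>k. good s n k \<longrightarrow>
     (\<forall>m j. 1 \<le> m \<longrightarrow> m \<le> n \<longrightarrow> j \<le> k \<longrightarrow> j \<le> degree f * m \<longrightarrow>
       sqrt (real n) ^ (s + 2) * \<bar>cf ([:-1, 1:] ^ s * E) N (n - m) (k - j)
          - cf ([:-1, 1:] ^ s * E) N n k / cf 1 0 n k * cf 1 0 (n - m) (k - j)\<bar> \<le> C * real m ^ (s + 2))"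
proof -
  let ?Q = "[:-1, 1:] ^ s * E"
  let ?U = "cf ?Q N" and ?P = "cf 1 0"
  define \<kappa> where "\<kappa> = Psi 0 (real s + var + 1) / 2"
  have \<kappa>: "\<kappa> > 0" unfolding \<kappa>_def using Psi_0_pos by simp
  obtain C1 where C1: "C1 \<ge> 0" "\<And>n m k j. 2 * N \<le> n \<Longrightarrow> 2 * m \<le> n \<Longrightarrow> j \<le> k \<Longrightarrow> j \<le> degree f * m \<Longrightarrow>
     sqrt (real n) ^ Suc (Suc s) * \<bar>?U (n - m) (k - j) - ?U n k\<bar> \<le> C1 * real m"
    using cf_multi_step[of N s E] by blast
  obtain C2 where C2: "C2 \<ge> 0" "\<And>n m k j. 2 * m \<le> n \<Longrightarrow> j \<le> k \<Longrightarrow> j \<le> degree f * m \<Longrightarrow>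
     (sqrt (real n))\<^sup>2 * \<bar>?P (n - m) (k - j) - ?P n k\<bar> \<le> C2 * real m"
    using cf_multi_step[of 0 0 1] by (auto simp: power2_eq_square)
  obtain C3 where C3: "C3 \<ge> 0" "\<And>n k. sqrt (real n) ^ Suc s * \<bar>?U n k\<bar> \<le> C3"
    using cf_bound[of s E N] by blast
  obtain C4 where C4: "C4 \<ge> 0" "\<And>n k. \<bar>?U n k\<bar> \<le> C4" using cf_abs_bound[of s E N] by blast
  obtain C5 where C5: "C5 \<ge> 0" "\<And>n k. \<bar>?P n k\<bar> \<le> C5" using cf_abs_bound[of 0 1 0] by auto
  define \<Lambda> where "\<Lambda> = C3 / \<kappa>"
  have \<Lambda>0: "\<Lambda> \<ge> 0" using C3 \<kappa> by (simp add: \<Lambda>_def)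
  define C where "C = (C1 + \<Lambda> * C2) + 2 ^ (s + 2) * (C4 + \<Lambda> * C5)"
  have C0: "0 \<le> C1 + \<Lambda> * C2" "0 \<le> 2 ^ (s + 2) * (C4 + \<Lambda> * C5)" using C1 C2 C4 C5 \<Lambda>0 by auto
  have ev: "\<forall>\<^sub>F n in sequentially. \<forall>k. good s n k \<longrightarrow> \<kappa> \<le> sqrt (real n) * ?P n k"
    using good_cf_ge[of 0 0 s] by (simp add: \<kappa>_def monom_0 flip: one_pCons)
  show ?thesis
  proof (intro exI[of _ C] conjI)
    show "0 \<le> C" using C0 unfolding C_def by linarith
    show "\<forall>\<^sub>F n in sequentially. \<forall>k. good s n k \<longrightarrow>
     (\<forall>m j. 1 \<le> m \<longrightarrow> m \<le> n \<longrightarrow> j \<le> k \<longrightarrow> j \<le> degree f * m \<longrightarrow>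
       sqrt (real n) ^ (s + 2) * \<bar>?U (n - m) (k - j) - ?U n k / ?P n k * ?P (n - m) (k - j)\<bar> \<le> C * real m ^ (s + 2))"
      using ev eventually_ge_at_top[of "2 * N + 1"]
    proof eventually_elim
      case (elim n)
      show ?case
      proof (intro allI impI)
        fix k m j assume g: "good s n k" and m: "1 \<le> m" "m \<le> n" and j: "j \<le> k" "j \<le> degree f * m"
        define S where "S = sqrt (real n)"
        define lam where "lam = ?U n k / ?P n k"
        have S: "S \<ge> 1" using elim(2) by (simp add: S_def)
        have SP: "\<kappa> \<le> S * ?P n k" using elim(1) g by (simp add: S_def)
        then have P: "?P n k > 0" using S \<kappa> by (smt (verit, best) mult_nonneg_nonpos)
        have "S ^ s * \<bar>lam\<bar> = (S ^ Suc s * \<bar>?U n k\<bar>) / (S * ?P n k)"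
          using P S by (simp add: lam_def abs_divide)
        also have "\<dots> \<le> C3 / \<kappa>"
          using C3 \<kappa> SP unfolding S_def by (intro frac_le) auto
        finally have lam: "S ^ s * \<bar>lam\<bar> \<le> \<Lambda>" by (simp add: \<Lambda>_def)
        have m1: "1 \<le> real m ^ (s + 2)" "real m \<le> real m ^ (s + 2)"
          using m by (intro one_le_power self_le_power; simp)+
        show "sqrt (real n) ^ (s + 2) * \<bar>?U (n - m) (k - j) - ?U n k / ?P n k * ?P (n - m) (k - j)\<bar> \<le> C * real m ^ (s + 2)"
        proof (cases "2 * m \<le> n")
          case True
          have a1: "S ^ (s + 2) * \<bar>?U (n - m) (k - j) - ?U n k\<bar> \<le> C1 * real m"
            using C1(2)[of n m j k] True j elim(2) by (simp add: S_def)
          have a2: "S\<^sup>2 * \<bar>?P (n - m) (k - j) - ?P n k\<bar> \<le> C2 * real m"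
            using C2(2)[of m n j k] True j by (simp add: S_def)
          have "?U (n - m) (k - j) - lam * ?P (n - m) (k - j) = (?U (n - m) (k - j) - ?U n k) - lam * (?P (n - m) (k - j) - ?P n k)"
            using P by (simp add: lam_def field_simps)
          then have "\<bar>?U (n - m) (k - j) - lam * ?P (n - m) (k - j)\<bar> \<le> \<bar>?U (n - m) (k - j) - ?U n k\<bar> + \<bar>lam\<bar> * \<bar>?P (n - m) (k - j) - ?P n k\<bar>"
            by (metis abs_mult abs_triangle_ineq4)
          then have "S ^ (s + 2) * \<bar>?U (n - m) (k - j) - lam * ?P (n - m) (k - j)\<bar>
              \<le> S ^ (s + 2) * (\<bar>?U (n - m) (k - j) - ?U n k\<bar> + \<bar>lam\<bar> * \<bar>?P (n - m) (k - j) - ?P n k\<bar>)"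
            using S by (intro mult_left_mono) auto
          also have "\<dots> = S ^ (s + 2) * \<bar>?U (n - m) (k - j) - ?U n k\<bar> + (S ^ s * \<bar>lam\<bar>) * (S\<^sup>2 * \<bar>?P (n - m) (k - j) - ?P n k\<bar>)"
            by (simp add: power_add algebra_simps power2_eq_square)
          also have "\<dots> \<le> C1 * real m + \<Lambda> * (C2 * real m)"
            using S by (intro add_mono[OF a1] mult_mono[OF lam a2] \<Lambda>0) auto
          also have "\<dots> = (C1 + \<Lambda> * C2) * real m" by (simp add: algebra_simps)
          also have "\<dots> \<le> (C1 + \<Lambda> * C2) * real m ^ (s + 2)" using C0 m1 by (intro mult_left_mono) auto
          also have "\<dots> \<le> C * real m ^ (s + 2)"
            using C0 m1 by (intro mult_right_mono) (auto simp: C_def)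
          finally show ?thesis by (simp add: S_def lam_def)
        next
          case False
          have "\<bar>lam\<bar> \<le> S ^ s * \<bar>lam\<bar>" using one_le_power[OF S, of s] by (simp add: mult_left_le_one_le mult_le_cancel_right1)
          then have l: "\<bar>lam\<bar> \<le> \<Lambda>" using lam by linarith
          have "\<bar>?U (n - m) (k - j) - lam * ?P (n - m) (k - j)\<bar> \<le> \<bar>?U (n - m) (k - j)\<bar> + \<bar>lam\<bar> * \<bar>?P (n - m) (k - j)\<bar>"
            by (metis abs_mult abs_triangle_ineq4)
          also have "\<dots> \<le> C4 + \<Lambda> * C5" using C4 C5 l \<Lambda>0 by (intro add_mono mult_mono) auto
          finally have b: "\<bar>?U (n - m) (k - j) - lam * ?P (n - m) (k - j)\<bar> \<le> C4 + \<Lambda> * C5" .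
          have "S \<le> 2 * real m"
          proof -
            have "S * 1 \<le> S * S" using S by (intro mult_left_mono) auto
            then have "S \<le> real n" by (simp add: S_def)
            then show ?thesis using False by linarith
          qed
          then have "S ^ (s + 2) \<le> (2 * real m) ^ (s + 2)" using S by (intro power_mono) auto
          then have "S ^ (s + 2) * \<bar>?U (n - m) (k - j) - lam * ?P (n - m) (k - j)\<bar> \<le> (2 * real m) ^ (s + 2) * (C4 + \<Lambda> * C5)"
            using b S by (intro mult_mono) auto
          also have "\<dots> = (2 ^ (s + 2) * (C4 + \<Lambda> * C5)) * real m ^ (s + 2)"
            by (simp only: power_mult_distrib mult_ac)
          also have "\<dots> \<le> C * real m ^ (s + 2)"
            using C0 m1 by (intro mult_right_mono) (auto simp: C_def)
          finally show ?thesis by (simp add: S_def lam_def)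
        qed
      qed
    qed
  qed
qed

end

section \<open>Finite paths in adic order\<close>

lemma sorted_wrt_concat_map:
  assumes "sorted_wrt R es"
    and "\<And>e. e \<in> set es \<Longrightarrow> sorted_wrt Q (F e)"
    and "\<And>e e' c c'. R e e' \<Longrightarrow> e \<in> set es \<Longrightarrow> e' \<in> set es \<Longrightarrow> c \<in> set (F e) \<Longrightarrow> c' \<in> set (F e') \<Longrightarrow> Q c c'"
  shows "sorted_wrt Q (concat (map F es))"
  using assms
proof (induction es)
  case (Cons e es)
  have "sorted_wrt Q (concat (map F es))"
    using Cons.prems by (intro Cons.IH) auto
  then show ?case using Cons.prems by (auto simp: sorted_wrt_append)
qed simp

text \<open>All incoming edges of an interior vertex in canonical order; near the boundary the list
  is filtered by type.\<close>

definition labs :: "nat poly \<Rightarrow> label list" where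
  "labs p = concat (map (\<lambda>j. map (Pair j) [0..<coeff p j]) (rev [0..<Suc (degree p)]))"

lemma set_labs: "set (labs p) = {e. valid_label p e}"
proof -
  have "(a, b) \<in> set (labs p) \<longleftrightarrow> valid_label p (a, b)" for a b
    by (auto simp: labs_def valid_label_def image_iff less_Suc_eq_le simp del: upt_Suc)
  then show ?thesis by auto
qed

lemma sorted_labs: "sorted_wrt edge_less (labs p)"
  unfolding labs_def
proof (rule sorted_wrt_concat_map)
  show "sorted_wrt (\<lambda>i j. j < i) (rev [0..<Suc (degree p)])"
    unfolding sorted_wrt_rev by (rule sorted_wrt_upt)
  show "sorted_wrt edge_less (map (Pair j) [0..<coeff p j])" for j
    unfolding sorted_wrt_map by (rule sorted_wrt_mono_rel[OF _ sorted_wrt_upt]) (simp add: edge_less_def)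
qed (auto simp: edge_less_def)

lemma sum_list_concat_map: "sum_list (concat xss) = sum_list (map sum_list xss)"
  by (induction xss) simp_all

lemma sum_list_labs:
  fixes F :: "nat \<Rightarrow> 'a :: comm_semiring_1"
  shows "(\<Sum>e\<leftarrow>labs p. F (fst e)) = (\<Sum>j\<le>degree p. of_nat (coeff p j) * F j)"
proof -
  have "(\<Sum>e\<leftarrow>labs p. F (fst e)) = (\<Sum>j\<leftarrow>rev [0..<Suc (degree p)]. of_nat (coeff p j) * F j)"
    unfolding labs_def map_concat sum_list_concat_map map_map comp_def
    by (simp add: map_replicate_const sum_list_replicate del: upt_Suc)
  also have "\<dots> = (\<Sum>j\<leftarrow>[0..<Suc (degree p)]. of_nat (coeff p j) * F j)"
    by (simp only: rev_map[symmetric] sum_list_rev)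
  also have "\<dots> = (\<Sum>j\<le>degree p. of_nat (coeff p j) * F j)"
    unfolding interv_sum_list_conv_sum_set_nat by (intro sum.cong) auto
  finally show ?thesis .
qed

lemma sum_list_filter_labs:
  fixes F :: "nat \<Rightarrow> 'a :: comm_semiring_1"
  shows "(\<Sum>e\<leftarrow>filter (\<lambda>e. fst e \<le> k) (labs p). F (fst e)) = (\<Sum>j\<le>k. of_nat (coeff p j) * F j)"
proof -
  have "(\<Sum>e\<leftarrow>filter (\<lambda>e. fst e \<le> k) (labs p). F (fst e)) = (\<Sum>e\<leftarrow>labs p. if fst e \<le> k then F (fst e) else 0)"
    by (rule sum_list_map_filter')
  also have "\<dots> = (\<Sum>j\<le>degree p. of_nat (coeff p j) * (if j \<le> k then F j else 0))"
    by (rule sum_list_labs)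
  also have "\<dots> = (\<Sum>j\<in>{..degree p} \<inter> {..k}. of_nat (coeff p j) * F j)"
    by (subst sum.inter_restrict) (auto intro!: sum.cong)
  also have "\<dots> = (\<Sum>j\<le>k. of_nat (coeff p j) * F j)"
  proof (rule sum.mono_neutral_left)
    show "\<forall>i\<in>{..k} - {..degree p} \<inter> {..k}. of_nat (coeff p i) * F i = 0"
      using coeff_eq_0[of p] by (metis DiffE IntI atMost_iff mult_zero_left not_le of_nat_0)
  qed auto
  finally show ?thesis .
qed

text \<open>The order looks at the last differing edge first. Running through the last edge, and for
  each one through the paths to its source, therefore lists the finite paths increasingly.\<close>

fun paths :: "nat poly \<Rightarrow> nat \<Rightarrow> nat \<Rightarrow> label list list" where
  "paths p 0 k = (if k = 0 then [[]] else [])"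
| "paths p (Suc n) k = concat (map (\<lambda>e. map (\<lambda>c. c @ [e]) (paths p n (k - fst e)))
     (filter (\<lambda>e. fst e \<le> k) (labs p)))"

lemma set_paths: "set (paths p n k) = fin_paths p n k"
proof (induction n arbitrary: k)
  case 0
  then show ?case by (auto simp: fin_paths_def)
next
  case (Suc n)
  have "c \<in> fin_paths p (Suc n) k \<longleftrightarrow>
      (\<exists>e c'. c = c' @ [e] \<and> valid_label p e \<and> fst e \<le> k \<and> c' \<in> fin_paths p n (k - fst e))" for c
  proof (cases c rule: rev_cases)
    case (snoc c' e)
    then show ?thesis by (auto simp: fin_paths_def)
  qed (auto simp: fin_paths_def)
  then show ?case
    by (simp add: set_eq_iff image_iff Suc.IH set_labs del: split_paired_Ex) blast
qed

lemma edge_less_asym: "edge_less e e' \<Longrightarrow> \<not> edge_less e' e"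
  by (auto simp: edge_less_def)

lemma fin_less_irrefl: "\<not> fin_less c c"
  by (simp add: fin_less_def)

lemma fin_less_asym:
  assumes "length c = length c'" "fin_less c c'" shows "\<not> fin_less c' c"
proof
  assume "fin_less c' c"
  then obtain i where i: "i < length c" "c' ! i \<noteq> c ! i" "\<And>l. i < l \<Longrightarrow> l < length c \<Longrightarrow> c' ! l = c ! l" "edge_less (c' ! i) (c ! i)"
    using assms(1) unfolding fin_less_def by auto
  obtain j where j: "j < length c" "c ! j \<noteq> c' ! j" "\<And>l. j < l \<Longrightarrow> l < length c \<Longrightarrow> c ! l = c' ! l" "edge_less (c ! j) (c' ! j)"
    using assms(2) unfolding fin_less_def by auto
  have "\<not> i < j" using i(3)[of j] j(1,2) by auto
  moreover have "\<not> j < i" using j(3)[of i] i(1,2) by auto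
  ultimately have "i = j" by simp
  then show False using i j edge_less_asym by blast
qed

lemma fin_less_snoc_same:
  assumes "length c = length c'" "fin_less c c'" shows "fin_less (c @ [e]) (c' @ [e])"
proof -
  obtain j where j: "j < length c" "c ! j \<noteq> c' ! j" "\<And>l. j < l \<Longrightarrow> l < length c \<Longrightarrow> c ! l = c' ! l" "edge_less (c ! j) (c' ! j)"
    using assms(2) unfolding fin_less_def by auto
  show ?thesis unfolding fin_less_def
    using j assms(1) by (intro exI[of _ j]) (auto simp: nth_append less_Suc_eq)
qed

lemma fin_less_snoc_edge:
  assumes "length c = length c'" "edge_less e e'" shows "fin_less (c @ [e]) (c' @ [e'])"
proof -
  have "e \<noteq> e'" using assms(2) edge_less_asym by blast
  then show ?thesis unfolding fin_less_def using assms
    by (intro exI[of _ "length c"]) (auto simp: nth_append)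
qed

lemma sorted_paths: "sorted_wrt fin_less (paths p n k)"
proof (induction n arbitrary: k)
  case (Suc n)
  have len: "c \<in> set (paths p n k) \<Longrightarrow> length c = n" for c k
    unfolding set_paths by (simp add: fin_paths_def)
  show ?case unfolding paths.simps
  proof (rule sorted_wrt_concat_map)
    show "sorted_wrt edge_less (filter (\<lambda>e. fst e \<le> k) (labs p))"
      by (rule sorted_wrt_filter[OF sorted_labs])
    show "sorted_wrt fin_less (map (\<lambda>c. c @ [e]) (paths p n (k - fst e)))" for e
      unfolding sorted_wrt_map
      by (rule sorted_wrt_mono_rel[OF _ Suc.IH]) (auto intro: fin_less_snoc_same simp: len)
    show "fin_less c c'" if "edge_less e e'" "c \<in> set (map (\<lambda>c. c @ [e]) (paths p n (k - fst e)))"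
      "c' \<in> set (map (\<lambda>c. c @ [e']) (paths p n (k - fst e')))" for e e' c c'
    proof -
      from that obtain a a' where "c = a @ [e]" "c' = a' @ [e']" "length a = n" "length a' = n"
        using len by auto
      then show ?thesis using that(1) by (simp add: fin_less_snoc_edge)
    qed
  qed
qed simp

lemma length_paths: "length (paths p n k) = H p n k"
proof (induction n arbitrary: k)
  case (Suc n)
  have "length (paths p (Suc n) k) = (\<Sum>e\<leftarrow>filter (\<lambda>e. fst e \<le> k) (labs p). length (paths p n (k - fst e)))"
    by (simp add: length_concat comp_def)
  also have "\<dots> = (\<Sum>j\<le>k. coeff p j * H p n (k - j))"
    unfolding Suc.IH by (subst sum_list_filter_labs[where F = "\<lambda>j. H p n (k - j)"]) simp
  also have "\<dots> = H p (Suc n) k"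
    by (simp add: H_def coeff_mult)
  finally show ?case .
qed (simp add: H_def)

text \<open>The cardinality of this set is the rank by which \<open>tau\<close> selects a
  path.\<close>

lemma nth_sorted_less_set:
  assumes "i < H p n k"
  shows "{c' \<in> fin_paths p n k. fin_less c' (paths p n k ! i)} = set (take i (paths p n k))"
proof -
  let ?L = "paths p n k"
  have len: "length ?L = H p n k" by (rule length_paths)
  have l: "length (?L ! a) = n" if "a < H p n k" for a
    using that len set_paths[of p n k] nth_mem[of a ?L] by (simp add: fin_paths_def)
  have lt: "fin_less (?L ! a) (?L ! b)" if "a < b" "b < H p n k" for a b
    using sorted_wrt_nth_less[OF sorted_paths that(1)] that len by simp
  show ?thesis
  proof (intro set_eqI iffI)
    fix c assume "c \<in> {c' \<in> fin_paths p n k. fin_less c' (?L ! i)}"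
    then have c: "c \<in> set ?L" "fin_less c (?L ! i)" by (simp_all add: set_paths)
    then obtain a where a: "a < H p n k" "c = ?L ! a" by (metis in_set_conv_nth len)
    have "a < i"
    proof (rule ccontr)
      assume "\<not> a < i"
      then consider "a = i" | "i < a" by linarith
      then show False
      proof cases
        case 1 then show False using c a fin_less_irrefl by simp
      next
        case 2
        then have "fin_less (?L ! i) (?L ! a)" using lt a by simp
        moreover have "length (?L ! i) = length (?L ! a)" using l assms a by simp
        ultimately show False using c a fin_less_asym[of "?L ! i" "?L ! a"] by simp
      qed
    qed
    then show "c \<in> set (take i ?L)" using a assms len by (auto simp: in_set_conv_nth)
  next
    fix c assume "c \<in> set (take i ?L)"
    then obtain a where a: "a < i" "c = ?L ! a" using assms len by (auto simp: in_set_conv_nth)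
    then have "c \<in> set ?L" using assms len by simp
    then show "c \<in> {c' \<in> fin_paths p n k. fin_less c' (?L ! i)}"
      using lt[of a i] a assms by (simp add: set_paths)
  qed
qed

lemma distinct_paths: "distinct (paths p n k)"
proof -
  have "paths p n k ! a \<noteq> paths p n k ! b" if "a < b" "b < length (paths p n k)" for a b
    using sorted_wrt_nth_less[OF sorted_paths that] fin_less_irrefl by metis
  then show ?thesis by (metis distinct_conv_nth linorder_neqE_nat)
qed

lemma tau_eq:
  assumes "i < H p n k"
  shows "tau p n k (Suc i) = paths p n k ! i"
  unfolding tau_def
proof (rule the_equality)
  have card: "card {c' \<in> fin_paths p n k. fin_less c' (paths p n k ! a)} = a" if "a < H p n k" for a
    unfolding nth_sorted_less_set[OF that] using that distinct_paths[of p n k]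
    by (simp add: distinct_card length_paths)
  show "paths p n k ! i \<in> fin_paths p n k \<and> card {c' \<in> fin_paths p n k. fin_less c' (paths p n k ! i)} = Suc i - 1"
    using assms card nth_mem[of i "paths p n k"] by (simp add: length_paths set_paths)
  fix c assume c: "c \<in> fin_paths p n k \<and> card {c' \<in> fin_paths p n k. fin_less c' c} = Suc i - 1"
  then obtain a where "a < H p n k" "c = paths p n k ! a"
    by (metis in_set_conv_nth length_paths set_paths)
  then show "c = paths p n k ! i" using c card by simp
qed

section \<open>The values of \<open>g\<close> along a tower and their polygon\<close>

definition gvals :: "nat poly \<Rightarrow> (path \<Rightarrow> real) \<Rightarrow> nat \<Rightarrow> nat \<Rightarrow> real list" where
  "gvals p g n k = map (\<lambda>c. g (\<lambda>l. if l < n then c ! l else (0, 0))) (paths p n k)"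

lemma length_gvals [simp]: "length (gvals p g n k) = H p n k"
  by (simp add: gvals_def length_paths)

lemma Fdisc_eq:
  assumes "j \<le> H p n k"
  shows "Fdisc p g n k j = sum_list (take j (gvals p g n k))"
proof -
  have "Fdisc p g n k j = (\<Sum>i<j. gval p g n k (Suc i))"
    unfolding Fdisc_def by (rule sum.reindex_bij_witness[of _ Suc "\<lambda>i. i - 1"]) auto
  also have "\<dots> = (\<Sum>i<j. gvals p g n k ! i)"
  proof (rule sum.cong)
    fix i assume "i \<in> {..<j}"
    then have "i < H p n k" using assms by simp
    then show "gval p g n k (Suc i) = gvals p g n k ! i"
      by (simp only: gval_def tau_eq gvals_def length_paths nth_map)
  qed simp
  also have "\<dots> = sum_list (take j (gvals p g n k))"
    using assms by (simp add: sum_list_sum_nth atLeast0LessThan min_def)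
  finally show ?thesis .
qed

lemma Fint_eq_PL:
  assumes "0 \<le> s" "s \<le> real (H p n k)"
  shows "Fint p g n k s = PL (gvals p g n k) s"
proof (cases "nat \<lfloor>s\<rfloor> \<ge> H p n k")
  case True
  then have "s \<ge> real (H p n k)" using assms by linarith
  then show ?thesis using True by (simp add: Fint_def Let_def Fdisc_eq PL_ge_length)
next
  case False
  define m where "m = nat \<lfloor>s\<rfloor>"
  have m: "m < H p n k" "real m \<le> s" "s < real m + 1" using False assms unfolding m_def by linarith+
  then have "Fint p g n k s = sum_list (take m (gvals p g n k)) + (s - real m) * gvals p g n k ! m"
    by (simp add: Fint_def Let_def m_def[symmetric] Fdisc_eq take_Suc_conv_app_nth)
  also have "\<dots> = PL (gvals p g n k) s" using m by (subst PL_eq_take) auto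
  finally show ?thesis .
qed

text \<open>The subtracted chord has the average value as its slope, so removing it amounts to
  centring every single value.\<close>

lemma bridge_eq_PL:
  assumes "0 \<le> t" "t \<le> 1" "H p n k > 0"
  shows "Fint p g n k (t * real (H p n k)) - t * Fint p g n k (real (H p n k))
    = PL (map (\<lambda>b. b - sum_list (gvals p g n k) / real (H p n k)) (gvals p g n k)) (t * real (H p n k))"
proof -
  have "t * real (H p n k) \<le> real (H p n k)" using assms by (simp add: mult_left_le_one_le)
  then show ?thesis using assms by (simp add: Fint_eq_PL PL_map_minus PL_ge_length)
qed

text \<open>From level \<open>N\<close> on, an appended edge does not affect \<open>g\<close>, so
  each last edge reproduces the list of its source unchanged.\<close>

lemma gvals_Suc:
  assumes "cylindric g N" "n \<ge> N"
  shows "gvals p g (Suc n) k = concat (map (\<lambda>e. gvals p g n (k - fst e)) (filter (\<lambda>e. fst e \<le> k) (labs p)))"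
proof -
  have cut: "g (\<lambda>l. if l < Suc n then (c @ [e]) ! l else (0, 0)) = g (\<lambda>l. if l < n then c ! l else (0, 0))"
    if "c \<in> set (paths p n k')" for c e k'
  proof -
    have "length c = n" using that unfolding set_paths by (simp add: fin_paths_def)
    then show ?thesis
      using assms(2) by (intro assms(1)[unfolded cylindric_def, rule_format]) (simp add: nth_append)
  qed
  have "map (\<lambda>c. g (\<lambda>l. if l < Suc n then c ! l else (0, 0))) (map (\<lambda>c. c @ [e]) (paths p n k'))
      = gvals p g n k'" for e k'
    unfolding gvals_def map_map comp_def by (rule map_cong[OF refl]) (rule cut)
  then show ?thesis
    unfolding gvals_def[of p g "Suc n"] paths.simps map_concat map_map[of _ _ "filter _ _"] comp_def by simp
qed

lemma gvals_add:
  assumes "cylindric g N" "n \<ge> N"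
  shows "\<exists>ls. gvals p g (n + m) k = concat (map (gvals p g n) ls) \<and> (\<forall>l\<in>set ls. l \<le> k \<and> k \<le> l + degree p * m)"
proof (induction m arbitrary: k)
  case 0
  then show ?case by (intro exI[of _ "[k]"]) simp
next
  case (Suc m)
  then obtain ls where ls: "\<And>k. gvals p g (n + m) k = concat (map (gvals p g n) (ls k))"
    "\<And>k l. l \<in> set (ls k) \<Longrightarrow> l \<le> k \<and> k \<le> l + degree p * m" by metis
  define es where "es = filter (\<lambda>e. fst e \<le> k) (labs p)"
  have "gvals p g (n + Suc m) k = concat (map (\<lambda>e. gvals p g (n + m) (k - fst e)) es)"
    using gvals_Suc[OF assms(1), of "n + m"] assms(2) by (simp add: es_def)
  also have "\<dots> = concat (map (gvals p g n) (concat (map (\<lambda>e. ls (k - fst e)) es)))"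
    unfolding ls(1) by (induction es) simp_all
  finally have 1: "gvals p g (n + Suc m) k = concat (map (gvals p g n) (concat (map (\<lambda>e. ls (k - fst e)) es)))" .
  have "l \<le> k \<and> k \<le> l + degree p * Suc m" if "l \<in> set (concat (map (\<lambda>e. ls (k - fst e)) es))" for l
  proof -
    from that obtain e where e: "e \<in> set es" "l \<in> set (ls (k - fst e))" by auto
    then have "fst e \<le> k" "fst e \<le> degree p"
      by (auto simp: es_def set_labs valid_label_def)
    then show ?thesis using ls(2)[OF e(2)] by auto
  qed
  then show ?case using 1 by blast
qed

lemma sum_gvals_Suc:
  assumes "cylindric g N" "n \<ge> N"
  shows "sum_list (gvals p g (Suc n) k) = (\<Sum>j\<le>k. real (coeff p j) * sum_list (gvals p g n (k - j)))"
  unfolding gvals_Suc[OF assms] sum_list_concat_map map_map comp_def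
  by (subst sum_list_filter_labs[where F = "\<lambda>j. sum_list (gvals p g n (k - j))"]) simp

section \<open>Tilting the polynomial\<close>

locale poly_adic =
  fixes p :: "nat poly" and q :: real
  assumes deg: "degree p \<ge> 1"
    and cpos: "\<And>i. i \<le> degree p \<Longrightarrow> coeff p i > 0"
    and q0: "0 < q" and q1: "q < 1 / real (coeff p 0)"
begin

text \<open>\<open>tq\<close> is given by a definite description, so existence and uniqueness come
  first. The left side is below the target at 0 because q < 1/a_0, above it at 1 because a_1 \<ge>
  1, and strictly increasing for t > 0.\<close>

lemma tq_props:
  "0 < tq p q" "(\<Sum>j\<le>degree p. real (coeff p j) * q ^ (degree p - j) * tq p q ^ j) = q ^ (degree p - 1)"
proof -
  define F where "F t = (\<Sum>j\<le>degree p. real (coeff p j) * q ^ (degree p - j) * t ^ j)" for t :: real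
  have qd: "q ^ degree p = q * q ^ (degree p - 1)" using deg by (cases "degree p") auto
  have "F 0 = real (coeff p 0) * q ^ degree p"
    by (simp add: F_def power_0_left if_distrib[where f = "\<lambda>x. _ * x"] cong: if_cong)
  also have "\<dots> = (real (coeff p 0) * q) * q ^ (degree p - 1)" unfolding qd by simp
  also have "\<dots> < 1 * q ^ (degree p - 1)"
    using q0 q1 cpos[of 0] by (intro mult_strict_right_mono) (auto simp: field_simps)
  finally have F0: "F 0 < q ^ (degree p - 1)" by simp
  have F1: "F 1 > q ^ (degree p - 1)"
  proof -
    have "real (coeff p 0) * q ^ degree p + real (coeff p 1) * q ^ (degree p - 1)
      = (\<Sum>j\<in>{0, 1}. real (coeff p j) * q ^ (degree p - j) * 1 ^ j)" by simp
    also have "\<dots> \<le> F 1" unfolding F_def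
      using deg q0 by (intro sum_mono2) auto
    finally have "real (coeff p 0) * q ^ degree p + real (coeff p 1) * q ^ (degree p - 1) \<le> F 1" .
    moreover have "real (coeff p 0) * q ^ degree p > 0" using cpos[of 0] q0 by simp
    moreover have "real (coeff p 1) * q ^ (degree p - 1) \<ge> 1 * q ^ (degree p - 1)"
      using cpos[of 1] deg q0 by (intro mult_right_mono) auto
    ultimately show ?thesis by linarith
  qed
  have "continuous_on {0..1} F" unfolding F_def by (intro continuous_intros)
  then obtain t where t: "0 \<le> t" "t \<le> 1" "F t = q ^ (degree p - 1)"
    using IVT'[of F 0 "q ^ (degree p - 1)" 1] F0 F1 by auto
  have t': "0 < t" "t < 1" using t F0 F1 by (metis less_eq_real_def less_irrefl)+
  have mono: "F a < F b" if "0 < a" "a < b" for a b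
    unfolding F_def
  proof (rule sum_strict_mono_ex1)
    show "\<forall>j\<in>{..degree p}. real (coeff p j) * q ^ (degree p - j) * a ^ j \<le> real (coeff p j) * q ^ (degree p - j) * b ^ j"
      using that q0 by (auto intro!: mult_left_mono power_mono)
    show "\<exists>j\<in>{..degree p}. real (coeff p j) * q ^ (degree p - j) * a ^ j < real (coeff p j) * q ^ (degree p - j) * b ^ j"
      using that q0 cpos[of 1] deg by (intro bexI[of _ 1]) auto
  qed simp
  have ex1: "\<exists>!t. 0 < t \<and> t < 1 \<and> F t = q ^ (degree p - 1)"
  proof (rule ex1I[of _ t])
    fix t' assume "0 < t' \<and> t' < 1 \<and> F t' = q ^ (degree p - 1)"
    then show "t' = t" using t t' mono[of t t'] mono[of t' t] by (metis less_irrefl linorder_neqE_linordered_idom)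
  qed (use t t' in auto)
  have "0 < tq p q \<and> tq p q < 1 \<and> F (tq p q) = q ^ (degree p - 1)"
    using theI'[OF ex1] unfolding tq_def F_def .
  then show "0 < tq p q" "(\<Sum>j\<le>degree p. real (coeff p j) * q ^ (degree p - j) * tq p q ^ j) = q ^ (degree p - 1)"
    by (simp_all add: F_def)
qed

text \<open>An edge of type j has probability q w^j, so a cylinder ending at \<open>(n, k)\<close>
  has measure q^n w^k.\<close>

definition w :: real where "w = tq p q / q"

definition rp :: "real poly" where "rp = map_poly real p"

text \<open>The generating polynomial of the type of a random edge under
  \<open>mu p q\<close>.\<close>

definition f :: "real poly" where "f = smult q (rp \<circ>\<^sub>p [:0, w:])"

lemma w_pos: "w > 0" using tq_props q0 by (simp add: w_def)

lemma coeff_f: "coeff f j = q * w ^ j * real (coeff p j)"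
  by (simp add: f_def rp_def coeff_pcompose_linear coeff_map_poly)

lemma degree_f: "degree f = degree p"
proof (rule antisym)
  show "degree f \<le> degree p" by (rule degree_le) (simp add: coeff_f coeff_eq_0)
  show "degree p \<le> degree f" by (rule le_degree) (use q0 w_pos deg in \<open>auto simp: coeff_f\<close>)
qed

lemma sum_f: "(\<Sum>j\<le>degree p. q * w ^ j * real (coeff p j)) = 1"
proof -
  have "q ^ degree p * (\<Sum>j\<le>degree p. w ^ j * real (coeff p j))
    = (\<Sum>j\<le>degree p. real (coeff p j) * q ^ (degree p - j) * tq p q ^ j)"
    unfolding sum_distrib_left
  proof (rule sum.cong)
    fix j assume "j \<in> {..degree p}"
    then have "q ^ degree p = q ^ (degree p - j) * q ^ j" by (simp add: power_add[symmetric])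
    then show "q ^ degree p * (w ^ j * real (coeff p j)) = real (coeff p j) * q ^ (degree p - j) * tq p q ^ j"
      using q0 by (simp add: w_def power_divide)
  qed simp
  also have "\<dots> = q ^ (degree p - 1)" by (rule tq_props)
  finally have "q ^ (degree p - 1) * (q * (\<Sum>j\<le>degree p. w ^ j * real (coeff p j))) = q ^ (degree p - 1) * 1"
    using deg by (cases "degree p") (auto simp: mult_ac)
  then have "q * (\<Sum>j\<le>degree p. w ^ j * real (coeff p j)) = 1" using q0 by simp
  then show ?thesis by (simp add: sum_distrib_left mult.assoc)
qed

sublocale lattice_dist f
proof
  show "coeff f i \<ge> 0" for i using q0 w_pos by (simp add: coeff_f)
  show "coeff f 0 > 0" using q0 cpos[of 0] by (simp add: coeff_f)
  show "coeff f 1 > 0" using q0 w_pos cpos[of 1] deg by (simp add: coeff_f)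
  show "poly f 1 = 1" using sum_f by (simp add: poly_altdef degree_f coeff_f)
qed

text \<open>The largest probability of an edge: q w^j is monotone in j, so it is attained at type 0
  or at type \<open>degree p\<close>.\<close>

definition \<theta> :: real where "\<theta> = max q (q * w ^ degree p)"

lemma \<theta>: "0 < \<theta>" "\<theta> < 1"
proof -
  show "0 < \<theta>" using q0 by (simp add: \<theta>_def)
  have "q * 1 \<le> q * real (coeff p 0)" using cpos[of 0] q0 by (intro mult_left_mono) auto
  also have "\<dots> < 1" using q1 cpos[of 0] by (simp add: field_simps)
  finally have "q < 1" by simp
  moreover have "q * w ^ degree p < 1"
  proof -
    have "coeff f 0 + coeff f (degree p) = (\<Sum>j\<in>{0, degree p}. coeff f j)" using deg by simp
    also have "\<dots> \<le> (\<Sum>j\<le>degree p. coeff f j)" using nonneg by (intro sum_mono2) auto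
    also have "\<dots> = 1" using sum_coeff by (simp add: degree_f)
    finally have "coeff f (degree p) < 1" using pos0 by linarith
    moreover have "q * w ^ degree p * 1 \<le> coeff f (degree p)"
      unfolding coeff_f using cpos[of "degree p"] q0 w_pos by (intro mult_left_mono) auto
    ultimately show ?thesis by linarith
  qed
  ultimately show "\<theta> < 1" by (simp add: \<theta>_def)
qed

lemma weight_le:
  assumes "j \<le> degree p * m" shows "q ^ m * w ^ j \<le> \<theta> ^ m"
proof (cases "w \<le> 1")
  case True
  have "q ^ m * w ^ j \<le> q ^ m * 1" using True w_pos q0 by (intro mult_left_mono power_le_one) auto
  also have "\<dots> \<le> \<theta> ^ m" using q0 by (simp add: \<theta>_def power_mono)
  finally show ?thesis .
next
  case False
  have "q ^ m * w ^ j \<le> q ^ m * w ^ (degree p * m)" using False q0 assms by (intro mult_left_mono power_increasing) auto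
  also have "\<dots> = (q * w ^ degree p) ^ m" by (simp add: power_mult_distrib power_mult)
  also have "\<dots> \<le> \<theta> ^ m" using q0 w_pos by (intro power_mono) (auto simp: \<theta>_def)
  finally show ?thesis .
qed

lemma pcompose_power: "(A ^ m) \<circ>\<^sub>p [:0, w:] = (A \<circ>\<^sub>p [:0, w:]) ^ m"
  by (induction m) (simp_all add: pcompose_mult pcompose_1)

text \<open>Substituting w x weights the k-th coefficient by w^k; with the powers of q this turns
  counts over \<open>(n, k)\<close> into measures.\<close>

lemma coeff_tilt: "coeff ((A \<circ>\<^sub>p [:0, w:]) * f ^ m) k = q ^ m * w ^ k * coeff (A * rp ^ m) k"
proof -
  have "(A \<circ>\<^sub>p [:0, w:]) * f ^ m = smult (q ^ m) ((A * rp ^ m) \<circ>\<^sub>p [:0, w:])"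
    by (simp add: f_def smult_power pcompose_mult pcompose_power)
  then show ?thesis by (simp add: coeff_pcompose_linear)
qed

lemma coeff_rp_power: "coeff (rp ^ n) k = real (H p n k)"
proof -
  have "map_poly real (A * B) = map_poly real A * map_poly real B" for A B :: "nat poly"
    by (rule poly_eqI) (simp add: coeff_map_poly coeff_mult)
  then have "rp ^ n = map_poly real (p ^ n)"
    by (induction n) (simp_all add: rp_def)
  then show ?thesis by (simp add: coeff_map_poly H_def)
qed

lemma cf_1: "cf 1 0 n k = q ^ n * w ^ k * real (H p n k)"
  using coeff_tilt[of 1 n k] by (simp add: cf_def coeff_rp_power pcompose_1)

lemma H_eq_0: "k > degree p * n \<Longrightarrow> H p n k = 0"
  unfolding H_def using degree_power_le[of p n] by (intro coeff_eq_0) (simp add: mult.commute)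

end

section \<open>Totals of \<open>g\<close> over towers as coefficients of polynomials\<close>

locale adic_fun = poly_adic +
  fixes g :: "path \<Rightarrow> real" and N :: nat
  assumes cyl: "cylindric g N"
begin

definition h :: "nat \<Rightarrow> nat \<Rightarrow> real" where "h n k = sum_list (gvals p g n k)"

definition G :: "real poly" where "G = (\<Sum>k\<le>degree p * N. monom (h N k) k)"

lemma gvals_empty: "k > degree p * n \<Longrightarrow> gvals p g n k = []"
  by (metis H_eq_0 length_0_conv length_gvals)

lemma coeff_G: "coeff G k = h N k"
proof -
  have "coeff G k = (if k \<le> degree p * N then h N k else 0)"
    by (simp add: G_def coeff_sum)
  then show ?thesis using gvals_empty[of N k] by (auto simp: h_def)
qed

text \<open>The splitting of towers by last edges is a convolution with the coefficients of
  \<open>p\<close>.\<close>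

lemma h_eq: "h (N + m) k = coeff (G * rp ^ m) k"
proof (induction m arbitrary: k)
  case 0
  then show ?case by (simp add: coeff_G)
next
  case (Suc m)
  have "h (N + Suc m) k = (\<Sum>j\<le>k. real (coeff p j) * h (N + m) (k - j))"
    using sum_gvals_Suc[OF cyl, of "N + m" p k] by (simp add: h_def)
  also have "\<dots> = coeff (rp * (G * rp ^ m)) k"
    by (simp add: coeff_mult Suc.IH rp_def coeff_map_poly)
  finally show ?case by (simp add: mult_ac)
qed

text \<open>At \<open>(N, k)\<close> the coefficient is the total of g - c over the tower,
  multiplied by the measure of one of its cylinders.\<close>

definition tilted :: "real \<Rightarrow> real poly" where
  "tilted c = smult (q ^ N) ((G - smult c (rp ^ N)) \<circ>\<^sub>p [:0, w:])"

lemma cf_tilted: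
  assumes "n \<ge> N"
  shows "cf (tilted c) N n k = q ^ n * w ^ k * (h n k - c * real (H p n k))"
proof -
  obtain m where m: "n = N + m" using assms le_Suc_ex by blast
  have "cf (tilted c) N n k = q ^ N * (q ^ m * w ^ k * coeff ((G - smult c (rp ^ N)) * rp ^ m) k)"
    unfolding cf_def tilted_def m by (simp add: coeff_tilt)
  also have "coeff ((G - smult c (rp ^ N)) * rp ^ m) k = h n k - c * real (H p n k)"
    unfolding m h_eq by (simp add: left_diff_distrib coeff_rp_power flip: power_add)
  finally show ?thesis by (simp add: m power_add mult_ac)
qed

text \<open>No new values appear above level \<open>N\<close>, and level \<open>N\<close> has
  finitely many.\<close>

lemma gvals_bounded: "\<exists>B\<ge>0. \<forall>n\<ge>N. \<forall>k. \<forall>b\<in>set (gvals p g n k). \<bar>b\<bar> \<le> B"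
proof -
  define A where "A = (\<Union>l\<in>{..degree p * N}. set (gvals p g N l))"
  have A: "set (gvals p g N l) \<subseteq> A" for l
    using gvals_empty[of N l] by (cases "l \<le> degree p * N") (auto simp: A_def)
  define B where "B = (\<Sum>a\<in>A. \<bar>a\<bar>)"
  have fin: "finite A" by (simp add: A_def)
  have "\<bar>b\<bar> \<le> B" if "n \<ge> N" "b \<in> set (gvals p g n k)" for n k b
  proof -
    obtain m where m: "n = N + m" using \<open>n \<ge> N\<close> le_Suc_ex by blast
    obtain ls where "gvals p g (N + m) k = concat (map (gvals p g N) ls)"
      using gvals_add[OF cyl order_refl] by blast
    then have "b \<in> A" using that m A by auto
    then show ?thesis unfolding B_def using fin by (intro member_le_sum) auto
  qed
  moreover have "B \<ge> 0" by (simp add: B_def sum_nonneg)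
  ultimately show ?thesis by blast
qed

end

section \<open>Compactness of the normalised polygons\<close>

lemma summable_power_geometric:
  fixes x :: real assumes "0 < x" "x < 1"
  shows "summable (\<lambda>i. x ^ i * real i ^ K)"
proof -
  define y where "y = (1 + x) / 2"
  have y: "y < 1" "x < y" "0 < y" using assms by (auto simp: y_def)
  have "(\<lambda>i. x * (1 + 1 / real i) ^ K) \<longlonglongrightarrow> x * (1 + 0) ^ K"
    by (intro tendsto_intros lim_1_over_n)
  then have "\<forall>\<^sub>F i in sequentially. x * (1 + 1 / real i) ^ K < y"
    using y by (intro order_tendstoD) auto
  then obtain i0 where i0: "\<And>i. i \<ge> i0 \<Longrightarrow> x * (1 + 1 / real i) ^ K < y"
    unfolding eventually_sequentially by blast
  show ?thesis
  proof (rule summable_ratio_test[OF y(1), of "Suc i0"])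
    fix i assume i: "i \<ge> Suc i0"
    then have "real (Suc i) = real i * (1 + 1 / real i)" by (simp add: field_simps)
    then have "x ^ Suc i * real (Suc i) ^ K = (x * (1 + 1 / real i) ^ K) * (x ^ i * real i ^ K)"
      by (simp add: power_mult_distrib)
    also have "\<dots> \<le> y * (x ^ i * real i ^ K)"
      using i0[of i] i assms by (intro mult_right_mono) auto
    finally show "norm (x ^ Suc i * real (Suc i) ^ K) \<le> y * norm (x ^ i * real i ^ K)"
      using assms by simp
  qed
qed

lemma abs_PL_le: "\<bar>PL bs x\<bar> \<le> (\<Sum>b\<leftarrow>bs. \<bar>b\<bar>)"
proof (induction bs arbitrary: x)
  case (Cons b bs)
  have "\<bar>b * max 0 (min 1 x)\<bar> \<le> \<bar>b\<bar> * 1" unfolding abs_mult by (intro mult_left_mono) auto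
  then show ?case using Cons.IH[of "x - 1"] by simp
qed simp

locale adic_curve = adic_fun +
  fixes c :: real and s :: nat and E :: "real poly"
  assumes tilt: "tilted c = [:-1, 1:] ^ s * E" and s1: "s \<ge> 1" and E1: "poly E 1 \<noteq> 0"
begin

definition lam :: "nat \<Rightarrow> nat \<Rightarrow> real" where "lam n k = h n k / real (H p n k)"

definition wl :: "real \<Rightarrow> nat \<Rightarrow> nat \<Rightarrow> real list" where
  "wl l n k = map (\<lambda>b. b - l) (gvals p g n k)"

definition \<rho> :: "nat \<Rightarrow> nat \<Rightarrow> real" where
  "\<rho> n k = 1 / (sqrt (real n) ^ (s + 2) * (q ^ n * w ^ k))"

definition tail_sum :: "nat \<Rightarrow> real" where
  "tail_sum m = (\<Sum>i. \<theta> ^ (i + Suc m) * real (i + Suc m) ^ (s + 2))"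

lemma sum_wl: "sum_list (wl l n k) = h n k - l * real (H p n k)"
proof -
  have "sum_list (map (\<lambda>b. b - l) bs) = sum_list bs - l * real (length bs)" for bs
    by (induction bs) (simp_all add: algebra_simps)
  then show ?thesis by (simp add: wl_def h_def)
qed

lemma summable_tail_sum: "summable (\<lambda>i. \<theta> ^ (i + Suc m) * real (i + Suc m) ^ (s + 2))"
  using summable_power_geometric[OF \<theta>, of "s + 2"] by (subst summable_iff_shift)

lemma tail_sum_Suc: "tail_sum m = \<theta> ^ Suc m * real (Suc m) ^ (s + 2) + tail_sum (Suc m)"
  unfolding tail_sum_def using suminf_split_head[OF summable_tail_sum[of m]] by simp

lemma tail_sum_nonneg: "tail_sum m \<ge> 0"
  unfolding tail_sum_def using \<theta> by (intro suminf_nonneg summable_tail_sum) auto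

lemma tail_sum_tendsto: "tail_sum \<longlonglongrightarrow> 0"
proof -
  have "(\<lambda>m. \<Sum>i. \<theta> ^ (i + m) * real (i + m) ^ (s + 2)) \<longlonglongrightarrow> 0"
    using suminf_exist_split2[OF summable_power_geometric[OF \<theta>, of "s + 2"]] .
  then show ?thesis unfolding tail_sum_def by (rule LIMSEQ_Suc)
qed

text \<open>The constant \<open>c\<close> drops out, because replacing g by g - c also shifts the
  mean by \<open>c\<close>. The factor q^m w^j, the measure of a cylinder of m edges, supplies the
  geometric decay.\<close>

lemma sum_wl_eq:
  assumes "m + N \<le> n" "j \<le> k" "H p n k > 0"
  shows "sum_list (wl (lam n k) (n - m) (k - j))
    = q ^ m * w ^ j / (q ^ n * w ^ k) * (cf ([:-1, 1:] ^ s * E) N (n - m) (k - j)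
       - cf ([:-1, 1:] ^ s * E) N n k / cf 1 0 n k * cf 1 0 (n - m) (k - j))"
proof -
  have e: "q ^ n = q ^ (n - m) * q ^ m" "w ^ k = w ^ (k - j) * w ^ j"
    using assms by (simp_all flip: power_add)
  have r: "cf (tilted c) N n k / cf 1 0 n k = lam n k - c"
    using assms q0 w_pos by (simp add: cf_tilted cf_1 lam_def diff_divide_distrib)
  have "cf (tilted c) N (n - m) (k - j) - cf (tilted c) N n k / cf 1 0 n k * cf 1 0 (n - m) (k - j)
    = q ^ (n - m) * w ^ (k - j) * (h (n - m) (k - j) - lam n k * real (H p (n - m) (k - j)))"
    unfolding r using assms by (simp add: cf_tilted cf_1 algebra_simps)
  then show ?thesis unfolding tilt sum_wl e using q0 w_pos by simp
qed

lemma good_H_pos: "\<forall>\<^sub>F n in sequentially. \<forall>k. good s n k \<longrightarrow> H p n k > 0"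
  using good_cf_ge[OF le0[of "degree f * 0"], of s]
proof eventually_elim
  case (elim n)
  show ?case
  proof (intro allI impI)
    fix k assume "good s n k"
    then have "Psi 0 (real s + var + 1) / 2 \<le> sqrt (real n) * cf 1 0 n k"
      using elim by (simp add: monom_0 flip: one_pCons)
    then have "cf 1 0 n k \<noteq> 0" using Psi_0_pos[of "real s + var + 1"] by auto
    then show "H p n k > 0" by (auto simp: cf_1)
  qed
qed

text \<open>Descent through the levels: the polygon of a block is at most the sum of the moduli of
  the totals of its subblocks plus a common bound for their polygons. The totals at depth m + 1 are
  O(\<rho> \<theta>^(m+1) (m+1)^(s+2)), exactly the term by which \<open>tail_sum m\<close> exceeds
  \<open>tail_sum (Suc m)\<close>.\<close>

lemma block_estimate:
  "\<exists>K\<ge>0. \<forall>\<^sub>F n in sequentially. \<forall>k. good s n k \<longrightarrow>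
     (\<forall>m j x. m + N \<le> n \<longrightarrow> j \<le> k \<longrightarrow> j \<le> degree p * m \<longrightarrow>
       \<bar>PL (wl (lam n k) (n - m) (k - j)) x\<bar> \<le> K * \<rho> n k * tail_sum m)"
proof -
  obtain C where C: "C \<ge> 0" and ev: "\<forall>\<^sub>F n in sequentially. \<forall>k. good s n k \<longrightarrow>
     (\<forall>m j. 1 \<le> m \<longrightarrow> m \<le> n \<longrightarrow> j \<le> k \<longrightarrow> j \<le> degree p * m \<longrightarrow>
       sqrt (real n) ^ (s + 2) * \<bar>cf ([:-1, 1:] ^ s * E) N (n - m) (k - j)
          - cf ([:-1, 1:] ^ s * E) N n k / cf 1 0 n k * cf 1 0 (n - m) (k - j)\<bar> \<le> C * real m ^ (s + 2))"
    using cf_bridge_bound[of s E N] unfolding degree_f by blast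
  obtain B where B: "B \<ge> 0" "\<And>n k b. n \<ge> N \<Longrightarrow> b \<in> set (gvals p g n k) \<Longrightarrow> \<bar>b\<bar> \<le> B"
    using gvals_bounded by blast
  define HN where "HN = (\<Sum>l\<le>degree p * N. H p N l)"
  have HN: "H p N l \<le> HN" for l
  proof (cases "l \<le> degree p * N")
    case True then show ?thesis unfolding HN_def by (intro member_le_sum) auto
  qed (simp add: H_eq_0)
  define L0 where "L0 = real (length (labs p))"
  \<comment> \<open>The first summand pays for the totals of at most \<open>L0\<close> subblocks at
    every step, the second for whole blocks of level \<open>N\<close>, whose centred entries are at
    most 2B.\<close>
  define K where "K = L0 * C + real HN * (2 * B) / \<theta>"
  have K1: "L0 * C \<le> K" "real HN * (2 * B) \<le> K * \<theta>" and K0: "K \<ge> 0"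
    using B C \<theta> by (auto simp: K_def L0_def field_simps)
  show ?thesis
  proof (intro exI[of _ K] conjI K0)
    show "\<forall>\<^sub>F n in sequentially. \<forall>k. good s n k \<longrightarrow>
     (\<forall>m j x. m + N \<le> n \<longrightarrow> j \<le> k \<longrightarrow> j \<le> degree p * m \<longrightarrow>
       \<bar>PL (wl (lam n k) (n - m) (k - j)) x\<bar> \<le> K * \<rho> n k * tail_sum m)"
      using ev good_H_pos eventually_ge_at_top[of "2 * N + 4"]
    proof eventually_elim
      case (elim n)
      show ?case
      proof (intro allI impI)
        fix k m j x
        assume g: "good s n k" and "m + N \<le> n" "j \<le> k" "j \<le> degree p * m"
        have Hp: "H p n k > 0" using elim(2) g by blast
        then have kd: "k \<le> degree p * n" using H_eq_0[of n k] by (metis not_le less_irrefl)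
        define S where "S = sqrt (real n)"
        define D where "D = q ^ n * w ^ k"
        have D: "D > 0" using q0 w_pos by (simp add: D_def)
        have S: "S \<ge> 2" using elim(3) by (simp add: S_def real_le_rsqrt)
        have \<rho>: "\<rho> n k = 1 / (S ^ (s + 2) * D)" by (simp add: \<rho>_def S_def D_def)
        have \<rho>0: "\<rho> n k > 0" unfolding \<rho> using S D by simp
        have tot: "\<bar>sum_list (wl (lam n k) (n - m) (k - j))\<bar> \<le> C * \<rho> n k * (\<theta> ^ m * real m ^ (s + 2))"
          if "1 \<le> m" "m + N \<le> n" "j \<le> k" "j \<le> degree p * m" for m j
        proof -
          define X where "X = \<bar>cf ([:-1, 1:] ^ s * E) N (n - m) (k - j)
            - cf ([:-1, 1:] ^ s * E) N n k / cf 1 0 n k * cf 1 0 (n - m) (k - j)\<bar>"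
          have X: "S ^ (s + 2) * X \<le> C * real m ^ (s + 2)"
            using elim(1)[rule_format, OF g, of m j] that by (simp add: X_def S_def)
          have "\<bar>sum_list (wl (lam n k) (n - m) (k - j))\<bar> = (q ^ m * w ^ j) * (X / D)"
            unfolding sum_wl_eq[OF that(2,3) Hp] X_def D_def using q0 w_pos by (simp add: abs_mult)
          also have "\<dots> \<le> \<theta> ^ m * (X / D)"
            using weight_le[OF that(4)] D by (intro mult_right_mono) (auto simp: X_def)
          also have "X / D = (S ^ (s + 2) * X) * \<rho> n k" unfolding \<rho> using S by simp
          also have "\<theta> ^ m * ((S ^ (s + 2) * X) * \<rho> n k) \<le> \<theta> ^ m * ((C * real m ^ (s + 2)) * \<rho> n k)"
            using X \<rho>0 \<theta> by (intro mult_left_mono mult_right_mono) auto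
          finally show ?thesis by (simp add: mult_ac)
        qed
        have lam_le: "\<bar>lam n k\<bar> \<le> B"
        proof -
          have "\<bar>sum_list bs\<bar> \<le> real (length bs) * B" if "\<And>b. b \<in> set bs \<Longrightarrow> \<bar>b\<bar> \<le> B" for bs
            using that by (induction bs) (auto simp: algebra_simps intro: order_trans[OF abs_triangle_ineq] add_mono)
          then have "\<bar>h n k\<bar> \<le> real (H p n k) * B"
            using B(2)[of n _ k] elim(3) unfolding h_def by (metis length_gvals add_leD1 le_add1 mult_2 order_trans)
          then show ?thesis using Hp by (simp add: lam_def abs_divide field_simps)
        qed
        have base: "\<bar>PL (wl (lam n k) N l) x\<bar> \<le> K * \<theta>" for l x
        proof -
          have "\<bar>PL (wl (lam n k) N l) x\<bar> \<le> (\<Sum>b\<leftarrow>wl (lam n k) N l. \<bar>b\<bar>)" by (rule abs_PL_le)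
          also have "\<dots> = (\<Sum>b\<leftarrow>gvals p g N l. \<bar>b - lam n k\<bar>)" by (simp add: wl_def comp_def)
          also have "\<dots> \<le> (\<Sum>b\<leftarrow>gvals p g N l. 2 * B)"
          proof (rule sum_list_mono)
            fix b assume "b \<in> set (gvals p g N l)"
            then have "\<bar>b\<bar> \<le> B" using B(2) by blast
            then show "\<bar>b - lam n k\<bar> \<le> 2 * B" using lam_le by linarith
          qed
          also have "\<dots> = real (H p N l) * (2 * B)" by (simp add: sum_list_triv)
          also have "\<dots> \<le> real HN * (2 * B)" using HN B by (intro mult_right_mono) auto
          finally show ?thesis using K1 by linarith
        qed
        \<comment> \<open>The base blocks have size O(1), so the budget left at depth n - N must not
          tend to 0. Its first term suffices: q^n w^k \<le> \<theta>^n and sqrt n \<le> n - N +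
          1.\<close>
        have top: "\<theta> \<le> \<rho> n k * tail_sum (n - N)"
        proof -
          have "S * 2 \<le> S * S" using S by (intro mult_left_mono) auto
          then have "2 * S \<le> real n" by (simp add: S_def)
          then have Sn: "S \<le> real (Suc (n - N))" using elim(3) by (simp add: of_nat_diff)
          have "D \<le> \<theta> ^ n" unfolding D_def by (rule weight_le[OF kd])
          then have "\<theta> * (S ^ (s + 2) * D) \<le> \<theta> * (real (Suc (n - N)) ^ (s + 2) * \<theta> ^ n)"
            using Sn S D \<theta> by (intro mult_left_mono mult_mono power_mono) auto
          also have "\<dots> = \<theta> ^ Suc n * real (Suc (n - N)) ^ (s + 2)" by simp
          also have "\<dots> \<le> \<theta> ^ Suc (n - N) * real (Suc (n - N)) ^ (s + 2)"
            using \<theta> by (intro mult_right_mono power_decreasing) auto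
          also have "\<dots> \<le> tail_sum (n - N)" using tail_sum_Suc[of "n - N"] tail_sum_nonneg[of "Suc (n - N)"] by linarith
          finally show ?thesis unfolding \<rho> using S D by (simp add: field_simps)
        qed
        \<comment> \<open>The induction runs over the number of levels between the block and level
          \<open>N\<close>, so depth m uses the bound at depth m + 1.\<close>
        have step: "\<bar>PL (wl (lam n k) (n - m) (k - j)) x\<bar> \<le> K * \<rho> n k * tail_sum m"
          if "n - N - m = i" "m + N \<le> n" "j \<le> k" "j \<le> degree p * m" for i m j x
          using that
        proof (induction i arbitrary: m j x)
          case 0
          then have "m = n - N" "n - m = N" by auto
          then have "\<bar>PL (wl (lam n k) (n - m) (k - j)) x\<bar> \<le> K * \<theta>" using base by simp
          also have "\<dots> \<le> K * (\<rho> n k * tail_sum m)" using top K0 \<open>m = n - N\<close> by (intro mult_left_mono) auto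
          finally show ?case by (simp add: mult.assoc)
        next
          case (Suc i)
          define n' where "n' = n - Suc m"
          have n': "n - m = Suc n'" "n' \<ge> N" using Suc.prems by (auto simp: n'_def)
          define es where "es = filter (\<lambda>e. fst e \<le> k - j) (labs p)"
          have es: "fst e \<le> k - j" "fst e \<le> degree p" if "e \<in> set es" for e
            using that by (auto simp: es_def set_labs valid_label_def)
          define Y where "Y = K * \<rho> n k * tail_sum (Suc m)"
          have Y0: "Y \<ge> 0" using K0 \<rho>0 tail_sum_nonneg by (simp add: Y_def)
          define bs where "bs = map (\<lambda>e. wl (lam n k) n' (k - j - fst e)) es"
          have eq: "wl (lam n k) (n - m) (k - j) = concat bs"
            unfolding n'(1) wl_def bs_def es_def gvals_Suc[OF cyl n'(2)] by (simp add: map_concat comp_def)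
          have IH: "\<bar>PL b y\<bar> \<le> Y" if "b \<in> set bs" for b y
          proof -
            from that obtain e where e: "e \<in> set es" "b = wl (lam n k) n' (k - j - fst e)" by (auto simp: bs_def)
            have "\<bar>PL (wl (lam n k) (n - Suc m) (k - (j + fst e))) y\<bar> \<le> Y"
              unfolding Y_def using Suc.prems es[OF e(1)] by (intro Suc.IH) auto
            then show ?thesis using e by (simp add: n'_def)
          qed
          have T: "(\<Sum>b\<leftarrow>bs. \<bar>sum_list b\<bar>) \<le> L0 * (C * \<rho> n k * (\<theta> ^ Suc m * real (Suc m) ^ (s + 2)))"
          proof -
            have "(\<Sum>b\<leftarrow>bs. \<bar>sum_list b\<bar>) \<le> (\<Sum>b\<leftarrow>bs. C * \<rho> n k * (\<theta> ^ Suc m * real (Suc m) ^ (s + 2)))"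
            proof (rule sum_list_mono)
              fix b assume "b \<in> set bs"
              then obtain e where e: "e \<in> set es" "b = wl (lam n k) n' (k - j - fst e)" by (auto simp: bs_def)
              have "\<bar>sum_list (wl (lam n k) (n - Suc m) (k - (j + fst e)))\<bar> \<le> C * \<rho> n k * (\<theta> ^ Suc m * real (Suc m) ^ (s + 2))"
                using Suc.prems es[OF e(1)] by (intro tot) auto
              then show "\<bar>sum_list b\<bar> \<le> C * \<rho> n k * (\<theta> ^ Suc m * real (Suc m) ^ (s + 2))"
                using e by (simp add: n'_def)
            qed
            also have "\<dots> = real (length es) * (C * \<rho> n k * (\<theta> ^ Suc m * real (Suc m) ^ (s + 2)))"
              by (simp add: sum_list_triv bs_def del: power_Suc)
            also have "\<dots> \<le> L0 * (C * \<rho> n k * (\<theta> ^ Suc m * real (Suc m) ^ (s + 2)))"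
              using C \<rho>0 \<theta> by (intro mult_right_mono) (auto simp: L0_def es_def)
            finally show ?thesis .
          qed
          have "\<bar>PL (concat bs) x\<bar> \<le> (\<Sum>b\<leftarrow>bs. \<bar>sum_list b\<bar>) + Y"
            using IH Y0 by (rule abs_PL_concat_le)
          also have "\<dots> \<le> (L0 * C) * (\<rho> n k * (\<theta> ^ Suc m * real (Suc m) ^ (s + 2))) + Y"
            using T by (simp only: mult.assoc)
          also have "\<dots> \<le> K * (\<rho> n k * (\<theta> ^ Suc m * real (Suc m) ^ (s + 2))) + Y"
            using K1 \<rho>0 \<theta> by (intro add_right_mono mult_right_mono) auto
          also have "\<dots> = K * \<rho> n k * tail_sum m"
            unfolding Y_def by (subst tail_sum_Suc) (simp only: ring_distribs mult.assoc)
          finally show ?case unfolding eq .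
        qed
        show "\<bar>PL (wl (lam n k) (n - m) (k - j)) x\<bar> \<le> K * \<rho> n k * tail_sum m"
          by (rule step[OF refl]) fact+
      qed
    qed
  qed
qed

lemma bridge_eq:
  assumes "0 \<le> t" "t \<le> 1" "H p n k > 0"
  shows "Fint p g n k (t * real (H p n k)) - t * Fint p g n k (real (H p n k)) = PL (wl (lam n k) n k) (t * real (H p n k))"
  unfolding bridge_eq_PL[OF assms] wl_def lam_def h_def ..

lemma bdd_bridge:
  assumes "H p n k > 0"
  shows "bdd_above ((\<lambda>t. \<bar>Fint p g n k (t * real (H p n k)) - t * Fint p g n k (real (H p n k))\<bar>) ` {0..1})"
proof (rule bdd_aboveI2)
  fix t :: real assume "t \<in> {0..1}"
  then show "\<bar>Fint p g n k (t * real (H p n k)) - t * Fint p g n k (real (H p n k))\<bar> \<le> (\<Sum>b\<leftarrow>wl (lam n k) n k. \<bar>b\<bar>)"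
    using assms by (simp add: bridge_eq abs_PL_le)
qed

lemma Rg_ge:
  assumes "0 \<le> x" "x \<le> real (H p n k)" "H p n k > 0"
  shows "\<bar>PL (wl (lam n k) n k) x\<bar> \<le> Rg p g n k"
proof -
  define t where "t = x / real (H p n k)"
  have t: "t \<in> {0..1}" "t * real (H p n k) = x" using assms by (auto simp: t_def)
  have "\<bar>Fint p g n k (t * real (H p n k)) - t * Fint p g n k (real (H p n k))\<bar> \<le> Rg p g n k"
    unfolding Rg_def by (rule cSUP_upper[OF t(1) bdd_bridge[OF assms(3)]])
  then show ?thesis using t assms(3) bridge_eq[of t n k] by simp
qed

text \<open>The subtower over \<open>(n - 1, k)\<close>, reached by the edge \<open>(0, 0)\<close>,
  is a contiguous block. Its total is the increment of the polygon between the two ends, where the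
  polygon is at most R in modulus.\<close>

lemma Rg_ge_block:
  assumes "n \<ge> Suc N" "H p n k > 0"
  shows "\<bar>sum_list (wl (lam n k) (n - 1) k)\<bar> \<le> 2 * Rg p g n k"
proof -
  define n' where "n' = n - 1"
  have n': "n = Suc n'" "n' \<ge> N" using assms by (auto simp: n'_def)
  have "(0, 0) \<in> set (filter (\<lambda>e. fst e \<le> k) (labs p))"
    using cpos[of 0] by (simp add: set_labs valid_label_def)
  then obtain xs ys where "filter (\<lambda>e. fst e \<le> k) (labs p) = xs @ (0, 0) # ys"
    using split_list by metis
  then obtain as bs where ab: "wl (lam n k) n k = as @ wl (lam n k) n' k @ bs"
    unfolding wl_def n'(1) gvals_Suc[OF cyl n'(2)] by (auto simp: map_concat)
  have len: "length (wl (lam n k) n k) = H p n k" by (simp add: wl_def)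
  define W where "W = wl (lam n k) n' k"
  have l: "length as + length W \<le> H p n k" using len ab by (simp add: W_def)
  have 1: "\<bar>PL (wl (lam n k) n k) (real (length as))\<bar> \<le> Rg p g n k"
    using l assms by (intro Rg_ge) auto
  have 2: "\<bar>PL (wl (lam n k) n k) (real (length as) + real (length W))\<bar> \<le> Rg p g n k"
    using l assms by (intro Rg_ge) (auto simp flip: of_nat_add)
  have "PL (wl (lam n k) n k) (real (length as) + real (length W)) - PL (wl (lam n k) n k) (real (length as)) = sum_list W"
    unfolding ab W_def[symmetric] by (simp add: PL_append PL_ge_length PL_nonpos)
  then show ?thesis using 1 2 unfolding W_def n'_def by linarith
qed

text \<open>Divided by the height of the big tower, the determinant becomes the rescaled centred
  total of that block.\<close>

lemma Rg_lower: "\<exists>r>0. \<forall>\<^sub>F n in sequentially. \<forall>k. good s n k \<longrightarrow> r * \<rho> n k \<le> Rg p g n k"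
proof -
  let ?U = "cf ([:-1, 1:] ^ s * E) N" and ?P = "cf 1 0"
  obtain a where a: "a > 0" and ev: "\<forall>\<^sub>F n in sequentially. \<forall>k. good s n k \<longrightarrow>
    a \<le> sqrt (real n) ^ (s + 3) * \<bar>?U (n - 1) k * ?P n k - ?U n k * ?P (n - 1) k\<bar>"
    using cf_wronskian_ge[OF s1 E1, of N] by blast
  obtain b where b: "b \<ge> 0" "\<And>n k. sqrt (real n) * \<bar>?P n k\<bar> \<le> b"
    using cf_bound[of 0 1 0] by auto
  \<comment> \<open>\<open>q\<close> is the weight of one edge of type 0, \<open>a\<close> bounds
    the determinant from below, and \<open>b + 1\<close> bounds sqrt n times the rescaled height.
    The later halving accounts for the two ends of the block.\<close>
  define r0 where "r0 = q * (a / (b + 1))"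
  define r where "r = r0 / 2"
  show ?thesis
  proof (intro exI[of _ r] conjI)
    show "r > 0" using a b q0 by (simp add: r_def r0_def)
    show "\<forall>\<^sub>F n in sequentially. \<forall>k. good s n k \<longrightarrow> r * \<rho> n k \<le> Rg p g n k"
      using ev good_H_pos eventually_ge_at_top[of "Suc N"]
    proof eventually_elim
      case (elim n)
      show ?case
      proof (intro allI impI)
        fix k assume g: "good s n k"
        have Hp: "H p n k > 0" using elim(2) g by blast
        define S where "S = sqrt (real n)"
        define D where "D = q ^ n * w ^ k"
        have D: "D > 0" using q0 w_pos by (simp add: D_def)
        have S: "S > 0" using elim(3) by (simp add: S_def)
        have P: "?P n k > 0" using Hp q0 w_pos by (simp add: cf_1)
        define X where "X = \<bar>?U (n - 1) k - ?U n k / ?P n k * ?P (n - 1) k\<bar>"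
        have X: "\<bar>?U (n - 1) k * ?P n k - ?U n k * ?P (n - 1) k\<bar> = X * ?P n k"
        proof -
          have "?U (n - 1) k * ?P n k - ?U n k * ?P (n - 1) k = (?U (n - 1) k - ?U n k / ?P n k * ?P (n - 1) k) * ?P n k"
            using P by (simp add: field_simps)
          then show ?thesis unfolding X_def using P by (simp only: abs_mult abs_of_pos)
        qed
        have "a \<le> S ^ (s + 3) * (X * ?P n k)"
          using elim(1)[THEN spec, of k] g unfolding S_def X[symmetric] by blast
        also have "\<dots> = (S ^ (s + 2) * X) * (S * ?P n k)" by (simp add: eval_nat_numeral mult_ac)
        also have "\<dots> \<le> (S ^ (s + 2) * X) * (b + 1)"
          using b(2)[of n k] P S by (intro mult_left_mono) (auto simp: S_def X_def)
        finally have "a / (b + 1) \<le> S ^ (s + 2) * X" using b by (simp add: field_simps)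
        then have "q * (a / (b + 1)) \<le> q * (S ^ (s + 2) * X)" using q0 by (intro mult_left_mono) auto
        then have "2 * r \<le> q * (S ^ (s + 2) * X)" unfolding r_def r0_def[symmetric] by linarith
        then have "2 * r * \<rho> n k \<le> q * (S ^ (s + 2) * X) * \<rho> n k"
          using S D by (intro mult_right_mono) (auto simp: \<rho>_def S_def D_def)
        also have "\<dots> = \<bar>sum_list (wl (lam n k) (n - 1) (k - 0))\<bar>"
        proof -
          have "1 + N \<le> n" using elim(3) by simp
          from sum_wl_eq[OF this le0 Hp] have "\<bar>sum_list (wl (lam n k) (n - 1) (k - 0))\<bar> = q / D * X"
            using q0 w_pos by (simp add: X_def D_def abs_mult)
          then show ?thesis using S D by (simp add: \<rho>_def S_def D_def)
        qed
        also have "\<dots> \<le> 2 * Rg p g n k" using Rg_ge_block[OF elim(3) Hp] by simp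
        finally show "r * \<rho> n k \<le> Rg p g n k" by simp
      qed
    qed
  qed
qed

text \<open>On the window both heights have order q^(-n) w^(-k) / sqrt n, up to the factor q^m w^i,
  which takes finitely many values for fixed m.\<close>

lemma H_block_ge:
  "\<exists>\<delta>>0. \<forall>\<^sub>F n in sequentially. \<forall>k. good s n k \<longrightarrow>
     (\<forall>i\<le>degree p * m. i \<le> k \<longrightarrow> \<delta> * real (H p n k) \<le> real (H p (n - m) (k - i)))"
proof -
  define \<kappa> where "\<kappa> = Psi 0 (real s + var + 1) / 2"
  have \<kappa>: "\<kappa> > 0" using Psi_0_pos by (simp add: \<kappa>_def)
  obtain b where b: "b \<ge> 0" "\<And>n k. sqrt (real n) * \<bar>cf 1 0 n k\<bar> \<le> b"
    using cf_bound[of 0 1 0] by auto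
  \<comment> \<open>Makes w0^(degree p * m) a lower bound for all w^i with i \<le> degree p * m,
    whether w is below or above 1.\<close>
  define w0 where "w0 = min 1 w"
  have w0: "0 < w0" "w0 \<le> 1" "w0 \<le> w" using w_pos by (auto simp: w0_def)
  define \<delta> where "\<delta> = \<kappa> / (b + 1) * (q ^ m * w0 ^ (degree p * m))"
  have "\<forall>\<^sub>F n in sequentially. \<forall>i\<in>{..degree p * m}. \<forall>k. good s n k \<longrightarrow> \<kappa> \<le> sqrt (real n) * cf (monom 1 i) m n k"
    using good_cf_ge[where m = m and s = s] unfolding degree_f \<kappa>_def by (subst eventually_ball_finite_distrib) auto
  then have "\<forall>\<^sub>F n in sequentially. \<forall>k. good s n k \<longrightarrow>
     (\<forall>i\<le>degree p * m. i \<le> k \<longrightarrow> \<delta> * real (H p n k) \<le> real (H p (n - m) (k - i)))"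
    using eventually_ge_at_top[of "Suc m"]
  proof eventually_elim
    case (elim n)
    show ?case
    proof (intro allI impI)
      fix k i assume g: "good s n k" and i: "i \<le> degree p * m" "i \<le> k"
      define S where "S = sqrt (real n)"
      have S: "S > 0" using elim(2) by (simp add: S_def)
      define D where "D = q ^ (n - m) * w ^ (k - i)"
      have D: "D > 0" using q0 w_pos by (simp add: D_def)
      have "cf (monom 1 i) m n k = cf 1 0 (n - m) (k - i)"
        using i by (simp add: cf_def coeff_monom_mult)
      then have "\<kappa> \<le> S * (D * real (H p (n - m) (k - i)))"
        using elim(1)[THEN bspec, of i, THEN spec, of k] g i by (simp add: S_def D_def cf_1)
      moreover have "S * (q ^ n * w ^ k * real (H p n k)) \<le> b + 1"
        using b(2)[of n k] q0 w_pos unfolding cf_1 by (simp add: S_def)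
      ultimately have "\<kappa> * (S * (q ^ n * w ^ k * real (H p n k))) \<le> (S * (D * real (H p (n - m) (k - i)))) * (b + 1)"
        using \<kappa> S q0 w_pos D by (intro mult_mono) auto
      also have "q ^ n * w ^ k = D * (q ^ m * w ^ i)"
      proof -
        have "q ^ n = q ^ (n - m) * q ^ m" "w ^ k = w ^ (k - i) * w ^ i"
          using i elim(2) by (simp_all flip: power_add)
        then show ?thesis by (simp add: D_def)
      qed
      finally have "(S * D) * (\<kappa> * (q ^ m * w ^ i) * real (H p n k)) \<le> (S * D) * (real (H p (n - m) (k - i)) * (b + 1))"
        by (simp add: mult_ac)
      then have "\<kappa> * (q ^ m * w ^ i) * real (H p n k) \<le> real (H p (n - m) (k - i)) * (b + 1)"
        using S D by (simp add: mult_le_cancel_left_pos)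
      then have *: "\<kappa> / (b + 1) * (q ^ m * w ^ i) * real (H p n k) \<le> real (H p (n - m) (k - i))"
        using b by (simp add: field_simps)
      have "w0 ^ (degree p * m) \<le> w0 ^ i" using w0 i by (intro power_decreasing) auto
      also have "\<dots> \<le> w ^ i" using w0 by (intro power_mono) auto
      finally have "\<delta> \<le> \<kappa> / (b + 1) * (q ^ m * w ^ i)"
        unfolding \<delta>_def using \<kappa> b q0 by (intro mult_left_mono) auto
      then have "\<delta> * real (H p n k) \<le> \<kappa> / (b + 1) * (q ^ m * w ^ i) * real (H p n k)"
        by (intro mult_right_mono) auto
      then show "\<delta> * real (H p n k) \<le> real (H p (n - m) (k - i))" using * by linarith
    qed
  qed
  moreover have "\<delta> > 0" using \<kappa> b q0 w0 by (simp add: \<delta>_def)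
  ultimately show ?thesis by blast
qed

text \<open>The depth m is chosen first, to make the tail small against \<epsilon>; \<delta> is then
  a lower bound for the relative length of the blocks at depth m. The factor \<rho> cancels between
  the block bound and the lower bound for R.\<close>

lemma phi_modulus:
  assumes "\<epsilon> > 0"
  shows "\<exists>\<delta>>0. \<forall>\<^sub>F n in sequentially. \<forall>k. good s n k \<longrightarrow>
    (\<forall>x\<in>{0..1}. \<forall>y\<in>{0..1}. \<bar>x - y\<bar> \<le> \<delta> \<longrightarrow> \<bar>phi p g n k x - phi p g n k y\<bar> < \<epsilon>)"
proof -
  obtain K where K: "K \<ge> 0" and ev1: "\<forall>\<^sub>F n in sequentially. \<forall>k. good s n k \<longrightarrow>
     (\<forall>m j x. m + N \<le> n \<longrightarrow> j \<le> k \<longrightarrow> j \<le> degree p * m \<longrightarrow>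
       \<bar>PL (wl (lam n k) (n - m) (k - j)) x\<bar> \<le> K * \<rho> n k * tail_sum m)"
    using block_estimate by blast
  obtain r where r: "r > 0" and ev2: "\<forall>\<^sub>F n in sequentially. \<forall>k. good s n k \<longrightarrow> r * \<rho> n k \<le> Rg p g n k"
    using Rg_lower by blast
  have "(\<lambda>m. 3 * K / r * tail_sum m) \<longlonglongrightarrow> 3 * K / r * 0" by (intro tendsto_intros tail_sum_tendsto)
  then have "\<forall>\<^sub>F m in sequentially. 3 * K / r * tail_sum m < \<epsilon>" using assms by (intro order_tendstoD) auto
  then obtain m where m: "3 * K / r * tail_sum m < \<epsilon>" unfolding eventually_sequentially by blast
  obtain \<delta> where \<delta>: "\<delta> > 0" and ev3: "\<forall>\<^sub>F n in sequentially. \<forall>k. good s n k \<longrightarrow>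
     (\<forall>i\<le>degree p * m. i \<le> k \<longrightarrow> \<delta> * real (H p n k) \<le> real (H p (n - m) (k - i)))"
    using H_block_ge by blast
  have "\<forall>\<^sub>F n in sequentially. \<forall>k. good s n k \<longrightarrow>
    (\<forall>x\<in>{0..1}. \<forall>y\<in>{0..1}. \<bar>x - y\<bar> \<le> \<delta> \<longrightarrow> \<bar>phi p g n k x - phi p g n k y\<bar> < \<epsilon>)"
    using ev1 ev2 ev3 good_H_pos eventually_ge_at_top[of "m + N + 1"]
  proof eventually_elim
    case (elim n)
    show ?case
    proof (intro allI impI)
      fix k assume g: "good s n k"
      have Hp: "H p n k > 0" using elim(4) g by blast
      have \<rho>0: "\<rho> n k > 0" using q0 w_pos elim(5) by (simp add: \<rho>_def)
      have R: "r * \<rho> n k \<le> Rg p g n k" using elim(2) g by blast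
      have R0: "Rg p g n k > 0" using R r \<rho>0 by (smt (verit) mult_pos_pos)
      define Y where "Y = K * \<rho> n k * tail_sum m"
      have Y0: "Y \<ge> 0" using K \<rho>0 tail_sum_nonneg by (simp add: Y_def)
      obtain ls where ls: "gvals p g (n - m + m) k = concat (map (gvals p g (n - m)) ls)"
        "\<And>l. l \<in> set ls \<Longrightarrow> l \<le> k \<and> k \<le> l + degree p * m"
        using gvals_add[OF cyl, of "n - m" p m k] elim(5)
        by (metis add_le_imp_le_diff add.commute add_leD1)
      define bs where "bs = map (wl (lam n k) (n - m)) ls"
      have eq: "wl (lam n k) n k = concat bs"
        using ls(1) elim(5) by (simp add: wl_def[abs_def] bs_def map_concat comp_def)
      have b: "\<bar>PL b x\<bar> \<le> Y" "\<delta> * real (H p n k) \<le> real (length b)" if "b \<in> set bs" for b x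
      proof -
        from that obtain l where l: "l \<in> set ls" "b = wl (lam n k) (n - m) l" by (auto simp: bs_def)
        define j where "j = k - l"
        have j: "l = k - j" "j \<le> k" "j \<le> degree p * m" using ls(2)[OF l(1)] by (auto simp: j_def)
        show "\<bar>PL b x\<bar> \<le> Y" unfolding Y_def l(2) j(1) using elim(1)[rule_format, OF g, of m j x] j elim(5) by simp
        show "\<delta> * real (H p n k) \<le> real (length b)"
          using elim(3) g j unfolding l(2) j(1) by (simp add: wl_def)
      qed
      have win: "\<bar>phi p g n k y - phi p g n k x\<bar> < \<epsilon>" if xy: "0 \<le> x" "x \<le> y" "y \<le> 1" "y - x \<le> \<delta>" for x y
      proof -
        have "y * real (H p n k) \<le> x * real (H p n k) + \<delta> * real (H p n k)"
          using xy(4) mult_right_mono[of y "x + \<delta>" "real (H p n k)"] by (simp add: algebra_simps)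
        moreover have "x * real (H p n k) \<le> y * real (H p n k)" using xy by (intro mult_right_mono) auto
        ultimately have "\<bar>PL (concat bs) (y * real (H p n k)) - PL (concat bs) (x * real (H p n k))\<bar> \<le> 3 * Y"
          using b Y0 by (intro PL_concat_window[of bs Y "\<delta> * real (H p n k)"]) auto
        moreover have "phi p g n k y - phi p g n k x
            = (PL (concat bs) (y * real (H p n k)) - PL (concat bs) (x * real (H p n k))) / Rg p g n k"
          unfolding phi_def eq[symmetric] using xy Hp by (simp add: bridge_eq diff_divide_distrib)
        ultimately have "\<bar>phi p g n k y - phi p g n k x\<bar> \<le> 3 * Y / Rg p g n k"
          using R0 by (simp add: abs_divide divide_right_mono)
        also have "\<dots> \<le> 3 * Y / (r * \<rho> n k)" using R r \<rho>0 Y0 R0 by (intro divide_left_mono) auto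
        also have "\<dots> = 3 * K / r * tail_sum m" using \<rho>0 r by (simp add: Y_def)
        finally show ?thesis using m by linarith
      qed
      show "\<forall>x\<in>{0..1}. \<forall>y\<in>{0..1}. \<bar>x - y\<bar> \<le> \<delta> \<longrightarrow> \<bar>phi p g n k x - phi p g n k y\<bar> < \<epsilon>"
      proof (intro ballI impI)
        fix x y :: real assume "x \<in> {0..1}" "y \<in> {0..1}" "\<bar>x - y\<bar> \<le> \<delta>"
        then show "\<bar>phi p g n k x - phi p g n k y\<bar> < \<epsilon>"
          using win[of x y] win[of y x] by (cases "x \<le> y") (auto simp: abs_minus_commute)
      qed
    qed
  qed
  then show ?thesis using \<delta> by blast
qed

lemma continuous_on_phi:
  assumes "H p n k > 0"
  shows "continuous_on {0..1} (phi p g n k)"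
proof -
  have "continuous_on {0..1} (\<lambda>t. PL (wl (lam n k) n k) (t * real (H p n k)) / Rg p g n k)"
    unfolding divide_inverse
    by (intro continuous_on_mult continuous_on_const continuous_on_compose2[OF continuous_on_PL[of UNIV]]
        continuous_on_id) auto
  then show ?thesis
    by (rule continuous_on_eq) (use assms in \<open>simp add: phi_def bridge_eq\<close>)
qed

lemma abs_phi_le_1:
  assumes "H p n k > 0" "Rg p g n k > 0" "t \<in> {0..1}"
  shows "\<bar>phi p g n k t\<bar> \<le> 1"
proof -
  have "t * real (H p n k) \<le> real (H p n k)" using assms by (simp add: mult_left_le_one_le)
  then have "\<bar>PL (wl (lam n k) n k) (t * real (H p n k))\<bar> \<le> Rg p g n k"
    using assms by (intro Rg_ge) auto
  then show ?thesis using assms by (simp add: phi_def bridge_eq abs_divide)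
qed

text \<open>All estimates are uniform in \<open>k\<close> on the window, so the columns
  \<open>\<kappa> n\<close> may be arbitrary; the path enters only through its visits to the
  window.\<close>

theorem limiting_curve:
  assumes inf: "\<And>n0. \<exists>n\<ge>n0. good s n (\<kappa> n)"
  shows "\<exists>ns :: nat \<Rightarrow> nat. filterlim ns at_top sequentially \<and>
           (\<forall>j. N \<le> ns j \<and> Rg p g (ns j) (\<kappa> (ns j)) > 0) \<and>
           (\<exists>\<phi>. continuous_on {0..1} \<phi> \<and>
              uniform_limit {0..1} (\<lambda>j. phi p g (ns j) (\<kappa> (ns j))) \<phi> sequentially)"
proof -
  obtain r where r: "r > 0" and ev2: "\<forall>\<^sub>F n in sequentially. \<forall>k. good s n k \<longrightarrow> r * \<rho> n k \<le> Rg p g n k"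
    using Rg_lower by blast
  have "\<forall>\<^sub>F n in sequentially. good s n (\<kappa> n) \<longrightarrow> (N \<le> n \<and> H p n (\<kappa> n) > 0 \<and> Rg p g n (\<kappa> n) > 0)"
    using ev2 good_H_pos eventually_ge_at_top[of "N + 1"]
  proof eventually_elim
    case (elim n)
    have "r * \<rho> n (\<kappa> n) > 0" using r q0 w_pos elim(3) by (simp add: \<rho>_def)
    then show ?case using elim by fastforce
  qed
  then obtain n0 where n0: "\<And>n. n \<ge> n0 \<Longrightarrow> good s n (\<kappa> n) \<Longrightarrow> N \<le> n \<and> H p n (\<kappa> n) > 0 \<and> Rg p g n (\<kappa> n) > 0"
    unfolding eventually_sequentially by blast
  have "infinite {n. n \<ge> n0 \<and> good s n (\<kappa> n)}"
    unfolding infinite_nat_iff_unbounded_le using inf by (metis (mono_tags, lifting) max.bounded_iff mem_Collect_eq)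
  then obtain ms where ms: "strict_mono (ms :: nat \<Rightarrow> nat)" "\<And>j. ms j \<in> {n. n \<ge> n0 \<and> good s n (\<kappa> n)}"
    using infinite_enumerate by blast
  define F where "F j = phi p g (ms j) (\<kappa> (ms j))" for j
  have good: "good s (ms j) (\<kappa> (ms j))" "N \<le> ms j" "H p (ms j) (\<kappa> (ms j)) > 0" "Rg p g (ms j) (\<kappa> (ms j)) > 0" for j
    using ms(2)[of j] n0 by auto
  have equi: "\<exists>d. 0 < d \<and> (\<forall>n y. y \<in> {0..1} \<and> norm (x - y) < d \<longrightarrow> norm (F n x - F n y) < e)"
    if x: "x \<in> {0..1}" and e: "0 < e" for x e :: real
  proof -
    obtain d0 where d0: "d0 > 0" and ev: "\<forall>\<^sub>F n in sequentially. \<forall>k. good s n k \<longrightarrow>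
      (\<forall>x\<in>{0..1}. \<forall>y\<in>{0..1}. \<bar>x - y\<bar> \<le> d0 \<longrightarrow> \<bar>phi p g n k x - phi p g n k y\<bar> < e)"
      using phi_modulus[OF e] by blast
    then obtain j0 where j0: "\<And>n k x y. n \<ge> j0 \<Longrightarrow> good s n k \<Longrightarrow> x \<in> {0..1} \<Longrightarrow> y \<in> {0..1} \<Longrightarrow> \<bar>x - y\<bar> \<le> d0 \<Longrightarrow> \<bar>phi p g n k x - phi p g n k y\<bar> < e"
      unfolding eventually_sequentially by blast
    have "\<exists>d>0. \<forall>y\<in>{0..1}. dist y x < d \<longrightarrow> dist (F j y) (F j x) < e" for j
      using continuous_on_phi[OF good(3)[of j]] x e unfolding F_def continuous_on_iff by blast
    then obtain d where d: "\<And>j. d j > 0" "\<And>j y. y \<in> {0..1} \<Longrightarrow> dist y x < d j \<Longrightarrow> dist (F j y) (F j x) < e"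
      by metis
    \<comment> \<open>The common modulus holds from the index \<open>j0\<close> on; the finitely
      many earlier functions use their own continuity at x.\<close>
    define D where "D = Min (insert d0 (d ` {..<j0}))"
    have D0: "D > 0" unfolding D_def using d(1) d0 by (subst Min_gr_iff) auto
    have "norm (F j x - F j y) < e" if y: "y \<in> {0..1}" "norm (x - y) < D" for j y
    proof (cases "j < j0")
      case True
      then have "D \<le> d j" unfolding D_def by (intro Min_le) auto
      then have "dist y x < d j" using y by (simp add: dist_norm norm_minus_commute)
      then show ?thesis using d(2)[OF y(1), of j] by (simp add: dist_norm norm_minus_commute)
    next
      case False
      then have "ms j \<ge> j0" using seq_suble[OF ms(1), of j] by linarith
      moreover have "D \<le> d0" unfolding D_def by (intro Min_le) auto
      ultimately show ?thesis using j0[of "ms j" "\<kappa> (ms j)" x y] good(1) x y by (simp add: F_def)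
    qed
    then show ?thesis using D0 by blast
  qed
  obtain \<phi> t where t: "continuous_on {0..1} \<phi>" "strict_mono (t :: nat \<Rightarrow> nat)"
    "\<And>e. 0 < e \<Longrightarrow> \<exists>N. \<forall>n x. n \<ge> N \<and> x \<in> {0..1} \<longrightarrow> norm (F (t n) x - \<phi> x) < e"
  proof (rule Arzela_Ascoli[of "{0..1::real}" F 1])
    show "norm (F n x) \<le> 1" if "x \<in> {0..1}" for n x
      using abs_phi_le_1[OF good(3,4) that] by (simp add: F_def)
  qed (use equi in auto)
  show ?thesis
  proof (intro exI[of _ "ms \<circ> t"] conjI allI exI[of _ \<phi>])
    show "filterlim (ms \<circ> t) at_top sequentially"
      using ms(1) t(2) by (intro filterlim_subseq strict_mono_o)
    show "N \<le> (ms \<circ> t) j" "0 < Rg p g ((ms \<circ> t) j) (\<kappa> ((ms \<circ> t) j))" for j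
      using good by auto
    show "uniform_limit {0..1} (\<lambda>j. phi p g ((ms \<circ> t) j) (\<kappa> ((ms \<circ> t) j))) \<phi> sequentially"
      unfolding uniform_limit_sequentially_iff
    proof (intro allI impI)
      fix e :: real assume "e > 0"
      then obtain M where "\<And>n x. n \<ge> M \<Longrightarrow> x \<in> {0..1} \<Longrightarrow> norm (F (t n) x - \<phi> x) < e" using t(3) by blast
      then show "\<exists>M. \<forall>n\<ge>M. \<forall>x\<in>{0..1}. dist (phi p g ((ms \<circ> t) n) (\<kappa> ((ms \<circ> t) n)) x) (\<phi> x) < e"
        by (intro exI[of _ M]) (simp add: F_def dist_norm)
    qed
  qed (rule t)
qed

end

section \<open>Balanced functions are cohomologous to constants\<close>

lemma kk_Suc [simp]: "kk x (Suc n) = kk x n + fst (x n)"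
  by (simp add: kk_def)

lemma kk_eq_iff_agree:
  assumes "n \<le> m" "\<And>l. n \<le> l \<Longrightarrow> l < m \<Longrightarrow> x l = y l"
  shows "kk x m = kk y m \<longleftrightarrow> kk x n = kk y n"
  using assms
proof (induction m)
  case (Suc m)
  then show ?case by (cases "n = Suc m") auto
qed simp

definition seg :: "path \<Rightarrow> nat \<Rightarrow> label list" where "seg x n = map x [0..<n]"

lemma length_seg [simp]: "length (seg x n) = n" by (simp add: seg_def)

lemma nth_seg [simp]: "i < n \<Longrightarrow> seg x n ! i = x i" by (simp add: seg_def)

lemma kk_eq_seg: "kk x n = sum_list (map fst (seg x n))"
  by (simp add: kk_def seg_def comp_def interv_sum_list_conv_sum_set_nat atLeast0LessThan)

lemma seg_in_fin_paths: "Defs.valid_path p x \<Longrightarrow> seg x n \<in> fin_paths p n (kk x n)"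
  unfolding kk_eq_seg by (auto simp: fin_paths_def Defs.valid_path_def seg_def)

definition glue :: "label list \<Rightarrow> path \<Rightarrow> nat \<Rightarrow> path" where
  "glue c x n = (\<lambda>i. if i < n then c ! i else x i)"

lemma seg_glue: "length c = n \<Longrightarrow> seg (glue c x n) n = c"
  by (simp add: list_eq_iff_nth_eq glue_def)

lemma valid_glue:
  assumes "c \<in> fin_paths p n k" "Defs.valid_path p x" shows "Defs.valid_path p (glue c x n)"
  using assms by (auto simp: fin_paths_def Defs.valid_path_def glue_def)

lemma kk_glue: "c \<in> fin_paths p n k \<Longrightarrow> kk (glue c x n) n = k"
  unfolding kk_eq_seg by (subst seg_glue) (auto simp: fin_paths_def)

lemma path_lessD:
  assumes "path_less x y"
  shows "\<exists>i. x i \<noteq> y i \<and> (\<forall>l>i. x l = y l) \<and> kk x (Suc i) = kk y (Suc i) \<and> edge_less (x i) (y i)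
    \<and> (\<forall>m\<ge>Suc i. kk x m = kk y m)"
proof -
  from assms obtain i where i: "x i \<noteq> y i" "\<And>l. l > i \<Longrightarrow> x l = y l" "kk x (Suc i) = kk y (Suc i)" "edge_less (x i) (y i)"
    unfolding path_less_def by blast
  moreover have "kk x m = kk y m" if "m \<ge> Suc i" for m
    using kk_eq_iff_agree[OF that, of x y] i by auto
  ultimately show ?thesis by blast
qed

text \<open>Paths that share the vertex at level \<open>n\<close> and the tail after it are compared
  inside one tower.\<close>

lemma path_less_iff_fin_less:
  assumes "\<And>l. l \<ge> n \<Longrightarrow> x l = y l" "kk x n = kk y n"
  shows "path_less x y \<longleftrightarrow> fin_less (seg x n) (seg y n)"
proof
  assume "path_less x y"
  then obtain i where i: "x i \<noteq> y i" "\<And>l. l > i \<Longrightarrow> x l = y l" "edge_less (x i) (y i)"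
    using path_lessD by blast
  then have "i < n" using assms(1) by (metis not_le)
  then show "fin_less (seg x n) (seg y n)" unfolding fin_less_def using i by (intro exI[of _ i]) auto
next
  assume "fin_less (seg x n) (seg y n)"
  then obtain i where i: "i < n" "x i \<noteq> y i" "\<And>l. i < l \<Longrightarrow> l < n \<Longrightarrow> x l = y l" "edge_less (x i) (y i)"
    unfolding fin_less_def by auto
  have "kk x (Suc i) = kk y (Suc i)"
    using kk_eq_iff_agree[of "Suc i" n x y] i assms(2) by auto
  moreover have "x l = y l" if "l > i" for l
    using that i(3) assms(1) by (cases "l < n") auto
  ultimately show "path_less x y" unfolding path_less_def using i by blast
qed

lemma fin_less_nth_iff:
  assumes "a < H p n k" "b < H p n k"
  shows "fin_less (paths p n k ! a) (paths p n k ! b) \<longleftrightarrow> a < b"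
proof -
  have len: "length (paths p n k ! i) = n" if "i < H p n k" for i
    using that nth_mem[of i "paths p n k"] by (simp add: length_paths set_paths fin_paths_def)
  have lt: "fin_less (paths p n k ! i) (paths p n k ! j)" if "i < j" "j < H p n k" for i j
    using sorted_wrt_nth_less[OF sorted_paths that(1)] that by (simp add: length_paths)
  show ?thesis
  proof
    assume l: "fin_less (paths p n k ! a) (paths p n k ! b)"
    then have "a \<noteq> b" using fin_less_irrefl by metis
    moreover have "\<not> b < a" using l lt[of b a] fin_less_asym len assms by metis
    ultimately show "a < b" by simp
  qed (use lt assms in blast)
qed

lemma fin_paths_nth:
  assumes "c \<in> fin_paths p n k" obtains a where "a < H p n k" "c = paths p n k ! a"
  using assms by (metis in_set_conv_nth length_paths set_paths)

lemma nth_fin_paths: "a < H p n k \<Longrightarrow> paths p n k ! a \<in> fin_paths p n k"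
  using nth_mem[of a "paths p n k"] by (simp add: length_paths set_paths)

section \<open>Successors in the adic order\<close>

definition is_succ :: "nat poly \<Rightarrow> path \<Rightarrow> path \<Rightarrow> bool" where
  "is_succ p x y \<longleftrightarrow> Defs.valid_path p y \<and> path_less x y \<and>
     \<not> (\<exists>z. Defs.valid_path p z \<and> path_less x z \<and> path_less z y)"

text \<open>Both candidates agree with x from some level on, so they lie in one tower and are
  comparable; the smaller would lie strictly between x and the larger.\<close>

lemma is_succ_unique:
  assumes "is_succ p x y" "is_succ p x y'" shows "y = y'"
proof (rule ccontr)
  assume ne: "y \<noteq> y'"
  obtain i where i: "\<And>l. l > i \<Longrightarrow> x l = y l" "\<And>m. m \<ge> Suc i \<Longrightarrow> kk x m = kk y m"
    using assms(1) path_lessD[of x y] unfolding is_succ_def by auto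
  obtain i' where i': "\<And>l. l > i' \<Longrightarrow> x l = y' l" "\<And>m. m \<ge> Suc i' \<Longrightarrow> kk x m = kk y' m"
    using assms(2) path_lessD[of x y'] unfolding is_succ_def by auto
  define n where "n = Suc (max i i')"
  have ag: "y l = y' l" if "l \<ge> n" for l using i(1)[of l] i'(1)[of l] that by (simp add: n_def)
  have k: "kk y n = kk y' n" using i(2)[of n] i'(2)[of n] by (simp add: n_def)
  have "seg y n \<noteq> seg y' n"
  proof
    assume "seg y n = seg y' n"
    then have "y l = y' l" for l using ag[of l] nth_seg[of l n y] nth_seg[of l n y'] by (cases "l < n") auto
    then show False using ne by auto
  qed
  moreover obtain a where a: "a < H p n (kk y n)" "seg y n = paths p n (kk y n) ! a"
    using fin_paths_nth[OF seg_in_fin_paths[of p y n]] assms(1) unfolding is_succ_def by blast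
  moreover obtain b where b: "b < H p n (kk y n)" "seg y' n = paths p n (kk y n) ! b"
    using fin_paths_nth[OF seg_in_fin_paths[of p y' n]] assms(2) k unfolding is_succ_def by metis
  ultimately have "a \<noteq> b" by auto
  then have "fin_less (seg y n) (seg y' n) \<or> fin_less (seg y' n) (seg y n)"
    using fin_less_nth_iff a b by (metis linorder_neqE_nat)
  then have "path_less y y' \<or> path_less y' y"
    using path_less_iff_fin_less[of n y y'] path_less_iff_fin_less[of n y' y] ag k by auto
  then show False using assms unfolding is_succ_def by blast
qed

definition nonmax :: "nat poly \<Rightarrow> path \<Rightarrow> bool" where
  "nonmax p x \<longleftrightarrow> (\<exists>n. \<exists>c\<in>fin_paths p n (kk x n). fin_less (seg x n) c)"

text \<open>The initial segment is replaced by the next path of its tower. No path fits in between: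
  it would have the tail of x too, and so a position strictly between two consecutive ones.\<close>

lemma is_succ_exists:
  assumes v: "Defs.valid_path p x" and "nonmax p x"
  shows "\<exists>y. is_succ p x y"
proof -
  obtain n c where c: "c \<in> fin_paths p n (kk x n)" "fin_less (seg x n) c"
    using assms(2) unfolding nonmax_def by blast
  define k where "k = kk x n"
  obtain a where a: "a < H p n k" "seg x n = paths p n k ! a"
    using fin_paths_nth[OF seg_in_fin_paths[OF v, of n]] unfolding k_def by blast
  obtain b where b: "b < H p n k" "c = paths p n k ! b"
    using fin_paths_nth[OF c(1)] unfolding k_def by blast
  have "a < b" using c(2) fin_less_nth_iff a b by simp
  then have sa: "Suc a < H p n k" using b by simp
  define y where "y = glue (paths p n k ! Suc a) x n"
  have fp: "paths p n k ! Suc a \<in> fin_paths p n k" using sa by (rule nth_fin_paths)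
  have vy: "Defs.valid_path p y" unfolding y_def by (rule valid_glue[OF fp v])
  have ky: "kk y n = k" unfolding y_def by (rule kk_glue[OF fp])
  have sy: "seg y n = paths p n k ! Suc a" unfolding y_def using fp by (intro seg_glue) (simp add: fin_paths_def)
  have ag: "x l = y l" if "l \<ge> n" for l using that by (simp add: y_def glue_def)
  have "path_less x y"
    using path_less_iff_fin_less[of n x y] ag ky sy a sa fin_less_nth_iff[of a p n k "Suc a"] by (simp add: k_def)
  moreover have False if z: "Defs.valid_path p z" "path_less x z" "path_less z y" for z
  proof -
    obtain i where i: "x i \<noteq> z i" "\<And>l. l > i \<Longrightarrow> x l = z l" "edge_less (x i) (z i)" "\<And>m. m \<ge> Suc i \<Longrightarrow> kk x m = kk z m"
      using path_lessD[OF z(2)] by auto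
    obtain j where j: "z j \<noteq> y j" "\<And>l. l > j \<Longrightarrow> z l = y l" "edge_less (z j) (y j)"
      using path_lessD[OF z(3)] by auto
    \<comment> \<open>If z first left the tail of x at or above level n, then, whichever comparison
      has the higher last difference, z could not lie between x and y, which share this
      tail.\<close>
    have "i < n"
    proof (rule ccontr)
      assume "\<not> i < n"
      then have yi: "x i = y i" using ag by simp
      consider "j < i" | "i < j" | "i = j" by linarith
      then show False
      proof cases
        case 1 then show False using j(2)[of i] yi i(1) by simp
      next
        case 2 then show False using i(2)[of j] ag[of j] \<open>\<not> i < n\<close> j(1) by simp
      next
        case 3 then show False using i(3) j(3) yi edge_less_asym by metis
      qed
    qed
    then have agz: "x l = z l" if "l \<ge> n" for l using that i(2) by simp
    have kz: "kk z n = k" using i(4)[of n] \<open>i < n\<close> by (simp add: k_def)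
    obtain d where d: "d < H p n k" "seg z n = paths p n k ! d"
      using fin_paths_nth[OF seg_in_fin_paths[OF z(1), of n]] unfolding kz by blast
    have "fin_less (seg x n) (seg z n)"
      using path_less_iff_fin_less[of n x z] agz kz z(2) by (simp add: k_def)
    then have 1: "a < d" using fin_less_nth_iff a d by simp
    have "fin_less (seg z n) (seg y n)"
      using path_less_iff_fin_less[of n z y] agz ag kz ky z(3) by auto
    then have "d < Suc a" using fin_less_nth_iff d sa sy by simp
    then show False using 1 by simp
  qed
  ultimately show ?thesis unfolding is_succ_def using vy by blast
qed

lemma is_succ_Tp:
  assumes "Defs.valid_path p x" "nonmax p x" shows "is_succ p x (Tp p x)"
proof -
  have "\<exists>!y. is_succ p x y" using is_succ_exists[OF assms] is_succ_unique by blast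
  from theI'[OF this] show ?thesis unfolding Tp_def is_succ_def .
qed

context adic_fun
begin

text \<open>The sum of g - c over the positions before that of x in its tower of level
  \<open>N\<close>.\<close>

definition transfer :: "real \<Rightarrow> path \<Rightarrow> real" where
  "transfer c x = sum_list (take (card {d \<in> fin_paths p N (kk x N). fin_less d (seg x N)})
      (map (\<lambda>b. b - c) (gvals p g N (kk x N))))"

lemma transfer_nth:
  assumes "seg x N = paths p N (kk x N) ! a" "a < H p N (kk x N)"
  shows "transfer c x = sum_list (take a (map (\<lambda>b. b - c) (gvals p g N (kk x N))))"
proof -
  have "card {d \<in> fin_paths p N (kk x N). fin_less d (seg x N)} = a"
    unfolding assms(1) nth_sorted_less_set[OF assms(2)] using assms(2) distinct_paths[of p N "kk x N"]
    by (simp add: distinct_card length_paths)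
  then show ?thesis by (simp add: transfer_def)
qed

lemma gvals_nth:
  assumes "seg x N = paths p N (kk x N) ! a" "a < H p N (kk x N)"
  shows "gvals p g N (kk x N) ! a = g x"
proof -
  have "gvals p g N (kk x N) ! a = g (\<lambda>l. if l < N then seg x N ! l else (0, 0))"
    unfolding assms(1) using assms(2) by (simp add: gvals_def length_paths)
  also have "\<dots> = g x" by (rule cyl[unfolded cylindric_def, rule_format]) simp
  finally show ?thesis .
qed

text \<open>Inside a tower of level \<open>N\<close> the successor moves up by one position and adds
  one term. Otherwise x is last in its tower and y is first in its own; then both sides agree
  because the tower of x has total 0.\<close>

lemma transfer_succ:
  assumes v: "Defs.valid_path p x" and s: "is_succ p x y"
    and bal: "\<And>k. h N k = c * real (H p N k)"
  shows "transfer c y - transfer c x = g x - c"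
proof -
  have vy: "Defs.valid_path p y" and xy: "path_less x y"
    and nb: "\<And>z. Defs.valid_path p z \<Longrightarrow> path_less x z \<Longrightarrow> path_less z y \<Longrightarrow> False"
    using s unfolding is_succ_def by blast+
  define k k' where "k = kk x N" and "k' = kk y N"
  define L L' where "L = map (\<lambda>b. b - c) (gvals p g N k)" and "L' = map (\<lambda>b. b - c) (gvals p g N k')"
  obtain a where a: "a < H p N k" "seg x N = paths p N k ! a"
    using fin_paths_nth[OF seg_in_fin_paths[OF v, of N]] unfolding k_def by blast
  obtain b where b: "b < H p N k'" "seg y N = paths p N k' ! b"
    using fin_paths_nth[OF seg_in_fin_paths[OF vy, of N]] unfolding k'_def by blast
  have tx: "transfer c x = sum_list (take a L)" using transfer_nth a unfolding k_def L_def by simp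
  have ty: "transfer c y = sum_list (take b L')" using transfer_nth b unfolding k'_def L'_def by simp
  have lenL: "length L = H p N k" by (simp add: L_def)
  have La: "L ! a = g x - c" using gvals_nth[of x a] a by (simp add: L_def k_def)
  have tSuc: "sum_list (take (Suc a) L) = sum_list (take a L) + (g x - c)"
    using a lenL La by (simp add: take_Suc_conv_app_nth)
  obtain i where i: "x i \<noteq> y i" "\<And>l. l > i \<Longrightarrow> x l = y l" "kk x (Suc i) = kk y (Suc i)" "edge_less (x i) (y i)"
    "\<And>m. m \<ge> Suc i \<Longrightarrow> kk x m = kk y m"
    using path_lessD[OF xy] by auto
  show ?thesis
  proof (cases "i < N")
    case True
    then have ag: "x l = y l" if "l \<ge> N" for l using that i(2) by simp
    have kk': "k' = k" using i(5)[of N] True by (simp add: k_def k'_def)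
    have "fin_less (seg x N) (seg y N)"
      using path_less_iff_fin_less[of N x y] ag kk' xy by (simp add: k_def k'_def)
    then have ab: "a < b" using fin_less_nth_iff a b kk' by simp
    have "b = Suc a"
    proof (rule ccontr)
      assume "b \<noteq> Suc a"
      then have sb: "Suc a < b" using ab by simp
      then have sH: "Suc a < H p N k" using b kk' by simp
      define z where "z = glue (paths p N k ! Suc a) x N"
      have fp: "paths p N k ! Suc a \<in> fin_paths p N k" using sH by (rule nth_fin_paths)
      have kz: "kk z N = k" unfolding z_def by (rule kk_glue[OF fp])
      have sz: "seg z N = paths p N k ! Suc a"
        unfolding z_def using fp by (intro seg_glue) (simp add: fin_paths_def)
      have agz: "z l = x l" if "l \<ge> N" for l using that by (simp add: z_def glue_def)
      have "path_less x z"
        using path_less_iff_fin_less[of N x z] kz sz agz a sH fin_less_nth_iff[of a p N k "Suc a"]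
        by (simp add: k_def)
      moreover have "path_less z y"
        using path_less_iff_fin_less[of N z y] kz sz agz b sb sH ag kk' fin_less_nth_iff[of "Suc a" p N k b]
        by (simp add: k'_def)
      ultimately show False using nb valid_glue[OF fp v] unfolding z_def by blast
    qed
    then show ?thesis using tx ty tSuc kk' unfolding L_def L'_def by simp
  next
    case False
    then have iN: "N \<le> i" by simp
    \<comment> \<open>Moving x up by one position inside its tower keeps the difference from y at i
      \<ge> N, so it would give a path strictly between x and y.\<close>
    have "Suc a = H p N k"
    proof (rule ccontr)
      assume "Suc a \<noteq> H p N k"
      then have sH: "Suc a < H p N k" using a by simp
      define z where "z = glue (paths p N k ! Suc a) x N"
      have fp: "paths p N k ! Suc a \<in> fin_paths p N k" using sH by (rule nth_fin_paths)
      have kz: "kk z N = k" unfolding z_def by (rule kk_glue[OF fp])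
      have agz: "z l = x l" if "l \<ge> N" for l using that by (simp add: z_def glue_def)
      have sz: "seg z N = paths p N k ! Suc a"
        unfolding z_def using fp by (intro seg_glue) (simp add: fin_paths_def)
      have "path_less x z"
        using path_less_iff_fin_less[of N x z] kz sz agz a sH fin_less_nth_iff[of a p N k "Suc a"]
        by (simp add: k_def)
      moreover have "path_less z y"
        unfolding path_less_def
      proof (intro exI[of _ i] conjI allI impI)
        show "z i \<noteq> y i" "edge_less (z i) (y i)" using i agz[OF iN] by simp_all
        show "z l = y l" if "l > i" for l using that i(2) agz[of l] iN by simp
        have "kk z (Suc i) = kk x (Suc i)"
          using kk_eq_iff_agree[of N "Suc i" z x] iN agz kz by (simp add: k_def)
        then show "kk z (Suc i) = kk y (Suc i)" using i(3) by simp
      qed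
      ultimately show False using nb valid_glue[OF fp v] unfolding z_def by blast
    qed
    then have "sum_list L = transfer c x + (g x - c)" using tSuc tx lenL by simp
    moreover have "sum_list L = 0"
    proof -
      have "sum_list (map (\<lambda>b. b - c) bs) = sum_list bs - c * real (length bs)" for bs
        by (induction bs) (simp_all add: algebra_simps)
      then show ?thesis using bal[of k] by (simp add: L_def h_def)
    qed
    \<comment> \<open>Dually, moving y down by one position would give such a path.\<close>
    moreover have "b = 0"
    proof (rule ccontr)
      assume "b \<noteq> 0"
      define b' where "b' = b - 1"
      have b': "b' < b" "b' < H p N k'" using b \<open>b \<noteq> 0\<close> by (auto simp: b'_def)
      define z where "z = glue (paths p N k' ! b') y N"
      have fp: "paths p N k' ! b' \<in> fin_paths p N k'" using b'(2) by (rule nth_fin_paths)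
      have kz: "kk z N = k'" unfolding z_def by (rule kk_glue[OF fp])
      have agz: "z l = y l" if "l \<ge> N" for l using that by (simp add: z_def glue_def)
      have sz: "seg z N = paths p N k' ! b'"
        unfolding z_def using fp by (intro seg_glue) (simp add: fin_paths_def)
      have "path_less z y"
        using path_less_iff_fin_less[of N z y] kz sz agz b b' fin_less_nth_iff[of b' p N k' b]
        by (simp add: k'_def)
      moreover have "path_less x z"
        unfolding path_less_def
      proof (intro exI[of _ i] conjI allI impI)
        show "x i \<noteq> z i" "edge_less (x i) (z i)" using i agz[OF iN] by simp_all
        show "x l = z l" if "l > i" for l using that i(2) agz[of l] iN by simp
        have "kk z (Suc i) = kk y (Suc i)"
          using kk_eq_iff_agree[of N "Suc i" z y] iN agz kz by (simp add: k'_def)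
        then show "kk x (Suc i) = kk z (Suc i)" using i(3) by simp
      qed
      ultimately show False using nb valid_glue[OF fp vy] unfolding z_def by blast
    qed
    ultimately show ?thesis using ty by simp
  qed
qed

lemma transfer_bounded: "\<exists>B. \<forall>x. \<bar>transfer c x\<bar> \<le> B"
proof -
  define S where "S k = (\<Sum>b\<leftarrow>gvals p g N k. \<bar>b - c\<bar>)" for k
  have S0: "S k \<ge> 0" for k unfolding S_def by (intro sum_list_nonneg) auto
  have le: "\<bar>sum_list (take a bs)\<bar> \<le> (\<Sum>b\<leftarrow>bs. \<bar>b\<bar>)" for a and bs :: "real list"
  proof (induction bs arbitrary: a)
    case (Cons b bs)
    have "0 \<le> (\<Sum>b\<leftarrow>bs. \<bar>b\<bar>)" by (intro sum_list_nonneg) auto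
    then show ?case using Cons.IH[of "a - 1"] by (cases a) auto
  qed simp
  have "\<bar>transfer c x\<bar> \<le> (\<Sum>k\<le>degree p * N. S k)" for x
  proof -
    have "\<bar>transfer c x\<bar> \<le> S (kk x N)"
      unfolding transfer_def S_def using le[of _ "map (\<lambda>b. b - c) (gvals p g N (kk x N))"] by (simp add: comp_def)
    also have "\<dots> \<le> (\<Sum>k\<le>degree p * N. S k)"
    proof (cases "kk x N \<le> degree p * N")
      case True then show ?thesis using S0 by (intro member_le_sum) auto
    next
      case False
      then have "S (kk x N) = 0" using gvals_empty by (simp add: S_def)
      then show ?thesis using S0 by (simp add: sum_nonneg)
    qed
    finally show ?thesis .
  qed
  then show ?thesis by blast
qed

end

section \<open>Recurrence of the rescaled path\<close>

lemma card_nat_interval_ge: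
  fixes a b :: real
  assumes "0 \<le> a" "a \<le> b"
  shows "b - a - 1 \<le> real (card {k::nat. a \<le> real k \<and> real k \<le> b})"
proof -
  have "{nat \<lceil>a\<rceil>..nat \<lfloor>b\<rfloor>} \<subseteq> {k::nat. a \<le> real k \<and> real k \<le> b}"
  proof
    fix k assume "k \<in> {nat \<lceil>a\<rceil>..nat \<lfloor>b\<rfloor>}"
    then have "nat \<lceil>a\<rceil> \<le> k" "k \<le> nat \<lfloor>b\<rfloor>" by auto
    then show "k \<in> {k::nat. a \<le> real k \<and> real k \<le> b}" using assms by (simp add: nat_le_iff le_nat_iff) linarith
  qed
  moreover have "finite {k::nat. a \<le> real k \<and> real k \<le> b}"
  proof (rule finite_subset)
    show "{k::nat. a \<le> real k \<and> real k \<le> b} \<subseteq> {..nat \<lfloor>b\<rfloor>}"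
      by (auto simp: le_nat_floor)
  qed simp
  ultimately have "card {nat \<lceil>a\<rceil>..nat \<lfloor>b\<rfloor>} \<le> card {k::nat. a \<le> real k \<and> real k \<le> b}"
    by (intro card_mono)
  moreover have "b - a - 1 \<le> real (card {nat \<lceil>a\<rceil>..nat \<lfloor>b\<rfloor>})"
    using assms by (simp add: of_nat_diff) linarith
  ultimately show ?thesis by linarith
qed

text \<open>The condition for \<open>Suc j\<close> is stricter than the one for \<open>j\<close> by
  a fixed amount, which absorbs a perturbation tending to 0.\<close>

lemma frequently_near_cong:
  fixes a b :: "nat \<Rightarrow> real"
  assumes "(\<lambda>n. a n - b n) \<longlonglongrightarrow> 0"
    and "\<forall>j m. \<exists>n\<ge>m. \<bar>a n - z\<bar> \<le> 1 / 4 + 1 / (real j + 5)"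
  shows "\<forall>j m. \<exists>n\<ge>m. \<bar>b n - z\<bar> \<le> 1 / 4 + 1 / (real j + 5)"
proof (intro allI)
  fix j m :: nat
  define e where "e = 1 / (real j + 5) - 1 / (real (Suc j) + 5)"
  have "1 / (real (Suc j) + 5) < 1 / (real j + 5)" by (intro divide_strict_left_mono) auto
  then have "e > 0" by (simp add: e_def)
  then obtain m' where m': "\<And>n. n \<ge> m' \<Longrightarrow> \<bar>a n - b n\<bar> < e"
    using assms(1) unfolding LIMSEQ_iff by auto
  obtain n where n: "n \<ge> max m m'" "\<bar>a n - z\<bar> \<le> 1 / 4 + 1 / (real (Suc j) + 5)"
    using assms(2) by blast
  have "\<bar>b n - z\<bar> \<le> \<bar>a n - z\<bar> + \<bar>a n - b n\<bar>" by linarith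
  also have "\<dots> \<le> 1 / 4 + 1 / (real (Suc j) + 5) + e" using n m'[of n] by linarith
  finally have "\<bar>b n - z\<bar> \<le> 1 / 4 + 1 / (real j + 5)" by (simp add: e_def)
  then show "\<exists>n\<ge>m. \<bar>b n - z\<bar> \<le> 1 / 4 + 1 / (real j + 5)" using n by auto
qed

context poly_adic
begin

lemma sets_edge: "sets (edge_measure p q) = UNIV"
  by (simp add: edge_measure_def)

lemma space_edge: "space (edge_measure p q) = UNIV"
  by (simp add: edge_measure_def)

lemma finite_valid: "finite {e. valid_label p e}"
  unfolding set_labs[symmetric] by simp

lemma prob_space_edge: "prob_space (edge_measure p q)"
proof
  have eq: "{e. valid_label p e} = Sigma {..degree p} (\<lambda>j. {..<coeff p j})"
    by (auto simp: valid_label_def)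
  have "emeasure (edge_measure p q) (space (edge_measure p q))
    = (\<integral>\<^sup>+e. (if valid_label p e then ennreal (q * w ^ fst e) else 0) \<partial>count_space UNIV)"
    unfolding edge_measure_def w_def by (subst emeasure_density) simp_all
  also have "\<dots> = (\<Sum>e\<in>{e. valid_label p e}. if valid_label p e then ennreal (q * w ^ fst e) else 0)"
    by (rule nn_integral_count_space') (auto simp: finite_valid)
  also have "\<dots> = (\<Sum>e\<in>{e. valid_label p e}. ennreal (q * w ^ fst e))" by (intro sum.cong) auto
  also have "\<dots> = ennreal (\<Sum>e\<in>{e. valid_label p e}. q * w ^ fst e)"
    using q0 w_pos by (intro sum_ennreal) auto
  also have "(\<Sum>e\<in>{e. valid_label p e}. q * w ^ fst e) = (\<Sum>j\<le>degree p. \<Sum>m<coeff p j. q * w ^ j)"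
    unfolding eq by (subst sum.Sigma) (auto simp: case_prod_beta)
  also have "\<dots> = 1" using sum_f by (simp add: mult_ac)
  finally show "emeasure (edge_measure p q) (space (edge_measure p q)) = 1" by simp
qed

lemma measure_edge:
  assumes "valid_label p e" shows "measure (edge_measure p q) {e} = q * w ^ fst e"
proof -
  have "emeasure (edge_measure p q) {e} = (\<integral>\<^sup>+x. (if valid_label p x then ennreal (q * w ^ fst x) else 0) * indicator {e} x \<partial>count_space UNIV)"
    unfolding edge_measure_def w_def by (subst emeasure_density) simp_all
  also have "\<dots> = (\<Sum>x\<in>{e}. (if valid_label p x then ennreal (q * w ^ fst x) else 0) * indicator {e} x)"
    by (rule nn_integral_count_space') auto
  also have "\<dots> = ennreal (q * w ^ fst e)" using assms by simp
  finally show ?thesis using q0 w_pos by (simp add: measure_def)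
qed

lemma AE_edge_valid: "AE e in edge_measure p q. valid_label p e"
proof -
  have "AE e in density (count_space UNIV) (\<lambda>e. if valid_label p e then ennreal (q * (tq p q / q) ^ fst e) else 0). valid_label p e"
    by (subst AE_density) (auto simp: AE_count_space)
  then show ?thesis unfolding edge_measure_def .
qed

sublocale PP: product_prob_space "\<lambda>_. edge_measure p q" "UNIV :: nat set"
  by (intro product_prob_spaceI prob_space_edge)

lemma space_mu [simp]: "space (mu p q) = UNIV"
  by (simp add: mu_def space_PiM space_edge PiE_UNIV_domain)

lemma prob_space_mu: "prob_space (mu p q)"
  unfolding mu_def by (rule PP.P.prob_space_axioms)

lemma measurable_coord: "space L = UNIV \<Longrightarrow> (\<lambda>x. F (x i)) \<in> measurable (mu p q) L"
  unfolding mu_def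
  by (rule measurable_compose[OF measurable_component_singleton[of i]])
    (auto simp: measurable_def sets_edge space_edge)

lemma AE_valid: "AE x in mu p q. Defs.valid_path p x"
  unfolding Defs.valid_path_def mu_def AE_all_countable
  by (intro allI AE_PiM_component prob_space_edge AE_edge_valid) simp

lemma measurable_kk: "(\<lambda>x. kk x n) \<in> measurable (mu p q) (count_space UNIV)"
proof (induction n)
  case (Suc n)
  have "(\<lambda>x. fst (x n)) \<in> measurable (mu p q) (count_space UNIV)"
    by (rule measurable_coord) simp
  then show ?case using Suc by simp
qed (simp add: kk_def)

lemma measure_cylinder:
  assumes "c \<in> fin_paths p n k"
  shows "{x. \<forall>i<n. x i = c ! i} \<in> sets (mu p q)" "measure (mu p q) {x. \<forall>i<n. x i = c ! i} = q ^ n * w ^ k"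
proof -
  have c: "length c = n" "\<And>i. i < n \<Longrightarrow> valid_label p (c ! i)" "sum_list (map fst c) = k"
    using assms by (auto simp: fin_paths_def)
  have eq: "{x. \<forall>i<n. x i = c ! i} = prod_emb UNIV (\<lambda>_. edge_measure p q) {..<n} (PiE {..<n} (\<lambda>i. {c ! i}))"
    by (simp add: set_eq_iff prod_emb_iff restrict_PiE_iff space_edge Ball_def Pi_iff)
  show "{x. \<forall>i<n. x i = c ! i} \<in> sets (mu p q)"
    unfolding eq mu_def by (intro sets_PiM_I) (auto simp: sets_edge)
  have "measure (mu p q) {x. \<forall>i<n. x i = c ! i} = (\<Prod>i<n. measure (edge_measure p q) {c ! i})"
    unfolding eq mu_def by (rule PP.measure_PiM_emb) (auto simp: sets_edge)
  also have "\<dots> = (\<Prod>i<n. q * w ^ fst (c ! i))"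
    using c by (intro prod.cong) (auto simp: measure_edge)
  also have "\<dots> = q ^ n * w ^ (\<Sum>i<n. fst (c ! i))"
    by (simp add: prod.distrib power_sum)
  also have "(\<Sum>i<n. fst (c ! i)) = k"
    using c(1,3) by (simp add: sum_list_sum_nth atLeast0LessThan)
  finally show "measure (mu p q) {x. \<forall>i<n. x i = c ! i} = q ^ n * w ^ k" .
qed

lemma card_fin_paths: "card (fin_paths p n k) = H p n k" "finite (fin_paths p n k)"
  unfolding set_paths[symmetric] by (simp_all add: distinct_card distinct_paths length_paths)

text \<open>The cylinders of the finite paths are disjoint. They lie inside the event, which may
  also contain sequences with invalid labels.\<close>

lemma measure_kk_ge:
  assumes "finite S"
  shows "(\<Sum>k\<in>S. cf 1 0 n k) \<le> measure (mu p q) {x. kk x n \<in> S}"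
proof -
  interpret prob_space "mu p q" by (rule prob_space_mu)
  define C where "C = (\<Union>k\<in>S. fin_paths p n k)"
  define A where "A c = {x. \<forall>i<n. x i = c ! i}" for c :: "label list"
  have C: "c \<in> C \<Longrightarrow> \<exists>k\<in>S. c \<in> fin_paths p n k" for c by (auto simp: C_def)
  have disj: "disjoint_family_on A C"
    unfolding disjoint_family_on_def
  proof (intro ballI impI)
    fix c d assume "c \<in> C" "d \<in> C" "c \<noteq> d"
    then have "length c = n" "length d = n" by (auto simp: C_def fin_paths_def)
    then obtain i where "i < n" "c ! i \<noteq> d ! i" using \<open>c \<noteq> d\<close> by (metis nth_equalityI)
    then show "A c \<inter> A d = {}" by (auto simp: A_def)
  qed
  have "(\<Sum>k\<in>S. cf 1 0 n k) = (\<Sum>k\<in>S. \<Sum>c\<in>fin_paths p n k. measure (mu p q) (A c))"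
    by (intro sum.cong) (simp_all add: cf_1 A_def measure_cylinder card_fin_paths)
  also have "\<dots> = (\<Sum>c\<in>C. measure (mu p q) (A c))"
    unfolding C_def using assms
    by (intro sum.UNION_disjoint[symmetric]) (auto simp: card_fin_paths, auto simp: fin_paths_def)
  also have "\<dots> = measure (mu p q) (\<Union>c\<in>C. A c)"
  proof (rule finite_measure_finite_Union[symmetric])
    show "finite C" using assms by (auto simp: C_def card_fin_paths)
    show "A ` C \<subseteq> events" using C measure_cylinder(1) by (auto simp: A_def)
  qed (rule disj)
  also have "\<dots> \<le> measure (mu p q) {x. kk x n \<in> S}"
  proof (rule finite_measure_mono)
    show "(\<Union>c\<in>C. A c) \<subseteq> {x. kk x n \<in> S}"
    proof
      fix x assume "x \<in> (\<Union>c\<in>C. A c)"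
      then obtain c k where c: "c \<in> fin_paths p n k" "k \<in> S" "\<forall>i<n. x i = c ! i" by (auto simp: C_def A_def)
      then have "seg x n = c" by (auto simp: fin_paths_def list_eq_iff_nth_eq)
      then show "x \<in> {x. kk x n \<in> S}" using c by (simp add: kk_eq_seg fin_paths_def)
    qed
    have "(\<lambda>x. kk x n) -` S \<inter> space (mu p q) \<in> events" by (rule measurable_sets[OF measurable_kk]) simp
    then show "{x. kk x n \<in> S} \<in> events" by (simp add: vimage_def)
  qed
  finally show ?thesis .
qed

text \<open>The interval for k has length sqrt n / 2, and each integer in it carries mass at least a
  constant over sqrt n. It is centred in the window, and its radius 1/4 leaves room for the slack of
  at most 1/5: 1/4 + 1/5 < 1/2.\<close>

lemma prob_near_ge:
  "\<exists>\<delta>>0. \<forall>\<^sub>F n in sequentially. \<delta> \<le> measure (mu p q) {x. \<bar>zs n (kk x n) - (real s + var + 1 / 2)\<bar> \<le> 1 / 4}"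
proof -
  define \<kappa> where "\<kappa> = Psi 0 (real s + var + 1) / 2"
  have \<kappa>: "\<kappa> > 0" using Psi_0_pos by (simp add: \<kappa>_def)
  define z0 where "z0 = real s + var + 1 / 2"
  have "\<forall>\<^sub>F n in sequentially. \<kappa> / 4 \<le> measure (mu p q) {x. \<bar>zs n (kk x n) - z0\<bar> \<le> 1 / 4}"
    using good_cf_ge[OF le0[of "degree f * 0"], of s] eventually_ge_at_top[of 16]
  proof eventually_elim
    case (elim n)
    define S where "S = sqrt (real n)"
    \<comment> \<open>Ensures S/2 - 1 \<ge> S/4, a lower bound for the number of integers in the
      interval.\<close>
    have S: "S \<ge> 4" using elim(2) by (simp add: S_def real_le_rsqrt)
    define a b where "a = real n * mean + (z0 - 1 / 4) * S" and "b = real n * mean + (z0 + 1 / 4) * S"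
    define A where "A = {k::nat. a \<le> real k \<and> real k \<le> b}"
    have A: "k \<in> A \<longleftrightarrow> \<bar>zs n k - z0\<bar> \<le> 1 / 4" for k
    proof -
      have "real k = real n * mean + zs n k * S" using elim(2) by (simp add: zs_def S_def)
      then have "a \<le> real k \<longleftrightarrow> (z0 - 1 / 4) * S \<le> zs n k * S" "real k \<le> b \<longleftrightarrow> zs n k * S \<le> (z0 + 1 / 4) * S"
        by (simp_all add: a_def b_def)
      then have *: "k \<in> A \<longleftrightarrow> z0 - 1 / 4 \<le> zs n k \<and> zs n k \<le> z0 + 1 / 4" using S by (simp add: A_def)
      show ?thesis unfolding * by arith
    qed
    have fin: "finite A"
      by (rule finite_subset[of _ "{..nat \<lfloor>b\<rfloor>}"]) (auto simp: A_def le_nat_floor)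
    have "z0 > 1 / 4" using var_pos by (simp add: z0_def)
    then have a0: "0 \<le> a" using S mean_pos by (simp add: a_def)
    have ba: "b - a = S / 2" by (simp add: a_def b_def algebra_simps)
    have "S / 4 \<le> b - a - 1" using S unfolding ba by simp
    also have "\<dots> \<le> real (card A)" unfolding A_def using a0 ba S by (intro card_nat_interval_ge) auto
    finally have card: "S / 4 \<le> real (card A)" .
    have "\<kappa> / 4 = S / 4 * (\<kappa> / S)" using S by simp
    also have "\<dots> \<le> real (card A) * (\<kappa> / S)" using card \<kappa> S by (intro mult_right_mono) auto
    also have "\<dots> = (\<Sum>k\<in>A. \<kappa> / S)" by simp
    also have "\<dots> \<le> (\<Sum>k\<in>A. cf 1 0 n k)"
    proof (rule sum_mono)
      fix k assume "k \<in> A"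
      then have "\<bar>zs n k - z0\<bar> \<le> 1 / 4" by (simp add: A)
      then have "good s n k" unfolding good_def z0_def by linarith
      then have "\<kappa> \<le> S * cf 1 0 n k" using elim(1) by (simp add: S_def \<kappa>_def monom_0 flip: one_pCons)
      then show "\<kappa> / S \<le> cf 1 0 n k" using S by (simp add: field_simps)
    qed
    also have "\<dots> \<le> measure (mu p q) {x. kk x n \<in> A}" by (rule measure_kk_ge[OF fin])
    finally show ?case by (simp add: A)
  qed
  then show ?thesis using \<kappa> unfolding z0_def by (intro exI[of _ "\<kappa> / 4"]) auto
qed

section \<open>The zero-one law for visits to the window\<close>

definition coord_events :: "nat \<Rightarrow> path set set" where
  "coord_events i = {(\<lambda>x. x i) -` A \<inter> space (mu p q) |A. A \<in> sets (edge_measure p q)}"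

lemma indep_coord_events: "prob_space.indep_sets (mu p q) coord_events UNIV"
proof -
  interpret prob_space "mu p q" by (rule prob_space_mu)
  have rv: "random_variable (edge_measure p q) (\<lambda>x. x i)" for i
    by (rule measurable_coord[of _ "\<lambda>e. e"]) (rule space_edge)
  have "indep_vars (\<lambda>_. edge_measure p q) (\<lambda>i x. x i) (UNIV :: nat set)"
  proof (subst indep_vars_iff_distr_eq_PiM)
    have "distr (mu p q) (PiM UNIV (\<lambda>_. edge_measure p q)) (\<lambda>x. \<lambda>i\<in>UNIV. x i) = distr (mu p q) (mu p q) (\<lambda>x. x)"
      by (simp add: mu_def restrict_UNIV)
    also have "\<dots> = mu p q" by (simp add: distr_id2)
    also have "\<dots> = (\<Pi>\<^sub>M i\<in>UNIV. distr (mu p q) (edge_measure p q) (\<lambda>x. x i))"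
      unfolding mu_def by (subst distr_PiM_component) (auto intro: prob_space_edge)
    finally show "distr (mu p q) (PiM UNIV (\<lambda>_. edge_measure p q)) (\<lambda>x. \<lambda>i\<in>UNIV. x i)
      = (\<Pi>\<^sub>M i\<in>UNIV. distr (mu p q) (edge_measure p q) (\<lambda>x. x i))" .
  qed (use rv in auto)
  then show ?thesis unfolding indep_vars_def2 coord_events_def[abs_def] by simp
qed

lemma sigma_algebra_coord_events: "sigma_algebra (space (mu p q)) (coord_events i)"
proof -
  have "coord_events i = sets (vimage_algebra (space (mu p q)) (\<lambda>x. x i) (edge_measure p q))"
    unfolding coord_events_def by (subst sets_vimage_algebra2) (auto simp: space_edge)
  then show ?thesis
    using sets.sigma_algebra_axioms[of "vimage_algebra (space (mu p q)) (\<lambda>x. x i) (edge_measure p q)"] by simp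
qed

text \<open>The slack 1/(j+5) makes the event insensitive to the first coordinates, hence a tail event.\<close>

definition near_io :: "nat \<Rightarrow> path set" where
  "near_io s = {x. \<forall>j m. \<exists>n\<ge>m. \<bar>zs n (kk x n) - (real s + var + 1 / 2)\<bar> \<le> 1 / 4 + 1 / (real j + 5)}"

text \<open>Dropping the first \<open>m0\<close> edges changes the standardised position by a
  constant over sqrt n.\<close>

lemma near_io_shift:
  "near_io s = {x. \<forall>j m. \<exists>n\<ge>m. \<bar>((\<Sum>i\<in>{m0..<n}. real (fst (x i))) - real n * mean) / sqrt (real n)
      - (real s + var + 1 / 2)\<bar> \<le> 1 / 4 + 1 / (real j + 5)}"
proof -
  have lim: "(\<lambda>n. zs n (kk x n) - ((\<Sum>i\<in>{m0..<n}. real (fst (x i))) - real n * mean) / sqrt (real n)) \<longlonglongrightarrow> 0" for x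
  proof -
    have "eventually (\<lambda>n. real (kk x m0) / sqrt (real n) = zs n (kk x n) - ((\<Sum>i\<in>{m0..<n}. real (fst (x i))) - real n * mean) / sqrt (real n)) sequentially"
      using eventually_ge_at_top[of m0]
    proof eventually_elim
      case (elim n)
      have "{..<n} = {..<m0} \<union> {m0..<n}" using elim by auto
      then have "real (kk x n) = real (kk x m0) + (\<Sum>i\<in>{m0..<n}. real (fst (x i)))"
        by (simp add: kk_def sum.union_disjoint ivl_disj_int)
      then show ?case by (simp add: zs_def diff_divide_distrib add_divide_distrib)
    qed
    then show ?thesis using tendsto_div_sqrt[of "real (kk x m0)"] by (rule Lim_transform_eventually[rotated])
  qed
  have lim': "(\<lambda>n. ((\<Sum>i\<in>{m0..<n}. real (fst (x i))) - real n * mean) / sqrt (real n) - zs n (kk x n)) \<longlonglongrightarrow> 0" for x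
    using tendsto_minus[OF lim[of x]] by simp
  show ?thesis unfolding near_io_def
    using frequently_near_cong[OF lim] frequently_near_cong[OF lim'] by blast
qed

lemma near_io_tail: "near_io s \<in> prob_space.tail_events (mu p q) coord_events"
proof -
  interpret prob_space "mu p q" by (rule prob_space_mu)
  have "near_io s \<in> sigma_sets (space (mu p q)) (\<Union> (coord_events ` {m0..}))" for m0
  proof -
    define L where "L = sigma (UNIV :: path set) (\<Union> (coord_events ` {m0..}))"
    have sub: "\<Union> (coord_events ` {m0..}) \<subseteq> Pow UNIV" by auto
    have sp: "space L = UNIV" by (simp add: L_def)
    have st: "sets L = sigma_sets UNIV (\<Union> (coord_events ` {m0..}))" by (simp add: L_def)
    have [measurable]: "(\<lambda>x. real (fst (x i))) \<in> borel_measurable L" if "i \<ge> m0" for i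
    proof (rule measurableI)
      fix A :: "real set" assume "A \<in> sets borel"
      have "(\<lambda>x. real (fst (x i))) -` A \<inter> space L = (\<lambda>x. x i) -` {e. real (fst e) \<in> A} \<inter> space (mu p q)"
        by (auto simp: sp)
      also have "\<dots> \<in> coord_events i"
        unfolding coord_events_def by (intro CollectI exI[of _ "{e. real (fst e) \<in> A}"]) (simp add: sets_edge)
      finally show "(\<lambda>x. real (fst (x i))) -` A \<inter> space L \<in> sets L"
        unfolding st using that by (intro sigma_sets.Basic) auto
    qed simp
    have [measurable]: "(\<lambda>x. \<Sum>i\<in>{m0..<n}. real (fst (x i))) \<in> borel_measurable L" for n
      by (rule borel_measurable_sum) simp
    have "{x \<in> space L. \<forall>j m. \<exists>n\<ge>m. \<bar>((\<Sum>i\<in>{m0..<n}. real (fst (x i))) - real n * mean) / sqrt (real n)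
      - (real s + var + 1 / 2)\<bar> \<le> 1 / 4 + 1 / (real j + 5)} \<in> sets L"
      by measurable
    then show ?thesis unfolding near_io_shift[of s m0] st sp by simp
  qed
  then show ?thesis unfolding tail_events_def by blast
qed

text \<open>Events of probability at least \<delta> occur infinitely often with probability at least
  \<delta>; this lim sup lies in the tail event \<open>near_io s\<close>, whose probability must
  then be 1.\<close>

lemma AE_good_io: "AE x in mu p q. \<forall>n0. \<exists>n\<ge>n0. good s n (kk x n)"
proof -
  interpret prob_space "mu p q" by (rule prob_space_mu)
  define A where "A n = {x. \<bar>zs n (kk x n) - (real s + var + 1 / 2)\<bar> \<le> 1 / 4}" for n
  obtain \<delta> n1 where \<delta>: "\<delta> > 0" "\<And>n. n \<ge> n1 \<Longrightarrow> \<delta> \<le> prob (A n)"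
    using prob_near_ge[of s] unfolding eventually_sequentially A_def by blast
  have A_sets: "A n \<in> events" for n
  proof -
    have "(\<lambda>x. kk x n) -` {k. \<bar>zs n k - (real s + var + 1 / 2)\<bar> \<le> 1 / 4} \<inter> space (mu p q) \<in> events"
      by (rule measurable_sets[OF measurable_kk]) simp
    then show ?thesis by (simp add: A_def vimage_def)
  qed
  define B where "B m = (\<Union>n\<in>{m..}. A n)" for m
  have B_sets: "B m \<in> events" for m unfolding B_def using A_sets by (intro sets.countable_UN') auto
  have "decseq B" unfolding B_def decseq_def by (intro allI impI UN_mono) auto
  then have lim: "(\<lambda>m. prob (B m)) \<longlonglongrightarrow> prob (\<Inter>m. B m)"
    using B_sets by (intro finite_Lim_measure_decseq) auto
  have "\<delta> \<le> prob (B m)" for m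
  proof -
    have "\<delta> \<le> prob (A (max m n1))" by (rule \<delta>) simp
    also have "\<dots> \<le> prob (B m)"
      by (intro finite_measure_mono B_sets) (unfold B_def, rule UN_upper, simp)
    finally show ?thesis .
  qed
  then have "\<delta> \<le> prob (\<Inter>m. B m)" by (intro tendsto_lowerbound[OF lim]) auto
  moreover have T_sets: "near_io s \<in> events"
  proof -
    have "tail_events coord_events \<subseteq> events"
      using indep_coord_events by (intro tail_events_sets) (auto simp: indep_sets_def)
    then show ?thesis using near_io_tail by blast
  qed
  moreover have "(\<Inter>m. B m) \<subseteq> near_io s"
  proof
    fix x assume x: "x \<in> (\<Inter>m. B m)"
    have "\<exists>n\<ge>m. \<bar>zs n (kk x n) - (real s + var + 1 / 2)\<bar> \<le> 1 / 4 + 1 / (real j + 5)" for j m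
    proof -
      have "x \<in> B m" using x by blast
      then obtain n where n: "n \<ge> m" "\<bar>zs n (kk x n) - (real s + var + 1 / 2)\<bar> \<le> 1 / 4"
        unfolding B_def A_def by blast
      have "0 \<le> 1 / (real j + 5)" by simp
      then have "\<bar>zs n (kk x n) - (real s + var + 1 / 2)\<bar> \<le> 1 / 4 + 1 / (real j + 5)" using n(2) by linarith
      then show ?thesis using n(1) by blast
    qed
    then show "x \<in> near_io s" unfolding near_io_def by blast
  qed
  ultimately have "0 < prob (near_io s)" using \<delta>(1) finite_measure_mono[of "\<Inter>m. B m" "near_io s"] by linarith
  moreover have "prob (near_io s) = 0 \<or> prob (near_io s) = 1"
    by (rule kolmogorov_0_1_law[OF sigma_algebra_coord_events indep_coord_events near_io_tail])
  ultimately have "prob (near_io s) = 1" by simp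
  then have "AE x in mu p q. x \<in> near_io s" using T_sets by (simp add: prob_eq_1)
  then show ?thesis
  proof eventually_elim
    case (elim x)
    show ?case
    proof
      fix n0
      \<comment> \<open>Already j = 0 suffices: 1/4 + 1/5 is less than half the length of the
        window.\<close>
      obtain n where n: "n \<ge> n0" "\<bar>zs n (kk x n) - (real s + var + 1 / 2)\<bar> \<le> 1 / 4 + 1 / (real 0 + 5)"
        using elim unfolding near_io_def by blast
      then have "\<bar>zs n (kk x n) - (real s + var + 1 / 2)\<bar> \<le> 9 / 20" by simp
      then have "good s n (kk x n)" unfolding good_def by linarith
      then show "\<exists>n\<ge>n0. good s n (kk x n)" using n by blast
    qed
  qed
qed


text \<open>Raising the type of the earlier edge by 1 and lowering that of the later one by 1
  preserves the vertex. The later edge decides the comparison, and lower types come later in the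
  order. Index 0 is a valid label since all coefficients are positive.\<close>

lemma nonmax_if_exchange:
  assumes v: "Defs.valid_path p x" and ij: "i < j" "fst (x i) < degree p" "fst (x j) > 0"
  shows "nonmax p x"
proof -
  define y where "y = x(i := (fst (x i) + 1, 0), j := (fst (x j) - 1, 0))"
  define n where "n = Suc j"
  have "valid_label p (x j)" using v by (simp add: Defs.valid_path_def)
  then have "fst (x j) - 1 \<le> degree p" unfolding valid_label_def by linarith
  then have vy: "Defs.valid_path p y"
    using v ij cpos[of "fst (x i) + 1"] cpos[of "fst (x j) - 1"]
    by (auto simp: y_def Defs.valid_path_def valid_label_def)
  have split: "kk z n = fst (z i) + fst (z j) + (\<Sum>l\<in>{..<n} - {i, j}. fst (z l))" for z
  proof -
    have "{..<n} = insert i (insert j ({..<n} - {i, j}))" using ij by (auto simp: n_def)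
    then have "(\<Sum>l<n. fst (z l)) = (\<Sum>l\<in>insert i (insert j ({..<n} - {i, j})). fst (z l))" by simp
    also have "\<dots> = fst (z i) + fst (z j) + (\<Sum>l\<in>{..<n} - {i, j}. fst (z l))"
      using ij by simp
    finally show ?thesis by (simp add: kk_def)
  qed
  have "kk y n = kk x n" unfolding split using ij by (simp add: y_def)
  then have "seg y n \<in> fin_paths p n (kk x n)" using seg_in_fin_paths[OF vy, of n] by simp
  moreover have "fin_less (seg x n) (seg y n)"
  proof -
    have lt: "edge_less (x j) (y j)" using ij by (simp add: edge_less_def y_def)
    then have "x j \<noteq> y j" using edge_less_asym[of "x j" "y j"] by metis
    then show ?thesis unfolding fin_less_def using lt
      by (intro exI[of _ j]) (auto simp: n_def simp del: fun_upd_apply)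
  qed
  ultimately show ?thesis unfolding nonmax_def by blast
qed

lemma mean_less_degree: "mean < real (degree p)"
proof -
  have "real (degree p) - mean = (\<Sum>i\<le>degree p. coeff f i * (real (degree p) - real i))"
    using sum_coeff by (simp add: right_diff_distrib sum_subtractf mean_def degree_f flip: sum_distrib_right)
  also have "\<dots> \<ge> coeff f 0 * (real (degree p) - real 0)"
    by (rule member_le_sum) (auto intro!: mult_nonneg_nonneg nonneg)
  moreover have "coeff f 0 * (real (degree p) - real 0) > 0" using pos0 deg by simp
  ultimately show ?thesis by linarith
qed

text \<open>Without an exchange, either every edge has the top type, or all edges after the first
  lower one have type 0. Then k_n grows at rate \<open>degree p\<close> or is eventually constant,
  while the mean lies strictly in between, so the standardised position leaves the window for
  good.\<close>

lemma nonmax_if_good_io: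
  assumes v: "Defs.valid_path p x" and io: "\<And>n0. \<exists>n\<ge>n0. good s n (kk x n)"
  shows "nonmax p x"
proof (rule ccontr)
  assume nm: "\<not> nonmax p x"
  have le: "fst (x i) \<le> degree p" for i
    using v by (simp add: Defs.valid_path_def valid_label_def)
  show False
  proof (cases "\<exists>i. fst (x i) < degree p")
    case True
    then obtain i where i: "fst (x i) < degree p" by blast
    have z: "fst (x l) = 0" if "l > i" for l
      using nonmax_if_exchange[OF v that i] nm by auto
    have kk: "kk x n = kk x (Suc i)" if "n \<ge> Suc i" for n
      using that by (induction n rule: dec_induct) (simp_all add: z)
    obtain m where m: "real (kk x (Suc i)) < real m * mean"
      using reals_Archimedean3[OF mean_pos] by blast
    obtain n where n: "n \<ge> max (Suc i) (Suc m)" "good s n (kk x n)" using io by blast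
    have "real m * mean \<le> real n * mean" using n mean_pos by (intro mult_right_mono) auto
    then have "real (kk x n) - real n * mean < 0" using m kk[of n] n by simp
    then have "zs n (kk x n) < 0" unfolding zs_def using n by (intro divide_neg_pos) auto
    then show False using n(2) var_pos unfolding good_def by linarith
  next
    case False
    then have "fst (x i) = degree p" for i using le[of i] by (metis le_neq_implies_less)
    then have kk: "kk x n = n * degree p" for n by (simp add: kk_def)
    define a where "a = real (degree p) - mean"
    have a: "a > 0" using mean_less_degree by (simp add: a_def)
    obtain m where m: "real s + var + 1 < real m * a" using reals_Archimedean3[OF a] by blast
    obtain n where n: "n \<ge> Suc (m\<^sup>2)" "good s n (kk x n)" using io by blast
    have "real m \<le> sqrt (real n)" using n(1) by (intro real_le_rsqrt) (simp flip: of_nat_power)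
    have "zs n (kk x n) = (real n * a) / sqrt (real n)" by (simp add: zs_def kk a_def algebra_simps)
    also have "\<dots> = sqrt (real n) * a" by (simp add: real_div_sqrt flip: times_divide_eq_left)
    also have "\<dots> \<ge> real m * a" using \<open>real m \<le> sqrt (real n)\<close> a by (intro mult_right_mono) auto
    finally show False using n(2) m unfolding good_def by linarith
  qed
qed

lemma AE_nonmax: "AE x in mu p q. nonmax p x"
  using AE_good_io[of 0] AE_valid
proof eventually_elim
  case (elim x)
  show ?case by (rule nonmax_if_good_io[OF elim(2)]) (use elim(1) in blast)
qed

end

context adic_fun
begin

lemma transfer_measurable: "transfer c \<in> borel_measurable (mu p q)"
proof -
  have seg: "(\<lambda>x. seg x n) \<in> measurable (mu p q) (count_space UNIV)" for n
  proof (induction n)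
    case 0
    then show ?case by (simp add: seg_def)
  next
    case (Suc n)
    have m1: "(\<lambda>x. x n) \<in> measurable (mu p q) (count_space UNIV)"
      by (rule measurable_coord[of _ "\<lambda>e. e"]) simp
    have "(\<lambda>x. (seg x n, x n)) \<in> measurable (mu p q) (count_space UNIV \<Otimes>\<^sub>M count_space UNIV)"
      by (rule measurable_Pair[OF Suc m1])
    then have "(\<lambda>x. (seg x n, x n)) \<in> measurable (mu p q) (count_space UNIV)"
      by (simp add: pair_measure_countable)
    then have "(\<lambda>x. (\<lambda>(c, e). c @ [e]) (seg x n, x n)) \<in> measurable (mu p q) (count_space UNIV)"
      by (rule measurable_compose) simp
    then show ?case by (simp add: seg_def)
  qed
  have "(\<lambda>x. (\<lambda>c'. sum_list (take (card {d \<in> fin_paths p N (sum_list (map fst c')). fin_less d c'})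
      (map (\<lambda>b. b - c) (gvals p g N (sum_list (map fst c')))))) (seg x N)) \<in> borel_measurable (mu p q)"
    by (rule measurable_compose[OF seg]) simp
  then show ?thesis by (simp add: transfer_def[abs_def] kk_eq_seg)
qed

lemma cohomologous_if_balanced:
  assumes "\<And>k. h N k = c * real (H p N k)"
  shows "cohomologous_const p q g"
proof -
  obtain B where B: "\<And>x. \<bar>transfer c x\<bar> \<le> B" using transfer_bounded by blast
  have "AE x in mu p q. g x = c + transfer c (Tp p x) - transfer c x"
    using AE_valid AE_nonmax
  proof eventually_elim
    case (elim x)
    from transfer_succ[OF elim(1) is_succ_Tp[OF elim] assms] show ?case by simp
  qed
  then show ?thesis unfolding cohomologous_const_def
    using transfer_measurable B by (intro exI[of _ c] exI[of _ "transfer c"]) auto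
qed

text \<open>\<open>s\<close> is the order of the zero of the polynomial at 1. It is finite because a
  zero polynomial would mean that g - c has total 0 over every tower of level
  \<open>N\<close>.\<close>

lemma tilted_factor:
  assumes "\<not> cohomologous_const p q g"
  shows "\<exists>c s E. tilted c = [:-1, 1:] ^ s * E \<and> s \<ge> 1 \<and> poly E 1 \<noteq> 0"
proof -
  \<comment> \<open>The integral of g: totals over the towers of level N, weighted by the cylinder
    measures q^N w^k. It is the value for which \<open>tilted c\<close> vanishes at 1.\<close>
  define c where "c = poly G w * q ^ N"
  have pw: "poly rp w * q = 1"
    using poly_1 by (simp add: f_def poly_pcompose mult.commute)
  have "(poly rp w) ^ N * q ^ N = 1" using pw by (simp flip: power_mult_distrib)
  then have root: "poly (tilted c) 1 = 0"
    by (simp add: tilted_def poly_pcompose poly_power c_def algebra_simps)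
  have nz: "tilted c \<noteq> 0"
  proof
    assume 0: "tilted c = 0"
    have "h N k = c * real (H p N k)" for k
    proof -
      have "coeff (tilted c) k = q ^ N * (w ^ k * (h N k - c * real (H p N k)))"
        by (simp add: tilted_def coeff_pcompose_linear coeff_G coeff_rp_power)
      then show ?thesis using 0 q0 w_pos by simp
    qed
    then show False using assms cohomologous_if_balanced by blast
  qed
  obtain E where E: "tilted c = [:-1, 1:] ^ order 1 (tilted c) * E" "\<not> [:-1, 1:] dvd E"
    using order_decomp[OF nz, of 1] by auto
  moreover have "poly E 1 \<noteq> 0" using E(2) by (simp add: poly_eq_0_iff_dvd)
  moreover have "order 1 (tilted c) \<ge> 1" using order_root[of "tilted c" 1] root nz by linarith
  ultimately show ?thesis by blast
qed

end

theorem mainTheorem5: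
  fixes p :: "nat poly" and q :: real and g :: "path \<Rightarrow> real" and N :: nat
  assumes "degree p \<ge> 1"
    and "\<forall>i\<le>degree p. coeff p i > 0"
    and "0 < q" and "q < 1 / real (coeff p 0)"
    and "cylindric g N"
    and "\<not> cohomologous_const p q g"
  shows "AE x in mu p q. \<exists>ns :: nat \<Rightarrow> nat. filterlim ns at_top sequentially \<and>
           (\<forall>j. N \<le> ns j \<and> Rg p g (ns j) (kk x (ns j)) > 0) \<and>
           (\<exists>\<phi>. continuous_on {0..1} \<phi> \<and>
              uniform_limit {0..1} (\<lambda>j. phi p g (ns j) (kk x (ns j))) \<phi> sequentially)"
proof -
  interpret adic_fun p q g N
    using assms by unfold_locales auto
  obtain c s E where *: "tilted c = [:-1, 1:] ^ s * E" "s \<ge> 1" "poly E 1 \<noteq> 0"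
    using tilted_factor[OF assms(6)] by blast
  interpret adic_curve p q g N c s E
    by unfold_locales (fact *)+
  \<comment> \<open>\<open>s\<close> depends only on g, so one null set serves.\<close>
  show ?thesis
    using AE_good_io[of s]
  proof eventually_elim
    case (elim x)
    show ?case by (rule limiting_curve) (use elim in blast)
  qed
qed

end
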